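(* Let $\Gamma$ be a connected negative definite plumbing tree with all genera zero, and let $h\in H$ (notation as in the context). (a) The restriction of $\mathcal L_h(\mathbf A,\mathcal T,l')$ to $V_{\mathcal N}$ depends only on those coordinates which are indexed by the nodes (that is, it depends only on $pr_{\mathcal N}(l')$ whenever $l'\in V_{\mathcal N}$). (b) The same is true for the counting function $Q_h$ associated with $Z_h(\mathbf t)$ as well. In other words, if we consider the restriction $$Z_h(\mathbf t_{\mathcal N}):=Z_h(\mathbf t)|_{t_v=1\text{ for all }v\notin\mathcal N},$$ then for any $l'\in L_{\mathcal N}$ the counting functions $\sum_{l''\not\ge l'}p_{l''}[l'']$ of $Z_h(\mathbf t)$ and of $Z_h(\mathbf t_{\mathcal N})$ are the same. (c) Consider the chamber decomposition of $\mathcal S_{\mathcal N}$ by intersections of type $\mathcal C_{\mathcal N}:=\mathcal C\cap\mathcal S_{\mathcal N}$, where $\mathcal C$ denotes a chamber (associated with the denominator of $Z$) such that $\mathrm{int}(\mathcal C\cap\mathcal S)\neq\emptyset$, and the intersection of $\mathcal C$ with the relative interior of $\mathcal S_{\mathcal N}$ is also non-empty. Then $$\mathrm{pc}^{\mathcal C}(Z_h(\mathbf t))=\mathrm{pc}^{\mathcal C_{\mathcal N}}(Z_h(\mathbf t_{\mathcal N})).$$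
   Context: **Graph.** $\Gamma$ is a connected tree with vertex set $\mathcal V$, all genera $0$, integer decorations and negative definite intersection form $(\,,\,)$ on $L=\bigoplus_{v\in\mathcal V}\mathbb ZE_v$. $L'=\{l'\in L\otimes\mathbb Q:(l',L)\subset\mathbb Z\}$, $H=L'/L$, and $[l']$ is the class of $l'$ in $H$. $E_v^*\in L'$ is defined by $(E_v^*,E_w)=-1$ if $v=w$ and $0$ otherwise; $\delta_v$ is the valency of $v$; $\mathcal N=\{v:\delta_v\ge3\}$ is the set of nodes. The vectors $a_1,\dots,a_d$ are the $E_v^*$ for the end vertices $v$ ($\delta_v=1$). $\mathcal S=\{x\in L\otimes\mathbb R:(x,E_v)\le0\ \forall v\}$ is the real Lipman cone. $V_{\mathcal N}=\mathbb R\langle E_n^*\rangle_{n\in\mathcal N}$, $\mathcal S_{\mathcal N}=\mathbb R_{\ge0}\langle E_n^*\rangle_{n\in\mathcal N}$, $L_{\mathcal N}=\mathbb Z\langle E_n\rangle_{n\in\mathcal N}$, and $pr_{\mathcal N}:L\otimes\mathbb R\to L_{\mathcal N}\otimes\mathbb R$ is the projection to the node coordinates; its restriction to $V_{\mathcal N}$ is an isomorphism onto $L_{\mathcal N}\otimes\mathbb R$. In each of these coordinate spaces, $l_1\ge l_2$ means that all coordinates of $l_1-l_2$ (with respect to the $E_v$) are $\ge0$. **Polytopes.** $\mathbf A$ is the matrix with columns $|H|a_i$. For $l'\in L'$ let $P^{(l')}$ be the closure of $\{\mathbf x\in(\mathbb R_{\ge0})^d:\sum_ix_ia_i\not\ge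 l'\}$, and let $\mathcal T$ be the collection of its facets other than the coordinate facets $P^{(l')}\cap\{x_i=0\}$. Then $\mathcal L_h(\mathbf A,\mathcal T,l')$ is the number of points $\mathbf x\in\mathbb Z^d$ of $P^{(l')}$ not lying on the facets from $\mathcal T$ and with $[\sum_ix_ia_i]=h$, i.e. $\#\{\mathbf x\in(\mathbb Z_{\ge0})^d:[\sum_ix_ia_i]=h,\ \sum_ix_ia_i\not\ge l'\}$. **Series and counting functions.** For $l'=\sum l'_vE_v\in L'$, $\mathbf t^{l'}=\prod_vt_v^{l'_v}$. $Z(\mathbf t)=\sum p_{l'}\mathbf t^{l'}$ is the Taylor expansion at the origin of $\prod_{v\in\mathcal V}(1-\mathbf t^{E_v^*})^{\delta_v-2}$, and $Z_h(\mathbf t)=\sum_{[l']=h}p_{l'}\mathbf t^{l'}$. The counting function of $Z_h(\mathbf t)$ is $Q_h(l')=\sum_{[l'']=h,\ l''\not\ge l'}p_{l''}$, for $l'\in L'$. The counting function of $Z_h(\mathbf t_{\mathcal N})$ is defined in the same way in terms of the node exponents only: $Q_h^{\mathcal N}(x)=\sum_{[l'']=h,\ pr_{\mathcal N}(l'')\not\ge x}p_{l''}$ for $x\in L_{\mathcal N}\otimes\mathbb Q$ (the decomposition over the original group $H$ is made before the substitution $t_v=1$). **Chambers.** Consider the vectors $a_1,\dots,a_d$ and $-E_v$ ($v\in\mathcal V$). For each subset forming a basis of $L\otimes\mathbb R$ take the closed positive cone it generates; a chamber is a closed cone with non-empty interior of the common refinement of all these cones. **Periodic constants.** A quasipolynomial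 is a function on a lattice which is polynomial on each coset of a finite index sublattice. Let $\mathcal K\subset L\otimes\mathbb R$ be a closed cone whose affine hull $\mathrm{aff}(\mathcal K)$ has positive dimension. If there are $l'_*\in\mathcal K$, a finite index sublattice $\widetilde L\subset L$ and a quasipolynomial $\widetilde Q_h$ on $\widetilde L\cap\mathrm{aff}(\mathcal K)$ with $Q_h=\widetilde Q_h$ on $\widetilde L\cap(l'_*+\mathcal K)$, then $\mathrm{pc}^{\mathcal K}(Z_h(\mathbf t)):=\widetilde Q_h(0)$. It exists for every chamber $\mathcal C$. Similarly, $\mathrm{pc}^{\mathcal C_{\mathcal N}}(Z_h(\mathbf t_{\mathcal N}))$ is $\widetilde Q(0)$, where $V_{\mathcal N}$ is identified with $L_{\mathcal N}\otimes\mathbb R$ by $pr_{\mathcal N}$, and $\widetilde Q$ is a quasipolynomial on $\widetilde L\cap\mathrm{aff}(\mathcal C_{\mathcal N})$ with $Q_h^{\mathcal N}(pr_{\mathcal N}(l'))=\widetilde Q(l')$ for all $l'\in\widetilde L\cap(l'_*+\mathcal C_{\mathcal N})$, for some finite index sublattice $\widetilde L\subset L$ and some $l'_*\in\mathcal C_{\mathcal N}$. *)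

theory Defs
  imports "HOL-Analysis.Analysis" "HOL-Computational_Algebra.Formal_Power_Series"
begin

section \<open>Plumbing trees\<close>

text \<open>The vertex set is the finite type \<open>'v\<close>; all genera are zero, so a vertex carries only its
  integer decoration (Euler number).\<close>

record 'v plumbing =
  adj :: "'v \<Rightarrow> 'v \<Rightarrow> bool"
  euler :: "'v \<Rightarrow> int"

definition valency :: "'v::finite plumbing \<Rightarrow> 'v \<Rightarrow> nat" where
  "valency G v = card {w. adj G v w}"

definition nodes :: "'v::finite plumbing \<Rightarrow> 'v set" where
  "nodes G = {v. valency G v \<ge> 3}"

definition end_vertices :: "'v::finite plumbing \<Rightarrow> 'v set" where
  "end_vertices G = {v. valency G v = 1}"

definition is_cycle :: "'v plumbing \<Rightarrow> 'v list \<Rightarrow> bool" where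
  "is_cycle G c \<longleftrightarrow> length c \<ge> 3 \<and> distinct c \<and>
     (\<forall>i. Suc i < length c \<longrightarrow> adj G (c ! i) (c ! Suc i)) \<and> adj G (last c) (hd c)"

definition is_tree :: "'v plumbing \<Rightarrow> bool" where
  "is_tree G \<longleftrightarrow> symp (adj G) \<and> irreflp (adj G) \<and>
     (\<forall>v w. (adj G)\<^sup>*\<^sup>* v w) \<and> (\<nexists>c. is_cycle G c)"

text \<open>\<open>L \<otimes> \<real>\<close> is \<open>real ^ 'v\<close>; the basis element \<open>E\<^sub>v\<close> is \<open>axis v 1\<close>, so that \<open>x $ v\<close> is the
  \<open>E\<^sub>v\<close>-coordinate of \<open>x\<close> and \<open>\<le>\<close> is the coordinatewise order of the library.\<close>

definition intersection_matrix :: "'v::finite plumbing \<Rightarrow> real ^ 'v ^ 'v" where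
  "intersection_matrix G =
     (\<chi> v w. if v = w then of_int (euler G v) else if adj G v w then 1 else 0)"

definition iform :: "'v::finite plumbing \<Rightarrow> real ^ 'v \<Rightarrow> real ^ 'v \<Rightarrow> real" where
  "iform G x y = x \<bullet> (intersection_matrix G *v y)"

definition negative_definite :: "'v::finite plumbing \<Rightarrow> bool" where
  "negative_definite G \<longleftrightarrow> (\<forall>x. x \<noteq> 0 \<longrightarrow> iform G x x < 0)"

definition plumbing_tree :: "'v::finite plumbing \<Rightarrow> bool" where
  "plumbing_tree G \<longleftrightarrow> is_tree G \<and> negative_definite G"


section \<open>Lattices and cones\<close>

definition latt :: "(real ^ 'v::finite) set" where
  "latt = {x. \<forall>v. x $ v \<in> \<int>}"

definition dual_latt :: "'v::finite plumbing \<Rightarrow> (real ^ 'v) set" where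
  "dual_latt G = {x. (\<forall>v. x $ v \<in> \<rat>) \<and> (\<forall>y\<in>latt. iform G x y \<in> \<int>)}"

definition cls :: "'v::finite plumbing \<Rightarrow> real ^ 'v \<Rightarrow> (real ^ 'v) set" where
  "cls G x = {y \<in> dual_latt G. y - x \<in> latt}"

text \<open>The elements of \<open>H = L'/L\<close> are the cosets \<open>[l']\<close>; only this set is needed, not the group
  structure.\<close>

definition Hgroup :: "'v::finite plumbing \<Rightarrow> (real ^ 'v) set set" where
  "Hgroup G = cls G ` dual_latt G"

definition dual :: "'v::finite plumbing \<Rightarrow> 'v \<Rightarrow> real ^ 'v" where
  "dual G v = (THE x. x \<in> dual_latt G \<and>
     (\<forall>w. iform G x (axis w 1) = (if v = w then -1 else 0)))"

definition lipman_cone :: "'v::finite plumbing \<Rightarrow> (real ^ 'v) set" where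
  "lipman_cone G = {x. \<forall>v. iform G x (axis v 1) \<le> 0}"

definition node_space :: "'v::finite plumbing \<Rightarrow> (real ^ 'v) set" where
  "node_space G = span (dual G ` nodes G)"

definition node_cone :: "'v::finite plumbing \<Rightarrow> (real ^ 'v) set" where
  "node_cone G = convex_cone hull (dual G ` nodes G)"

text \<open>\<open>L\<^sub>\<N> \<otimes> \<real>\<close> is identified with the subspace of vectors of \<open>real ^ 'v\<close> all of whose coordinates
  outside the nodes vanish. On this subspace \<open>\<le>\<close> compares exactly the node coordinates.\<close>

definition node_latt :: "'v::finite plumbing \<Rightarrow> (real ^ 'v) set" where
  "node_latt G = {x \<in> latt. \<forall>v. v \<notin> nodes G \<longrightarrow> x $ v = 0}"

definition pr :: "'v::finite plumbing \<Rightarrow> real ^ 'v \<Rightarrow> real ^ 'v" where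
  "pr G x = (\<chi> v. if v \<in> nodes G then x $ v else 0)"


section \<open>Counting lattice points\<close>

text \<open>Elements of \<open>(\<int>\<^sub>\<ge>\<^sub>0)\<^sup>d\<close> are the functions \<open>'v \<Rightarrow> nat\<close> vanishing outside the end vertices;
  \<open>end_sum G x\<close> is \<open>\<Sum>\<^sub>i x\<^sub>i a\<^sub>i\<close>.\<close>

definition end_points :: "'v::finite plumbing \<Rightarrow> ('v \<Rightarrow> nat) set" where
  "end_points G = {x. \<forall>v. v \<notin> end_vertices G \<longrightarrow> x v = 0}"

definition end_sum :: "'v::finite plumbing \<Rightarrow> ('v \<Rightarrow> nat) \<Rightarrow> real ^ 'v" where
  "end_sum G x = (\<Sum>v\<in>end_vertices G. of_nat (x v) *\<^sub>R dual G v)"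

text \<open>\<open>Lcount G h l'\<close> is \<open>\<L>\<^sub>h(A, \<T>, l')\<close>: leaving out the facets in \<open>\<T>\<close> from the closure of
  \<open>{x \<ge> 0. \<Sum>\<^sub>i x\<^sub>i a\<^sub>i \<notge> l'}\<close> amounts to counting the integral points of this set itself.\<close>

definition Lcount :: "'v::finite plumbing \<Rightarrow> (real ^ 'v) set \<Rightarrow> real ^ 'v \<Rightarrow> nat" where
  "Lcount G h l = card {x \<in> end_points G. cls G (end_sum G x) = h \<and> \<not> l \<le> end_sum G x}"

definition Lcount_nodes :: "'v::finite plumbing \<Rightarrow> (real ^ 'v) set \<Rightarrow> real ^ 'v \<Rightarrow> nat" where
  "Lcount_nodes G h x =
     card {n \<in> end_points G. cls G (end_sum G n) = h \<and> \<not> x \<le> pr G (end_sum G n)}"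


section \<open>The series \<open>Z\<close> and its counting functions\<close>

text \<open>\<open>zcoeff G l'\<close> is the coefficient \<open>p\<^sub>l\<^sub>'\<close> of \<open>t\<^sup>l\<^sup>'\<close> in
  \<open>\<Prod>\<^sub>v (1 - t\<^bsup>E\<^sub>v\<^sup>*\<^esup>)\<^bsup>\<delta>\<^sub>v - 2\<^esup>\<close>: each factor is the one-variable power series
  \<open>(1 - X)\<^bsup>\<delta>\<^sub>v - 2\<^esup>\<close> at \<open>X = t\<^bsup>E\<^sub>v\<^sup>*\<^esup>\<close>, and the product is expanded.\<close>

definition zcoeff :: "'v::finite plumbing \<Rightarrow> real ^ 'v \<Rightarrow> real" where
  "zcoeff G l = (\<Sum>n | (\<Sum>v\<in>UNIV. of_nat (n v) *\<^sub>R dual G v) = l.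
     \<Prod>v\<in>UNIV. fps_nth (power_int (1 - fps_X :: real fps) (int (valency G v) - 2)) (n v))"

text \<open>All coordinates of the \<open>E\<^sub>v\<^sup>*\<close> are positive, so only finitely many nonzero coefficients
  contribute to the following sums; the condition \<open>zcoeff G l \<noteq> 0\<close> makes the index sets finite.\<close>

definition Qcount :: "'v::finite plumbing \<Rightarrow> (real ^ 'v) set \<Rightarrow> real ^ 'v \<Rightarrow> real" where
  "Qcount G h l' =
     (\<Sum>l | l \<in> dual_latt G \<and> zcoeff G l \<noteq> 0 \<and> cls G l = h \<and> \<not> l' \<le> l. zcoeff G l)"

definition Qcount_nodes :: "'v::finite plumbing \<Rightarrow> (real ^ 'v) set \<Rightarrow> real ^ 'v \<Rightarrow> real" where
  "Qcount_nodes G h x =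
     (\<Sum>l | l \<in> dual_latt G \<and> zcoeff G l \<noteq> 0 \<and> cls G l = h \<and> \<not> x \<le> pr G l. zcoeff G l)"


section \<open>Chambers\<close>

definition chamber_vectors :: "'v::finite plumbing \<Rightarrow> (real ^ 'v) set" where
  "chamber_vectors G = dual G ` end_vertices G \<union> range (\<lambda>v. - axis v 1)"

definition basis_cones :: "'v::finite plumbing \<Rightarrow> (real ^ 'v) set set" where
  "basis_cones G = {convex_cone hull B |B. B \<subseteq> chamber_vectors G \<and> independent B \<and> span B = UNIV}"

text \<open>The cell of the common refinement at a point \<open>x\<close> is the intersection of all basis cones
  containing \<open>x\<close>; the chambers are the cells with non-empty interior.\<close>

definition chamber :: "'v::finite plumbing \<Rightarrow> (real ^ 'v) set \<Rightarrow> bool" where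
  "chamber G C \<longleftrightarrow>
     (\<exists>x \<in> \<Union>(basis_cones G). C = \<Inter>{\<sigma> \<in> basis_cones G. x \<in> \<sigma>}) \<and> interior C \<noteq> {}"


section \<open>Quasipolynomials and periodic constants\<close>

definition finite_index_sublattice :: "(real ^ 'v::finite) set \<Rightarrow> (real ^ 'v) set \<Rightarrow> bool" where
  "finite_index_sublattice M \<Lambda> \<longleftrightarrow> M \<subseteq> \<Lambda> \<and> 0 \<in> M \<and> (\<forall>x\<in>M. \<forall>y\<in>M. x - y \<in> M) \<and>
     finite ((\<lambda>x. (+) x ` M) ` \<Lambda>)"

definition quasipolynomial_on :: "(real ^ 'v::finite) set \<Rightarrow> (real ^ 'v \<Rightarrow> real) \<Rightarrow> bool" where
  "quasipolynomial_on \<Lambda> f \<longleftrightarrow> (\<exists>M. finite_index_sublattice M \<Lambda> \<and>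
     (\<forall>x\<in>\<Lambda>. \<exists>g. real_polynomial_function g \<and> (\<forall>y\<in>M. f (x + y) = g (x + y))))"

text \<open>\<open>is_pc K f q\<close>: along the cone \<open>K\<close> the function \<open>f\<close> has the periodic constant \<open>q\<close>. As
  periodic constants are only defined for cones with a positive dimensional affine hull, this is
  part of the definition.\<close>

definition is_pc :: "(real ^ 'v::finite) set \<Rightarrow> (real ^ 'v \<Rightarrow> real) \<Rightarrow> real \<Rightarrow> bool" where
  "is_pc K f q \<longleftrightarrow> 0 < aff_dim K \<and>
     (\<exists>l\<in>K. \<exists>M f'. finite_index_sublattice M latt \<and> quasipolynomial_on (M \<inter> affine hull K) f' \<and>
        (\<forall>x \<in> M \<inter> (+) l ` K. f x = f' x) \<and> q = f' 0)"

definition pc :: "(real ^ 'v::finite) set \<Rightarrow> (real ^ 'v \<Rightarrow> real) \<Rightarrow> real" where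
  "pc K f = (THE q. is_pc K f q)"

text \<open>\<open>pc_series\<close> is \<open>pc\<^bsup>K\<^esup>(Z\<^sub>h(t))\<close> for a cone \<open>K\<close> in \<open>L \<otimes> \<real>\<close>, and \<open>pc_node_series\<close> is
  \<open>pc\<^bsup>K\<^esup>(Z\<^sub>h(t\<^sub>\<N>))\<close> for a cone \<open>K\<close> in \<open>V\<^sub>\<N>\<close>, transported to node coordinates by \<open>pr\<close>.
  The \<open>_exists\<close> predicates say that the periodic constant is well defined.\<close>

definition pc_series :: "'v::finite plumbing \<Rightarrow> (real ^ 'v) set \<Rightarrow> (real ^ 'v) set \<Rightarrow> real" where
  "pc_series G h K = pc K (Qcount G h)"

definition pc_series_exists :: "'v::finite plumbing \<Rightarrow> (real ^ 'v) set \<Rightarrow> (real ^ 'v) set \<Rightarrow> bool" where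
  "pc_series_exists G h K \<longleftrightarrow> (\<exists>!q. is_pc K (Qcount G h) q)"

definition pc_node_series :: "'v::finite plumbing \<Rightarrow> (real ^ 'v) set \<Rightarrow> (real ^ 'v) set \<Rightarrow> real" where
  "pc_node_series G h K = pc K (\<lambda>l. Qcount_nodes G h (pr G l))"

definition pc_node_series_exists ::
    "'v::finite plumbing \<Rightarrow> (real ^ 'v) set \<Rightarrow> (real ^ 'v) set \<Rightarrow> bool" where
  "pc_node_series_exists G h K \<longleftrightarrow> (\<exists>!q. is_pc K (\<lambda>l. Qcount_nodes G h (pr G l)) q)"

end

theory Submission
  imports Defs
begin

text \<open>Write \<open>(-l, E\<^sub>w) = n\<^sub>w\<close>, so that \<open>l = \<Sum>\<^sub>w n\<^sub>w E\<^sub>w\<^sup>*\<close>.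

  Parts (a) and (b): if \<open>l \<in> V\<^sub>\<N>\<close> and \<open>l''\<close> is in the support of \<open>Z\<close>, then \<open>y = l'' - l\<close>
  satisfies \<open>(y, E\<^sub>w) \<le> 0\<close> for all \<open>w \<notin> \<N>\<close>; by the minimum principle for the negative definite form,
  \<open>y\<close> is effective as soon as its node coordinates are nonnegative.

  Part (c): let \<open>r\<close> be the representative of \<open>h\<close> with coordinates in \<open>[0, 1)\<close>. For \<open>l \<in> L\<close> such that
  both \<open>l\<close> and \<open>l + E\<^sub>v\<close> lie in the region \<open>n\<^sub>w \<ge> max 0 (\<delta>\<^sub>w - 2)\<close>, the difference
  \<open>Q\<^sub>h(l + E\<^sub>v) - Q\<^sub>h(l)\<close> is the sum of the coefficients of \<open>Z\<close> at \<open>l + r + k\<close> with \<open>k \<ge> 0\<close> and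
  \<open>k\<^sub>v = 0\<close>. Summing over \<open>k\<^sub>w\<close> one vertex at a time, from the ends of the tree towards \<open>v\<close>, this is
  \<open>1 - (l + r, E\<^sub>v)\<close>, which is also the increment of a quadratic polynomial \<open>\<chi>\<close>. Paths inside the region
  show that \<open>Q\<^sub>h(l) = \<chi>(l + r) + c\<close> with a single constant \<open>c\<close> wherever \<open>n\<^sub>w \<ge> 0\<close> off the nodes
  and \<open>n\<^sub>w\<close> is large at the nodes. This covers both the deep interior of the Lipman cone and the
  deep relative interior of \<open>S\<^sub>\<N>\<close>. Finally a chamber whose interior meets the Lipman cone is contained in it,
  so both periodic constants are \<open>\<chi>(r) + c\<close>; they are unique because the cones are rational.\<close>

section \<open>Summation over a rooted tree\<close>

text \<open>The fractional shift \<open>r\<close> is the obstacle: summing over the height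
  \<open>k w\<close> need not give a power of \<open>1 - X\<close>, and the resulting series agrees
  with \<open>1 / (1 - X)\<close> only beyond a bound depending on the height of the parent. These
  bounds have to fit together along every branch. Their slopes are the coordinates of
  \<open>E\<^sub>v\<^sup>*\<close>, which are positive and harmonic at every vertex except
  \<open>v\<close>: the shares of the children of \<open>w\<close> add up exactly, and only rounding
  is lost. Rounding up \<open>\<delta>\<^sub>w - 1\<close> shares costs less than
  \<open>\<delta>\<^sub>w - 1\<close>, so a reserve of \<open>\<delta>\<^sub>w - 2\<close> suffices
  for a comparison of integers; this is the origin of \<open>max 0 (\<delta>\<^sub>w - 2)\<close>.
  The root keeps exponent -2, whose coefficients are linear, hence a quadratic function. On
  \<open>S\<^sub>\<N>\<close> the degrees off the nodes vanish, so there is no room to borrow from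
  them: a path into the deep region must keep them nonnegative after every single step.\<close>

lemma fps_eventually_one_mult:
  fixes F H :: "real fps"
  assumes F: "\<And>n. n \<ge> a \<Longrightarrow> fps_nth F n = 1" and H: "\<And>n. n \<ge> b \<Longrightarrow> fps_nth H n = 1"
    and n: "n \<ge> a + b"
  shows "fps_nth ((1 - fps_X) * F * H) n = 1"
proof -
  \<comment> \<open>\<open>D\<close> is a polynomial of degree at most \<open>a\<close> whose
    coefficients add up to \<open>fps_nth F a = 1\<close>. Convolving it with a series that is
    constantly 1 from \<open>n - a\<close> to \<open>n\<close> gives 1.\<close>
  define D where "D = (1 - fps_X) * F"
  have D_nth: "fps_nth D i = fps_nth F i - (if i = 0 then 0 else fps_nth F (i - 1))" for i
    by (simp add: D_def left_diff_distrib fps_X_mult_nth)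
  have D0: "fps_nth D i = 0" if "i > a" for i
    using that by (simp add: D_nth F)
  have tele: "(\<Sum>i\<le>j. fps_nth D i) = fps_nth F j" for j
    by (induction j) (auto simp: D_nth)
  have "fps_nth (D * H) n = (\<Sum>i=0..n. fps_nth D i * fps_nth H (n - i))"
    by (simp add: fps_mult_nth)
  also have "\<dots> = (\<Sum>i\<in>{..a}. fps_nth D i * fps_nth H (n - i))"
    using n by (intro sum.mono_neutral_right) (auto simp: D0)
  also have "\<dots> = (\<Sum>i\<in>{..a}. fps_nth D i)"
    using n by (intro sum.cong) (auto simp: H)
  also have "\<dots> = 1"
    using F[of a] by (simp add: tele)
  finally show ?thesis by (simp add: D_def)
qed

lemma fps_inverse_square_nth:
  fixes g :: "real fps"
  assumes "(1 - fps_X)^2 * g = 1"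
  shows "fps_nth g n = real n + 1"
proof -
  define h where "h = (1 - fps_X) * g"
  have h: "fps_nth h i = fps_nth g i - (if i = 0 then 0 else fps_nth g (i - 1))" for i
    by (simp add: h_def left_diff_distrib fps_X_mult_nth)
  have "(1 - fps_X) * h = 1"
    using assms by (simp add: h_def power2_eq_square mult.assoc)
  then have "fps_nth ((1 - fps_X) * h) i = fps_nth 1 i" for i by simp
  then have h1: "fps_nth h i - (if i = 0 then 0 else fps_nth h (i - 1)) = (if i = 0 then 1 else 0)" for i
    unfolding left_diff_distrib by (simp add: fps_X_mult_nth)
  have h2: "fps_nth h i = 1" for i
  proof (induction i)
    case 0 show ?case using h1[of 0] by simp
  next
    case (Suc i) then show ?case using h1[of "Suc i"] by simp
  qed
  show ?thesis
  proof (induction n)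
    case 0 show ?case using h[of 0] h2[of 0] by simp
  next
    case (Suc n) then show ?case using h[of "Suc n"] h2[of "Suc n"] by simp
  qed
qed

text \<open>A tree grown from its root by attaching leaves: a new vertex has exactly one neighbour
  among those present. Induction over this predicate, read backwards, strips the last leaf, which is
  the order in which heights are summed.\<close>

inductive rooted :: "('v \<Rightarrow> 'v \<Rightarrow> bool) \<Rightarrow> 'v \<Rightarrow> 'v set \<Rightarrow> bool" for E v where
  rooted_root: "rooted E v {v}"
| rooted_grow: "rooted E v A \<Longrightarrow> w \<notin> A \<Longrightarrow> p \<in> A \<Longrightarrow> {u \<in> A. E w u} = {p} \<Longrightarrow> rooted E v (insert w A)"

lemma rooted_root_mem: "rooted E v A \<Longrightarrow> v \<in> A"
  by (induction rule: rooted.induct) auto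

text \<open>Degrees become negative when a height is too large for its neighbours; such terms are
  zero terms instead of separate cases.\<close>

definition int_coeff :: "real fps \<Rightarrow> int \<Rightarrow> real" where
  "int_coeff g n = (if n < 0 then 0 else fps_nth g (nat n))"

definition height_fun :: "'v set \<Rightarrow> 'v \<Rightarrow> ('v \<Rightarrow> nat) set" where
  "height_fun A v = {k. k v = 0 \<and> (\<forall>u. u \<notin> A \<longrightarrow> k u = 0)}"

text \<open>With \<open>M w\<close> the degree \<open>n\<^sub>w\<close> of \<open>m + r\<close> and
  \<open>b w = - e\<^sub>w\<close>, the index at \<open>w\<close> is the degree of
  \<open>m + r + k\<close>; for \<open>A = UNIV\<close> and the factors of \<open>Z\<close> the
  product is a coefficient of \<open>Z\<close>. Neighbours outside \<open>A\<close> are absent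
  because their heights are already summed into \<open>G\<close>, which therefore depends on
  \<open>k w\<close>.\<close>

definition tree_term ::
  "('v::finite \<Rightarrow> 'v \<Rightarrow> bool) \<Rightarrow> ('v \<Rightarrow> int) \<Rightarrow> ('v \<Rightarrow> int) \<Rightarrow> 'v set \<Rightarrow> ('v \<Rightarrow> nat \<Rightarrow> real fps) \<Rightarrow> ('v \<Rightarrow> nat) \<Rightarrow> real" where
  "tree_term E b M A G k =
     (\<Prod>w\<in>A. int_coeff (G w (k w)) (M w + b w * int (k w) - (\<Sum>u | u \<in> A \<and> E w u. int (k u))))"

text \<open>Eliminating one height is a Cauchy product, since height \<open>j\<close> lowers the
  degree of its neighbour by \<open>j\<close>. The factor \<open>c\<close> stands for the rest of
  the tree term; restricting to the support is essential, as a sum over an infinite index set is 0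
  by default.\<close>

lemma int_coeff_mult:
  "int_coeff (Abs_fps F * g) n = (\<Sum>j | F j * int_coeff g (n - int j) * c \<noteq> 0. F j * int_coeff g (n - int j))"
  if "c \<noteq> 0"
proof (cases "n < 0")
  case True
  then have "int_coeff g (n - int j) = 0" for j by (simp add: int_coeff_def)
  with True show ?thesis by (simp add: int_coeff_def)
next
  case False
  then obtain m where m: "n = int m" by (metis nat_eq_iff2 not_le)
  have *: "int_coeff g (int m - int j) = (if j \<le> m then fps_nth g (m - j) else 0)" for j
    by (auto simp: int_coeff_def nat_diff_distrib)
  have "int_coeff (Abs_fps F * g) n = (\<Sum>j=0..m. F j * fps_nth g (m - j))"
    by (simp add: int_coeff_def m fps_mult_nth)
  also have "\<dots> = (\<Sum>j=0..m. F j * int_coeff g (int m - int j))"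
    by (intro sum.cong) (auto simp: *)
  also have "\<dots> = (\<Sum>j | F j * int_coeff g (n - int j) * c \<noteq> 0. F j * int_coeff g (n - int j))"
    unfolding m using that by (intro sum.mono_neutral_right) (auto simp: * split: if_splits)
  finally show ?thesis .
qed

text \<open>Fubini for finite support, with fibres over \<open>k(w := 0)\<close>. A nonzero value of
  \<open>g\<close> forces a nonempty fibre, so the support of \<open>g\<close> lies in the image of
  a finite set.\<close>

lemma finite_support_eliminate:
  fixes f :: "('v \<Rightarrow> nat) \<Rightarrow> real"
  assumes w: "w \<notin> A" "w \<noteq> v" "v \<in> A"
    and fin: "finite {k \<in> height_fun (insert w A) v. f k \<noteq> 0}"
    and inner: "\<And>k. k \<in> height_fun A v \<Longrightarrow> g k = (\<Sum>j | f (k(w := j)) \<noteq> 0. f (k(w := j)))"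
  shows "finite {k \<in> height_fun A v. g k \<noteq> 0}" (is "finite ?S'")
    and "sum f {k \<in> height_fun (insert w A) v. f k \<noteq> 0} = sum g {k \<in> height_fun A v. g k \<noteq> 0}"
proof -
  let ?S = "{k \<in> height_fun (insert w A) v. f k \<noteq> 0}"
  let ?p = "\<lambda>k::'v \<Rightarrow> nat. k(w := 0)"
  have im: "?p ` ?S \<subseteq> height_fun A v"
    using w by (auto simp: height_fun_def)
  have fib: "sum f {k \<in> ?S. ?p k = k'} = g k'" if k': "k' \<in> height_fun A v" for k'
  proof -
    have k'w: "k' w = 0" using k' w by (auto simp: height_fun_def)
    have "bij_betw (\<lambda>j. k'(w := j)) {j. f (k'(w := j)) \<noteq> 0} {k \<in> ?S. ?p k = k'}"
    proof (rule bij_betw_byWitness[where f' = "\<lambda>k. k w"])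
      show "(\<lambda>j. k'(w := j)) ` {j. f (k'(w := j)) \<noteq> 0} \<subseteq> {k \<in> ?S. ?p k = k'}"
        using k' w k'w by (auto simp: height_fun_def fun_eq_iff)
    qed (auto simp: fun_upd_idem)
    then have "sum f {k \<in> ?S. ?p k = k'} = (\<Sum>j | f (k'(w := j)) \<noteq> 0. f (k'(w := j)))"
      by (simp add: sum.reindex_bij_betw)
    then show ?thesis using inner[OF k'] by simp
  qed
  have sub: "?S' \<subseteq> ?p ` ?S"
  proof
    fix k assume k: "k \<in> ?S'"
    then have "sum f {l \<in> ?S. ?p l = k} \<noteq> 0" using fib by auto
    then have "{l \<in> ?S. ?p l = k} \<noteq> {}" by (metis sum.empty)
    then show "k \<in> ?p ` ?S" by blast
  qed
  show fin': "finite ?S'" using sub fin finite_subset by blast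
  have "sum f ?S = (\<Sum>k'\<in>?p ` ?S. sum f {k \<in> ?S. ?p k = k'})"
    by (rule sum.image_gen[OF fin])
  also have "\<dots> = sum g (?p ` ?S)"
    using im fib by (intro sum.cong) auto
  also have "\<dots> = sum g ?S'"
    using sub im fin by (intro sum.mono_neutral_right) auto
  finally show "sum f ?S = sum g ?S'" .
qed


lemma rooted_has_parent:
  assumes "rooted E v A" "symp E"
  shows "\<And>w. w \<in> A \<Longrightarrow> w \<noteq> v \<Longrightarrow> {u \<in> A. E w u} \<noteq> {}"
  using assms by (induction rule: rooted.induct) blast+

text \<open>The least height at \<open>c\<close> for which \<open>r c + k c\<close> reaches the
  value at \<open>c\<close> of the multiple of \<open>om\<close> that equals \<open>r w + j\<close>
  at \<open>w\<close>.\<close>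

definition cutoff :: "('v \<Rightarrow> real) \<Rightarrow> ('v \<Rightarrow> real) \<Rightarrow> 'v \<Rightarrow> nat \<Rightarrow> 'v \<Rightarrow> nat" where
  "cutoff om r w j c = nat \<lceil>(r w + real j) * om c / om w - r c\<rceil>"

text \<open>Put \<open>s = r w + j\<close> and \<open>P = r p + q\<close>. By harmonicity at
  \<open>w\<close> the shares of the neighbours other than \<open>p\<close> add up to
  \<open>b w * s - s * om p / om w\<close>. The degree left at \<open>w\<close> exceeds this by
  \<open>N w + s * om p / om w - P\<close>, and the assumptions make that large enough to round all
  shares up.\<close>

lemma leaf_cutoff_bound:
  fixes E :: "'v::finite \<Rightarrow> 'v \<Rightarrow> bool" and om r N :: "'v \<Rightarrow> real" and b M :: "'v \<Rightarrow> int"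
  assumes om: "\<And>u. om u > 0" and r: "\<And>u. 0 \<le> r u" "\<And>u. r u < 1"
    and harm: "of_int (b w) * om w = (\<Sum>u | E w u. om u)"
    and M: "of_int (M w) = N w + of_int (b w) * r w - (\<Sum>u | E w u. r u)"
    and wp: "E w p"
    and N: "real (card {u. E w u} - 2) \<le> N w"
    and start: "(r p + real q) * om w \<le> (r w + real j) * om p \<or>
      q = 0 \<and> real (card {u. E w u} - 2) + 1 \<le> N w"
  shows "int (\<Sum>c | E w c \<and> c \<noteq> p. cutoff om r w j c) \<le> M w + b w * int j - int q"
proof -
  define s P where "s = r w + real j" and "P = r p + real q"
  define C where "C = {c. E w c \<and> c \<noteq> p}"
  define x where "x c = s * om c / om w - r c" for c
  define LHS where "LHS = M w + b w * int j - int q"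
  have s0: "s \<ge> 0" using r(1)[of w] by (simp add: s_def)
  have nb: "{u. E w u} = insert p C" "p \<notin> C" "finite C" using wp by (auto simp: C_def)
  have cardC: "card {u. E w u} = Suc (card C)" using nb by simp
  have sum_om: "(\<Sum>c\<in>C. om c) = of_int (b w) * om w - om p"
    using harm nb by simp
  have "(\<Sum>c\<in>C. x c) = s * (\<Sum>c\<in>C. om c) / om w - (\<Sum>c\<in>C. r c)"
    by (simp add: x_def sum_subtractf sum_distrib_left sum_divide_distrib)
  also have "s * (\<Sum>c\<in>C. om c) / om w = of_int (b w) * s - s * om p / om w"
    using om[of w] by (simp add: sum_om field_simps)
  finally have sx: "(\<Sum>c\<in>C. x c) = of_int (b w) * s - s * om p / om w - (\<Sum>c\<in>C. r c)" .
  have "real_of_int LHS = N w + of_int (b w) * s - P - (\<Sum>c\<in>C. r c)"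
    using nb by (simp add: LHS_def M s_def P_def algebra_simps)
  with sx have diff: "real_of_int LHS - (\<Sum>c\<in>C. x c) = N w + s * om p / om w - P" by simp
  have gap: "real (card C - 1) \<le> real_of_int LHS - (\<Sum>c\<in>C. x c)"
    and gap0: "C = {} \<Longrightarrow> real (card C - 1) \<le> real_of_int LHS"
  proof -
    show "real (card C - 1) \<le> real_of_int LHS - (\<Sum>c\<in>C. x c)"
      using start
    proof
      assume "(r p + real q) * om w \<le> (r w + real j) * om p"
      then have "P \<le> s * om p / om w" using om[of w] by (simp add: P_def s_def field_simps)
      then show ?thesis using diff N cardC by simp
    next
      \<comment> \<open>The case of the root as parent: its height is 0, so
        \<open>P = r p < 1\<close>, and the extra unit in \<open>N w\<close> pays for it without
        comparing slopes.\<close>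
      assume *: "q = 0 \<and> real (card {u. E w u} - 2) + 1 \<le> N w"
      then have "P < 1" using r(2)[of p] by (simp add: P_def)
      moreover have "0 \<le> s * om p / om w" using s0 om[of p] om[of w] by simp
      ultimately show ?thesis using diff * cardC by simp
    qed
    then show "C = {} \<Longrightarrow> real (card C - 1) \<le> real_of_int LHS" by simp
  qed
  have x_gt: "x c > -1" for c
  proof -
    have "0 \<le> s * om c / om w" using s0 om[of c] om[of w] by simp
    then show ?thesis using r(2)[of c] by (simp add: x_def)
  qed
  \<comment> \<open>As \<open>x c > -1\<close>, the ceiling is nonnegative and \<open>nat\<close> in
    \<open>cutoff\<close> clips nothing.\<close>
  have nat_ceil: "int (nat \<lceil>x c\<rceil>) = \<lceil>x c\<rceil>" for c
    using x_gt[of c] by (simp add: ceiling_le_iff le_ceiling_iff)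
  have "(\<Sum>c\<in>C. \<lceil>x c\<rceil>) \<le> LHS"
  proof (cases "C = {}")
    case True
    then show ?thesis using gap0 by simp
  next
    case False
    have "real_of_int (\<Sum>c\<in>C. \<lceil>x c\<rceil>) = (\<Sum>c\<in>C. of_int \<lceil>x c\<rceil>)" by simp
    also have "\<dots> < (\<Sum>c\<in>C. x c + 1)"
      using False nb(3) by (intro sum_strict_mono) (auto simp: ceiling_correct less_eq_real_def, linarith+)
    also have "\<dots> = (\<Sum>c\<in>C. x c) + real (card C)" by (simp add: sum.distrib)
    also have "\<dots> = (\<Sum>c\<in>C. x c) + real (card C - 1) + 1"
      using False nb(3) by (simp add: Suc_leI card_gt_0_iff of_nat_diff)
    finally have "real_of_int (\<Sum>c\<in>C. \<lceil>x c\<rceil>) < real_of_int LHS + 1" using gap by simp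
    then show ?thesis by linarith
  qed
  then show ?thesis
    by (simp add: C_def[symmetric] LHS_def cutoff_def s_def[symmetric] x_def[symmetric] nat_ceil x_gt)
qed

text \<open>\<open>G w j\<close> is the generating series in the remaining degree at \<open>w\<close> when \<open>k w = j\<close> and the
  neighbours of \<open>w\<close> outside \<open>A\<close> have been summed over. Away from the root it need not be a power of
  \<open>1 - X\<close>: the factor \<open>F\<close> is \<open>1 / (1 - X)\<close> only from the cutoff on. The cutoffs are
  measured by a function \<open>om\<close> harmonic off the root, so that they add up correctly along the tree.\<close>

definition tree_kernel ::
  "('v::finite \<Rightarrow> 'v \<Rightarrow> bool) \<Rightarrow> ('v \<Rightarrow> real) \<Rightarrow> ('v \<Rightarrow> real) \<Rightarrow> 'v \<Rightarrow> 'v set \<Rightarrow> ('v \<Rightarrow> nat \<Rightarrow> real fps) \<Rightarrow> bool" where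
  "tree_kernel E om r v A G \<longleftrightarrow>
    (\<forall>w\<in>A. w \<noteq> v \<longrightarrow> (\<forall>j. \<exists>F. G w j = F * (1 - fps_X) ^ (card {u \<in> A. E w u} - 1) \<and>
        (\<forall>n \<ge> (\<Sum>c | E w c \<and> c \<notin> A. cutoff om r w j c). fps_nth F n = 1))) \<and>
    (1 - fps_X)\<^sup>2 * G v 0 = (1 - fps_X) ^ card {u \<in> A. E v u}"

text \<open>Eliminating the leaf \<open>w\<close> multiplies the kernel at its parent
  \<open>p\<close> by a series \<open>Fc q\<close> that behaves like \<open>1 / (1 - X)\<close>
  beyond the cutoff. This lowers the exponent at \<open>p\<close> by one, in step with the number of
  neighbours of \<open>p\<close> left in \<open>A\<close>. When only \<open>v\<close> remains, its
  kernel is \<open>(1 - X)\<close> to the power -2.\<close>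

theorem tree_term_sum:
  fixes E :: "'v::finite \<Rightarrow> 'v \<Rightarrow> bool" and om r N :: "'v \<Rightarrow> real" and b M :: "'v \<Rightarrow> int"
  assumes sym: "symp E" and irr: "irreflp E"
    and om: "\<And>u. om u > 0" and r: "\<And>u. 0 \<le> r u" "\<And>u. r u < 1"
    and harm: "\<And>w. w \<noteq> v \<Longrightarrow> of_int (b w) * om w = (\<Sum>u | E w u. om u)"
    and M: "\<And>w. of_int (M w) = N w + of_int (b w) * r w - (\<Sum>u | E w u. r u)"
    and N: "\<And>w. w \<noteq> v \<Longrightarrow> real (card {u. E w u} - 2) \<le> N w"
    and N1: "\<And>w. E w v \<Longrightarrow> real (card {u. E w u} - 2) + 1 \<le> N w"
    and Mv: "M v \<ge> -1"
    and A: "rooted E v A"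
  shows "tree_kernel E om r v A G \<Longrightarrow>
    finite {k \<in> height_fun A v. tree_term E b M A G k \<noteq> 0} \<Longrightarrow>
    sum (tree_term E b M A G) {k \<in> height_fun A v. tree_term E b M A G k \<noteq> 0} = of_int (M v) + 1"
  using A
proof (induction arbitrary: G rule: rooted.induct)
  case rooted_root
  have no: "{u. u = v \<and> E v u} = {}" using irr by (auto simp: irreflp_def)
  have "(1 - fps_X)\<^sup>2 * G v 0 = 1"
    using rooted_root(1) no by (simp add: tree_kernel_def)
  then have nth: "fps_nth (G v 0) n = real n + 1" for n by (rule fps_inverse_square_nth)
  have h: "height_fun {v} v = {\<lambda>_. 0}" unfolding height_fun_def by (auto simp: fun_eq_iff, metis)
  have t: "tree_term E b M {v} G (\<lambda>_. 0) = int_coeff (G v 0) (M v)"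
    by (simp add: tree_term_def no)
  \<comment> \<open>At \<open>M v = -1\<close> the coefficient is 0 by convention and still equals
    \<open>M v + 1\<close>; for smaller \<open>M v\<close> the formula would fail.\<close>
  have "int_coeff (G v 0) (M v) = of_int (M v) + 1"
    using Mv by (auto simp: int_coeff_def nth)
  then show ?case
    by (cases "int_coeff (G v 0) (M v) = 0") (auto simp: h t sum.If_cases Collect_conv_if2 cong: conj_cong)
next
  case (rooted_grow A w p)
  note IH = rooted_grow.IH and w = \<open>w \<notin> A\<close> and p = \<open>p \<in> A\<close> and wp = \<open>{u \<in> A. E w u} = {p}\<close>
    and K = \<open>tree_kernel E om r v (insert w A) G\<close>
  have vA: "v \<in> A" using rooted_grow.hyps rooted_root_mem by metis
  have wv: "w \<noteq> v" using w vA by auto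
  have Ewp: "E w p" and Epw: "E p w" using wp sym by (auto dest: sympD)
  have Eww: "\<not> E w w" using irr by (auto simp: irreflp_def)
  have Euw: "\<not> E u w" if "u \<in> A" "u \<noteq> p" for u
    using that wp sym by (auto dest: sympD)
  have nb_w: "{u \<in> insert w A. E w u} = {p}" using wp Eww by auto
  have nb_u: "{x \<in> insert w A. E u x} = {x \<in> A. E u x}" if "u \<in> A" "u \<noteq> p" for u
    using Euw[OF that] by auto
  have nb_p: "{x \<in> insert w A. E p x} = insert w {x \<in> A. E p x}" using Epw by auto
  have out_w: "{c. E w c \<and> c \<notin> insert w A} = {c. E w c \<and> c \<noteq> p}" using wp Eww p by auto
  have out_u: "{c. E u c \<and> c \<notin> insert w A} = {c. E u c \<and> c \<notin> A}" if "u \<in> A" "u \<noteq> p" for u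
    using Euw[OF that] by auto
  have out_p: "{c. E p c \<and> c \<notin> A} = insert w {c. E p c \<and> c \<notin> insert w A}" using Epw w by auto
  \<comment> \<open>The height \<open>q\<close> of the parent is subtracted from the degree at
    \<open>w\<close>, so the eliminated series depends on \<open>q\<close>; this is why kernels are
    indexed by heights.\<close>
  define Fc where "Fc q = Abs_fps (\<lambda>j. int_coeff (G w j) (M w + b w * int j - int q))" for q :: nat
  define G' where "G' = G(p := \<lambda>q. Fc q * G p q)"
  have Fc_one: "fps_nth (Fc q) j = 1"
    if "(r p + real q) * om w \<le> (r w + real j) * om p \<or> q = 0 \<and> p = v" for q j
  proof -
    have "\<exists>F. G w j = F * (1 - fps_X) ^ (card {x \<in> insert w A. E w x} - 1) \<and>
        (\<forall>n \<ge> (\<Sum>c | E w c \<and> c \<notin> insert w A. cutoff om r w j c). fps_nth F n = 1)"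
      using K wv unfolding tree_kernel_def by blast
    then obtain F where F: "G w j = F"
      "\<And>n. n \<ge> (\<Sum>c | E w c \<and> c \<noteq> p. cutoff om r w j c) \<Longrightarrow> fps_nth F n = 1"
      unfolding nb_w out_w by auto
    have "int (\<Sum>c | E w c \<and> c \<noteq> p. cutoff om r w j c) \<le> M w + b w * int j - int q"
      by (rule leaf_cutoff_bound[where om = om and r = r and N = N and E = E and w = w and p = p])
        (use that N1 Ewp om r harm[OF wv] M[of w] N[OF wv] in auto)
    then have "M w + b w * int j - int q \<ge> 0"
      and "(\<Sum>c | E w c \<and> c \<noteq> p. cutoff om r w j c) \<le> nat (M w + b w * int j - int q)"
      by linarith+
    then show ?thesis using F(2) by (simp add: Fc_def int_coeff_def F(1))
  qed
  have K': "tree_kernel E om r v A G'"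
    unfolding tree_kernel_def
  proof (intro conjI ballI impI allI)
    fix u j assume u: "u \<in> A" "u \<noteq> v"
    have Ku: "\<exists>F. G u j = F * (1 - fps_X) ^ (card {x \<in> insert w A. E u x} - 1) \<and>
        (\<forall>n \<ge> (\<Sum>c | E u c \<and> c \<notin> insert w A. cutoff om r u j c). fps_nth F n = 1)"
      using K u unfolding tree_kernel_def by blast
    show "\<exists>F. G' u j = F * (1 - fps_X) ^ (card {x \<in> A. E u x} - 1) \<and>
        (\<forall>n \<ge> (\<Sum>c | E u c \<and> c \<notin> A. cutoff om r u j c). fps_nth F n = 1)"
    proof (cases "u = p")
      case False
      then show ?thesis using Ku nb_u[OF u(1)] out_u[OF u(1)] by (simp add: G'_def)
    next
      case True
      define d where "d = card {x \<in> A. E p x} - 1"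
      have "card {x \<in> A. E p x} \<noteq> 0"
        using rooted_has_parent[OF rooted_grow.hyps(1) sym, of p] p u True by auto
      then have d: "card {x \<in> A. E p x} = Suc d" unfolding d_def by linarith
      have d': "card {x \<in> insert w A. E p x} - 1 = Suc d" unfolding nb_p using d w by simp
      obtain F where F: "G p j = F * (1 - fps_X) ^ Suc d"
        "\<And>n. n \<ge> (\<Sum>c | E p c \<and> c \<notin> insert w A. cutoff om r p j c) \<Longrightarrow> fps_nth F n = 1"
        using Ku unfolding True d' by blast
      have one: "fps_nth (Fc j) n = 1" if "n \<ge> cutoff om r p j w" for n
      proof -
        \<comment> \<open>The cutoff at \<open>w\<close> as seen from \<open>p\<close> is the first
          alternative of \<open>Fc_one\<close>, solved for the height of \<open>w\<close>.\<close>
        have "(r p + real j) * om w / om p - r w \<le> real n"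
          using that unfolding cutoff_def by (simp add: nat_le_iff ceiling_le_iff)
        then have "(r p + real j) * om w \<le> (r w + real n) * om p"
          using om[of p] by (simp add: field_simps)
        then show ?thesis using Fc_one by blast
      qed
      have sum_eq: "(\<Sum>c | E p c \<and> c \<notin> A. cutoff om r p j c) =
          cutoff om r p j w + (\<Sum>c | E p c \<and> c \<notin> insert w A. cutoff om r p j c)"
        unfolding out_p by simp
      \<comment> \<open>\<open>p\<close> has one neighbour fewer in \<open>A\<close> than in
        \<open>insert w A\<close>. The factor \<open>1 - X\<close> set free joins
        \<open>Fc j\<close> and \<open>F\<close>, and their cutoffs add.\<close>
      have "G' u j = ((1 - fps_X) * Fc j * F) * (1 - fps_X) ^ (card {x \<in> A. E u x} - 1)"
        by (simp add: True G'_def F(1) d mult_ac)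
      moreover have "\<forall>n \<ge> (\<Sum>c | E u c \<and> c \<notin> A. cutoff om r u j c). fps_nth ((1 - fps_X) * Fc j * F) n = 1"
        unfolding True sum_eq by (intro allI impI fps_eventually_one_mult[OF one F(2)])
      ultimately show ?thesis by blast
    qed
  next
    have Kv: "(1 - fps_X)\<^sup>2 * G v 0 = (1 - fps_X) ^ card {u \<in> insert w A. E v u}"
      using K by (simp add: tree_kernel_def)
    show "(1 - fps_X)\<^sup>2 * G' v 0 = (1 - fps_X) ^ card {u \<in> A. E v u}"
    proof (cases "p = v")
      case False
      then show ?thesis using Kv nb_u[OF vA] by (simp add: G'_def)
    next
      case True
      \<comment> \<open>At the root the identity is exact: the height of \<open>v\<close> is 0, and
        all coefficients of \<open>Fc 0\<close> are 1 from index 0 on.\<close>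
      have Fc1: "(1 - fps_X) * Fc 0 = 1"
        by (rule fps_ext) (simp add: left_diff_distrib fps_X_mult_nth Fc_one True)
      have "(1 - fps_X)\<^sup>2 * G' v 0 = Fc 0 * ((1 - fps_X)\<^sup>2 * G v 0)"
        by (simp add: G'_def True mult_ac)
      also have "\<dots> = ((1 - fps_X) * Fc 0) * (1 - fps_X) ^ card {u \<in> A. E v u}"
        unfolding Kv nb_p[unfolded True] using w by (simp add: mult_ac)
      finally show ?thesis by (simp add: Fc1)
    qed
  qed
  let ?f = "tree_term E b M (insert w A) G" and ?g = "tree_term E b M A G'"
  have inner: "?g k = (\<Sum>j | ?f (k(w := j)) \<noteq> 0. ?f (k(w := j)))" if k: "k \<in> height_fun A v" for k
  proof -
    define B where "B u = M u + b u * int (k u) - (\<Sum>x | x \<in> A \<and> E u x. int (k x))" for u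
    define c where "c = (\<Prod>u\<in>A - {p}. int_coeff (G u (k u)) (B u))"
    define F where "F j = int_coeff (G w j) (M w + b w * int j - int (k p))" for j
    have finA: "finite A" by simp
    have pw: "p \<noteq> w" using p w by auto
    have f: "?f (k(w := j)) = (F j * int_coeff (G p (k p)) (B p - int j)) * c" for j
    proof -
      have sw: "(\<Sum>x | x \<in> insert w A \<and> E w x. int ((k(w := j)) x)) = int (k p)"
        using nb_w pw by simp
      have sp: "(\<Sum>x | x \<in> insert w A \<and> E p x. int ((k(w := j)) x)) = int j + (\<Sum>x | x \<in> A \<and> E p x. int (k x))"
      proof -
        have "(\<Sum>x | x \<in> A \<and> E p x. int ((k(w := j)) x)) = (\<Sum>x | x \<in> A \<and> E p x. int (k x))"
          using w by (intro sum.cong) auto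
        then show ?thesis using nb_p w by simp
      qed
      have su: "(\<Sum>x | x \<in> insert w A \<and> E u x. int ((k(w := j)) x)) = (\<Sum>x | x \<in> A \<and> E u x. int (k x))"
        if "u \<in> A" "u \<noteq> p" for u
        unfolding nb_u[OF that] using w by (intro sum.cong) auto
      have "(\<Prod>u\<in>A - {p}. int_coeff (G u ((k(w := j)) u)) (M u + b u * int ((k(w := j)) u) -
               (\<Sum>x | x \<in> insert w A \<and> E u x. int ((k(w := j)) x)))) = c"
        unfolding c_def
      proof (intro prod.cong refl)
        fix u assume u: "u \<in> A - {p}"
        then have "u \<noteq> w" using w by auto
        then show "int_coeff (G u ((k(w := j)) u)) (M u + b u * int ((k(w := j)) u) -
               (\<Sum>x | x \<in> insert w A \<and> E u x. int ((k(w := j)) x))) = int_coeff (G u (k u)) (B u)"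
          using su u by (simp add: B_def)
      qed
      then show ?thesis
        unfolding tree_term_def prod.insert[OF finA w] prod.remove[OF finA p]
        using pw sw sp by (simp add: F_def B_def algebra_simps)
    qed
    have g: "?g k = int_coeff (Abs_fps F * G p (k p)) (B p) * c"
    proof -
      have "(\<Prod>u\<in>A - {p}. int_coeff (G' u (k u)) (B u)) = c"
        unfolding c_def by (intro prod.cong) (auto simp: G'_def)
      moreover have "G' p (k p) = Abs_fps F * G p (k p)" by (simp add: G'_def Fc_def F_def[abs_def])
      ultimately show ?thesis
        unfolding tree_term_def prod.remove[OF finA p] B_def[symmetric] by simp
    qed
    show ?thesis
    proof (cases "c = 0")
      case True
      then show ?thesis by (simp add: f g)
    next
      case False
      show ?thesis
        unfolding f g int_coeff_mult[OF False, of F] sum_distrib_right ..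
    qed
  qed
  have "sum ?f {k \<in> height_fun (insert w A) v. ?f k \<noteq> 0} = sum ?g {k \<in> height_fun A v. ?g k \<noteq> 0}"
    and fin: "finite {k \<in> height_fun A v. ?g k \<noteq> 0}"
    using finite_support_eliminate[OF w wv vA rooted_grow.prems(2) inner] by blast+
  then show ?case using IH[OF K' fin] by simp
qed

section \<open>Rational cones and uniqueness of periodic constants\<close>

definition rational_vec :: "real ^ 'v \<Rightarrow> bool" where
  "rational_vec x \<longleftrightarrow> (\<forall>v. x $ v \<in> \<rat>)"

lemma Rats_inner: "rational_vec x \<Longrightarrow> rational_vec y \<Longrightarrow> x \<bullet> y \<in> \<rat>" for x y :: "real ^ 'v::finite"
  by (auto simp: rational_vec_def inner_vec_def)

lemma rational_vec_axis [simp]: "rational_vec (axis i (1::real))"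
  by (auto simp: rational_vec_def axis_def)

lemma linear_inner_axis_nonzero:
  fixes P :: "real ^ 'v::finite \<Rightarrow> real ^ 'v"
  assumes "linear P" "a \<bullet> P x \<noteq> 0"
  obtains i where "a \<bullet> P (axis i 1) \<noteq> 0"
proof (rule ccontr)
  assume "\<not> thesis"
  then have z: "a \<bullet> P (axis i 1) = 0" for i using that by blast
  have "x = (\<Sum>i\<in>UNIV. x $ i *\<^sub>R axis i 1)"
    using basis_expansion[of x] by (simp add: scalar_mult_eq_scaleR)
  then have "P x = P (\<Sum>i\<in>UNIV. x $ i *\<^sub>R axis i 1)" by simp
  also have "\<dots> = (\<Sum>i\<in>UNIV. x $ i *\<^sub>R P (axis i 1))"
    using assms(1) by (simp add: linear_sum linear_cmul)
  finally show False using assms(2) by (simp add: inner_sum_right z)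
qed

text \<open>One functional at a time: if \<open>a\<close> is nonzero somewhere on the image of
  \<open>P\<close>, it is nonzero on the rational vector \<open>P (axis i 1)\<close> for some
  \<open>i\<close>. Subtracting multiples of that vector kills \<open>a\<close> and preserves
  rationality and the earlier equations.\<close>

lemma rational_projection:
  fixes J :: "(real ^ 'v::finite) set"
  assumes "finite J" "\<forall>a\<in>J. rational_vec a"
  shows "\<exists>P. linear P \<and> (\<forall>x. rational_vec x \<longrightarrow> rational_vec (P x)) \<and>
    (\<forall>a\<in>J. \<forall>x. a \<bullet> P x = 0) \<and> (\<forall>x. (\<forall>a\<in>J. a \<bullet> x = 0) \<longrightarrow> P x = x)"
  using assms
proof (induction J rule: finite_induct)
  case empty
  show ?case by (rule exI[of _ "\<lambda>x. x"]) (auto intro: linear_ident)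
next
  case (insert a J)
  then obtain P where P: "linear P" "\<And>x. rational_vec x \<Longrightarrow> rational_vec (P x)"
    "\<And>a x. a \<in> J \<Longrightarrow> a \<bullet> P x = 0" "\<And>x. (\<forall>a\<in>J. a \<bullet> x = 0) \<Longrightarrow> P x = x"
    by auto
  show ?case
  proof (cases "\<forall>x. a \<bullet> P x = 0")
    case True
    then show ?thesis using P by (intro exI[of _ P]) auto
  next
    case False
    then obtain i where i: "a \<bullet> P (axis i 1) \<noteq> 0"
      using linear_inner_axis_nonzero[OF P(1)] by blast
    define u where "u = P (axis i 1)"
    define Q where "Q x = P x - ((a \<bullet> P x) / (a \<bullet> u)) *\<^sub>R u" for x
    have ru: "rational_vec u" by (simp add: u_def P(2))
    have ra: "rational_vec a" using insert.prems by auto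
    have "linear Q"
      unfolding Q_def using P(1)
      by (intro linearI) (auto simp: linear_add linear_cmul algebra_simps add_divide_distrib inner_right_distrib)
    moreover have "rational_vec (Q x)" if "rational_vec x" for x
      using Rats_inner[OF ra P(2)[OF that]] Rats_inner[OF ra ru] P(2)[OF that] ru
      by (auto simp: Q_def rational_vec_def)
    moreover have "c \<bullet> Q x = 0" if "c \<in> insert a J" for c x
      using that i P(3) by (auto simp: Q_def inner_diff_right u_def)
    moreover have "Q x = x" if "\<forall>c\<in>insert a J. c \<bullet> x = 0" for x
      using that P(4)[of x] by (simp add: Q_def)
    ultimately show ?thesis by blast
  qed
qed

text \<open>The real solution \<open>z\<close> shows that \<open>a\<close> does not vanish on the
  kernel of \<open>J\<close>, so it is nonzero on the rational projection of some basis vector. This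
  produces rational dual bases, for simplicial cones as well as for the
  \<open>E\<^sub>v\<^sup>*\<close>.\<close>

lemma rational_witness:
  fixes J :: "(real ^ 'v::finite) set"
  assumes "finite J" "\<forall>a\<in>J. rational_vec a" "rational_vec a" "\<forall>c\<in>J. c \<bullet> z = 0" "a \<bullet> z \<noteq> 0"
  obtains u where "rational_vec u" "\<forall>c\<in>J. c \<bullet> u = 0" "a \<bullet> u = 1"
proof -
  obtain P where P: "linear P" "\<And>x. rational_vec x \<Longrightarrow> rational_vec (P x)"
    "\<And>a x. a \<in> J \<Longrightarrow> a \<bullet> P x = 0" "\<And>x. (\<forall>a\<in>J. a \<bullet> x = 0) \<Longrightarrow> P x = x"
    using rational_projection[OF assms(1,2)] by auto
  have "a \<bullet> P z \<noteq> 0" using P(4)[of z] assms by simp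
  then obtain i where i: "a \<bullet> P (axis i 1) \<noteq> 0" using linear_inner_axis_nonzero[OF P(1)] by blast
  let ?u = "(1 / (a \<bullet> P (axis i 1))) *\<^sub>R P (axis i 1)"
  have "rational_vec ?u"
    using P(2)[OF rational_vec_axis, of i] Rats_inner[OF assms(3) P(2)[OF rational_vec_axis, of i]]
    unfolding rational_vec_def by (simp add: Rats_divide)
  then show thesis using that[of ?u] i P(3) by simp
qed

lemma rational_vec_dense:
  fixes S :: "(real ^ 'v::finite) set"
  assumes "open S" "x \<in> S"
  obtains y where "y \<in> S" "rational_vec y"
proof -
  obtain e where e: "e > 0" "ball x e \<subseteq> S" using assms openE by blast
  obtain a b where ab: "\<forall>i\<in>Basis. a \<bullet> i \<in> \<rat> \<and> b \<bullet> i \<in> \<rat>" "x \<in> box a b" "box a b \<subseteq> ball x e"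
    using rational_boxes[OF e(1), of x] by blast
  have "(1/2) *\<^sub>R (a + b) \<in> box a b"
    using ab(2) by (force simp: mem_box inner_simps)
  moreover have "rational_vec ((1/2) *\<^sub>R (a + b))"
    unfolding rational_vec_def
  proof
    fix v
    have "(axis v 1 :: real ^ 'v) \<in> Basis" by (simp add: axis_in_Basis_iff)
    then have "a \<bullet> axis v 1 \<in> \<rat>" "b \<bullet> axis v 1 \<in> \<rat>" using ab(1) by auto
    then show "((1/2) *\<^sub>R (a + b)) $ v \<in> \<rat>" by (simp add: inner_axis)
  qed
  ultimately show thesis using that ab e by blast
qed

text \<open>Pulled back along the rational projection, the strict inequalities define an open set
  around \<open>x\<close>. Projecting a rational point of it restores the equations.\<close>

lemma rational_approximation:
  fixes I J :: "(real ^ 'v::finite) set"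
  assumes J: "finite J" "\<forall>a\<in>J. rational_vec a" and I: "finite I"
    and x: "\<forall>a\<in>J. a \<bullet> x = 0" "\<forall>a\<in>I. a \<bullet> x > 0"
  obtains u where "rational_vec u" "\<forall>a\<in>J. a \<bullet> u = 0" "\<forall>a\<in>I. a \<bullet> u > 0"
proof -
  obtain P where P: "linear P" "\<And>x. rational_vec x \<Longrightarrow> rational_vec (P x)"
    "\<And>a x. a \<in> J \<Longrightarrow> a \<bullet> P x = 0" "\<And>x. (\<forall>a\<in>J. a \<bullet> x = 0) \<Longrightarrow> P x = x"
    using rational_projection[OF J] by auto
  have cont: "continuous_on UNIV P" using P(1) by (simp add: linear_continuous_on linear_linear)
  have eq: "{y. \<forall>a\<in>I. 0 < a \<bullet> P y} = (\<Inter>a\<in>I. {y. 0 < a \<bullet> P y})" by auto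
  have "open {y. \<forall>a\<in>I. 0 < a \<bullet> P y}"
    unfolding eq using I cont by (intro open_INT ballI open_Collect_less continuous_intros) auto
  moreover have "x \<in> {y. \<forall>a\<in>I. 0 < a \<bullet> P y}" using P(4)[of x] x by simp
  ultimately obtain y where "y \<in> {y. \<forall>a\<in>I. 0 < a \<bullet> P y}" "rational_vec y"
    by (rule rational_vec_dense)
  then show thesis using that[of "P y"] P(2,3) by simp
qed

lemma rational_vec_integer_multiple:
  fixes x :: "real ^ 'v::finite"
  assumes "rational_vec x"
  obtains n :: nat where "n > 0" "real n *\<^sub>R x \<in> latt"
proof -
  have "\<exists>d::nat. d > 0 \<and> real d * x $ v \<in> \<int>" for v
  proof -
    have "x $ v \<in> \<rat>" using assms by (simp add: rational_vec_def)
    then obtain a b where ab: "b > 0" "x $ v = of_int a / of_int b" by (rule Rats_cases') 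
    then have "real (nat b) * x $ v = of_int a" by simp
    then show ?thesis using ab(1) by (intro exI[of _ "nat b"]) auto
  qed
  then obtain d where d: "\<And>v. d v > (0::nat)" "\<And>v. real (d v) * x $ v \<in> \<int>" by metis
  let ?n = "\<Prod>v\<in>UNIV. d v"
  have "real ?n * x $ v \<in> \<int>" for v
  proof -
    define c where "c = (\<Prod>u\<in>UNIV - {v}. d u)"
    have n: "?n = d v * c" by (simp add: prod.remove c_def)
    have "(real (d v) * x $ v) * real c \<in> \<int>" by (rule Ints_mult[OF d(2) Ints_of_nat])
    then show ?thesis unfolding n by (simp add: mult_ac)
  qed
  then show thesis using that[of ?n] d(1) by (simp add: latt_def)
qed

lemma latt_closed: "x \<in> latt \<Longrightarrow> y \<in> latt \<Longrightarrow> x + y \<in> latt" "x \<in> latt \<Longrightarrow> y \<in> latt \<Longrightarrow> x - y \<in> latt"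
  "0 \<in> latt" "x \<in> latt \<Longrightarrow> - x \<in> latt" "x \<in> latt \<Longrightarrow> real n *\<^sub>R x \<in> latt"
  by (auto simp: latt_def)

text \<open>The functionals in \<open>J\<close> are positive somewhere on \<open>K\<close>, the
  others vanish on \<open>K\<close>. A sum of witnesses is positive on all of \<open>J\<close>;
  approximated rationally and scaled, it gives a lattice ray that eventually enters every translate
  \<open>l + K\<close>.\<close>

lemma rational_cone_interior_lattice_point:
  fixes I :: "(real ^ 'v::finite) set"
  assumes I: "finite I" "\<forall>a\<in>I. rational_vec a" and K: "K = {x. \<forall>a\<in>I. 0 \<le> a \<bullet> x}"
  obtains w where "w \<in> latt" "w \<in> K" "\<And>l. l \<in> K \<Longrightarrow> \<exists>n0::nat. \<forall>n\<ge>n0. real n *\<^sub>R w - l \<in> K"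
proof -
  define J where "J = {a \<in> I. \<exists>x\<in>K. 0 < a \<bullet> x}"
  then have "\<forall>a\<in>J. \<exists>x. x \<in> K \<and> 0 < a \<bullet> x" by auto
  then obtain X where X: "\<And>a. a \<in> J \<Longrightarrow> X a \<in> K" "\<And>a. a \<in> J \<Longrightarrow> 0 < a \<bullet> X a"
    using bchoice[of J "\<lambda>a x. x \<in> K \<and> 0 < a \<bullet> x"] by blast
  have fin: "finite J" using I by (simp add: J_def)
  have JI: "J \<subseteq> I" by (auto simp: J_def)
  define x where "x = (\<Sum>a\<in>J. X a)"
  have "a \<bullet> x = 0" if "a \<in> I - J" for a
    unfolding x_def inner_sum_right
  proof (intro sum.neutral ballI)
    fix c assume "c \<in> J"
    then have "X c \<in> K" "0 \<le> a \<bullet> X c" using X(1)[of c] that unfolding K by auto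
    moreover have "\<not> 0 < a \<bullet> X c" using that X(1)[OF \<open>c \<in> J\<close>] by (auto simp: J_def)
    ultimately show "a \<bullet> X c = 0" by simp
  qed
  moreover have "a \<bullet> x > 0" if "a \<in> J" for a
    unfolding x_def inner_sum_right
  proof (rule sum_pos2[of J a])
    show "0 \<le> a \<bullet> X c" if "c \<in> J" for c
      using X(1)[OF that] \<open>a \<in> J\<close> JI unfolding K by blast
  qed (use fin that X in auto)
  ultimately obtain u where u: "rational_vec u" "\<forall>a\<in>I - J. a \<bullet> u = 0" "\<forall>a\<in>J. a \<bullet> u > 0"
    using rational_approximation[of "I - J" J x] I fin by (metis Diff_iff finite_Diff)
  obtain m where m: "m > 0" "real m *\<^sub>R u \<in> latt" using rational_vec_integer_multiple[OF u(1)] by blast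
  define w where "w = real m *\<^sub>R u"
  have w: "a \<bullet> w = 0" if "a \<in> I - J" for a using u that by (simp add: w_def)
  have w': "a \<bullet> w > 0" if "a \<in> J" for a using u that m by (simp add: w_def)
  show thesis
  proof (rule that[of w])
    show "w \<in> latt" using m by (simp add: w_def)
    show "w \<in> K" unfolding K using w w' by (auto simp: less_eq_real_def)
    fix l assume l: "l \<in> K"
    have l0: "a \<bullet> l = 0" if "a \<in> I - J" for a
    proof -
      have "0 \<le> a \<bullet> l" using l that unfolding K by auto
      moreover have "\<not> 0 < a \<bullet> l" using that l by (auto simp: J_def)
      ultimately show ?thesis by simp
    qed
    have "\<exists>n0::nat. \<forall>n\<ge>n0. 0 \<le> a \<bullet> (real n *\<^sub>R w - l)" if "a \<in> J" for a
    proof -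
      obtain n0 :: nat where n0: "(a \<bullet> l) / (a \<bullet> w) \<le> real n0" using real_arch_simple by blast
      show ?thesis
      proof (intro exI[of _ n0] allI impI)
        fix n assume "n0 \<le> n"
        then have "(a \<bullet> l) / (a \<bullet> w) \<le> real n" using n0 by simp
        then show "0 \<le> a \<bullet> (real n *\<^sub>R w - l)" using w'[OF that] by (simp add: inner_diff_right field_simps)
      qed
    qed
    then obtain n0 where n0: "\<And>a n. a \<in> J \<Longrightarrow> n \<ge> n0 a \<Longrightarrow> 0 \<le> a \<bullet> (real n *\<^sub>R w - l)" by metis
    show "\<exists>n0::nat. \<forall>n\<ge>n0. real n *\<^sub>R w - l \<in> K"
    proof (intro exI[of _ "\<Sum>a\<in>J. n0 a"] allI impI)
      fix n assume n: "(\<Sum>a\<in>J. n0 a) \<le> n"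
      have "0 \<le> a \<bullet> (real n *\<^sub>R w - l)" if "a \<in> I" for a
      proof (cases "a \<in> J")
        case True
        then have "n0 a \<le> n" using n member_le_sum[of a J n0] fin by simp
        then show ?thesis using n0 True by blast
      next
        case False
        then show ?thesis using w l0 that by (simp add: inner_diff_right)
      qed
      then show "real n *\<^sub>R w - l \<in> K" by (simp add: K)
    qed
  qed
qed

section \<open>Sublattices of finite index and polynomials along a ray\<close>

lemma finite_index_multiple:
  fixes w :: "real ^ 'v::finite"
  assumes M: "finite_index_sublattice M \<Lambda>" and w: "\<And>n::nat. real n *\<^sub>R w \<in> \<Lambda>"
  obtains n :: nat where "n > 0" "real n *\<^sub>R w \<in> M"
proof -
  \<comment> \<open>Pigeonhole: two multiples of \<open>w\<close> lie in the same coset, and their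
    difference lies in \<open>M\<close>.\<close>
  have "finite ((\<lambda>n::nat. (+) (real n *\<^sub>R w) ` M) ` UNIV)"
    by (rule finite_subset[of _ "(\<lambda>x. (+) x ` M) ` \<Lambda>"]) (use M w in \<open>auto simp: finite_index_sublattice_def\<close>)
  then have "\<not> inj (\<lambda>n::nat. (+) (real n *\<^sub>R w) ` M)" using finite_imageD[of "\<lambda>n::nat. (+) (real n *\<^sub>R w) ` M" UNIV] by auto
  then have "\<exists>i j :: nat. i < j \<and> (+) (real i *\<^sub>R w) ` M = (+) (real j *\<^sub>R w) ` M"
    unfolding inj_def by (metis (no_types, lifting) linorder_neqE_nat)
  then obtain i j :: nat where ij: "i < j" "(+) (real i *\<^sub>R w) ` M = (+) (real j *\<^sub>R w) ` M"
    by blast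
  have "real j *\<^sub>R w \<in> (+) (real j *\<^sub>R w) ` M"
    using M by (auto simp: finite_index_sublattice_def image_iff intro!: bexI[of _ 0])
  then obtain m where m: "m \<in> M" "real j *\<^sub>R w = real i *\<^sub>R w + m" using ij by auto
  have "real (j - i) *\<^sub>R w = m" using m ij by (simp add: of_nat_diff scaleR_left_diff_distrib)
  then show thesis using that[of "j - i"] ij m by auto
qed

lemma sublattice_multiple:
  fixes w :: "real ^ 'v::finite"
  assumes M: "finite_index_sublattice M \<Lambda>" and w: "w \<in> M"
  shows "real n *\<^sub>R w \<in> M"
proof -
  have closed: "x - y \<in> M" if "x \<in> M" "y \<in> M" for x y
    using M that by (auto simp: finite_index_sublattice_def)
  have "0 \<in> M" using M by (auto simp: finite_index_sublattice_def)
  then have add: "x + w \<in> M" if "x \<in> M" for x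
    using closed[OF that closed[OF \<open>0 \<in> M\<close> w]] by simp
  show ?thesis
  proof (induction n)
    case (Suc n)
    then show ?case using add[OF Suc] by (simp add: scaleR_left_distrib add.commute)
  qed (simp add: \<open>0 \<in> M\<close>)
qed

lemma real_polynomial_function_ray_zero:
  fixes g :: "real ^ 'v::finite \<Rightarrow> real"
  assumes g: "real_polynomial_function g" and z: "\<And>n::nat. n \<ge> n0 \<Longrightarrow> g (real n *\<^sub>R w) = 0"
  shows "g 0 = 0"
proof -
  have "polynomial_function (\<lambda>t::real. t *\<^sub>R w)"
    by (simp add: polynomial_function_bounded_linear bounded_linear_scaleR_left)
  then have "real_polynomial_function (g \<circ> (\<lambda>t. t *\<^sub>R w))"
    using g by (rule real_polynomial_function_compose)
  then obtain a n where a: "g \<circ> (\<lambda>t. t *\<^sub>R w) = (\<lambda>t. \<Sum>i\<le>n. a i * t ^ i)"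
    by (auto simp: real_polynomial_function_iff_sum)
  have gt: "g (t *\<^sub>R w) = (\<Sum>i\<le>n. a i * t ^ i)" for t using fun_cong[OF a, of t] by simp
  have "real ` {n0..} \<subseteq> {t. (\<Sum>i\<le>n. a i * t ^ i) = 0}" using z by (auto simp: gt[symmetric])
  moreover have "infinite (real ` {n0..})" using finite_imageD[of real "{n0..}"] infinite_Ici by (auto simp: inj_on_def)
  ultimately have "infinite {t. (\<Sum>i\<le>n. a i * t ^ i) = 0}" using finite_subset by blast
  then have "\<forall>i\<le>n. a i = 0" using polyfun_finite_roots[of a n] by auto
  then have "(\<Sum>i\<le>n. a i * 0 ^ i) = 0" by simp
  then show ?thesis using gt[of 0] by simp
qed

text \<open>On the multiples of \<open>w\<close> lying in all sublattices involved, \<open>f\<close>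
  agrees far out with a polynomial whose value at 0 is the periodic constant. Two such polynomials
  agree at infinitely many points of a line through 0.\<close>

lemma is_pc_unique:
  fixes K :: "(real ^ 'v::finite) set"
  assumes K: "convex_cone K" and w: "w \<in> latt" "w \<in> K"
    and deep: "\<And>l. l \<in> K \<Longrightarrow> \<exists>n0::nat. \<forall>n\<ge>n0. real n *\<^sub>R w - l \<in> K"
    and "is_pc K f q1" "is_pc K f q2"
  shows "q1 = q2"
proof -
  have ray: "\<exists>g m n0. real_polynomial_function g \<and> 0 < (m::nat) \<and> g 0 = q \<and>
      (\<forall>n\<ge>(n0::nat). g (real (m * n) *\<^sub>R w) = f (real (m * n) *\<^sub>R w))" if "is_pc K f q" for q
  proof -
    from that obtain l M f' where l: "l \<in> K" and M: "finite_index_sublattice M latt"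
      and qp: "quasipolynomial_on (M \<inter> affine hull K) f'"
      and eq: "\<forall>x \<in> M \<inter> (+) l ` K. f x = f' x" and q: "q = f' 0"
      unfolding is_pc_def by blast
    have inK: "real n *\<^sub>R w \<in> K" for n :: nat using K w by (simp add: convex_cone_scaleR)
    have inA: "real n *\<^sub>R w \<in> affine hull K" for n :: nat using inK hull_inc by metis
    have "real n *\<^sub>R w \<in> latt" for n :: nat using w by (simp add: latt_closed)
    then obtain m1 where m1: "m1 > 0" "real m1 *\<^sub>R w \<in> M" using finite_index_multiple[OF M] by blast
    have inM: "real (n * m1) *\<^sub>R w \<in> M" for n using sublattice_multiple[OF M m1(2), of n] by simp
    obtain M' where M': "finite_index_sublattice M' (M \<inter> affine hull K)"
      and g: "\<forall>x\<in>M \<inter> affine hull K. \<exists>g. real_polynomial_function g \<and> (\<forall>y\<in>M'. f' (x + y) = g (x + y))"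
      using qp unfolding quasipolynomial_on_def by blast
    have "real n *\<^sub>R (real m1 *\<^sub>R w) \<in> M \<inter> affine hull K" for n
      using inM[of n] inA[of "n * m1"] by simp
    then obtain m2 where m2: "m2 > 0" "real m2 *\<^sub>R real m1 *\<^sub>R w \<in> M'" using finite_index_multiple[OF M'] by blast
    define m where "m = m2 * m1"
    have inM': "real (m * n) *\<^sub>R w \<in> M'" for n
      using sublattice_multiple[OF M' m2(2), of n] by (simp add: m_def mult_ac)
    \<comment> \<open>The coset of 0 is chosen so that its polynomial takes the value
      \<open>f' 0 = q\<close> at 0.\<close>
    have "0 \<in> M \<inter> affine hull K" using inM[of 0] inA[of 0] by simp
    from bspec[OF g this] obtain g0 where g0: "real_polynomial_function g0" "\<And>y. y \<in> M' \<Longrightarrow> f' y = g0 y"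
      by auto
    obtain n0 where n0: "\<And>n. n \<ge> n0 \<Longrightarrow> real n *\<^sub>R w - l \<in> K" using deep[OF l] by blast
    have "g0 (real (m * n) *\<^sub>R w) = f (real (m * n) *\<^sub>R w)" if n: "n \<ge> n0" for n
    proof -
      have "m > 0" using m1(1) m2(1) by (simp add: m_def)
      then have "m * n \<ge> n" by simp
      then have "m * n \<ge> n0" using n by linarith
      then have "real (m * n) *\<^sub>R w \<in> (+) l ` K" using n0[of "m * n"] by (auto simp: image_iff intro!: bexI[of _ "real (m * n) *\<^sub>R w - l"])
      moreover have "real (m * n) *\<^sub>R w \<in> M" using inM[of "m2 * n"] by (simp add: m_def mult_ac)
      ultimately show ?thesis using eq g0(2)[OF inM', of n] by auto
    qed
    moreover have "g0 0 = q" using g0(2)[OF inM'[of 0]] q by simp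
    ultimately show ?thesis using g0(1) m1 m2 by (intro exI[of _ g0] exI[of _ m] exI[of _ n0]) (auto simp: m_def)
  qed
  obtain g1 m1 n1 where 1: "real_polynomial_function g1" "0 < (m1::nat)" "g1 0 = q1"
      "\<And>n. n \<ge> (n1::nat) \<Longrightarrow> g1 (real (m1 * n) *\<^sub>R w) = f (real (m1 * n) *\<^sub>R w)"
    using ray[OF assms(5)] by blast
  obtain g2 m2 n2 where 2: "real_polynomial_function g2" "0 < (m2::nat)" "g2 0 = q2"
      "\<And>n. n \<ge> (n2::nat) \<Longrightarrow> g2 (real (m2 * n) *\<^sub>R w) = f (real (m2 * n) *\<^sub>R w)"
    using ray[OF assms(6)] by blast
  have "g1 0 - g2 0 = 0"
  proof (rule real_polynomial_function_ray_zero[of "\<lambda>x. g1 x - g2 x" "n1 + n2" "real (m1 * m2) *\<^sub>R w"])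
    show "real_polynomial_function (\<lambda>x. g1 x - g2 x)" using 1 2 by auto
    fix n assume n: "n1 + n2 \<le> n"
    have "n \<le> m2 * n" "n \<le> m1 * n" using 1(2) 2(2) by auto
    then have "n1 \<le> m2 * n" "n2 \<le> m1 * n" using n by linarith+
    then show "g1 (real n *\<^sub>R real (m1 * m2) *\<^sub>R w) - g2 (real n *\<^sub>R real (m1 * m2) *\<^sub>R w) = 0"
      using 1(4)[of "m2 * n"] 2(4)[of "m1 * n"] by (simp add: mult_ac)
  qed
  then show ?thesis using 1 2 by simp
qed

section \<open>Simplicial cones\<close>

lemma convex_cone_hull_sum:
  assumes "finite S" "\<And>s. s \<in> S \<Longrightarrow> 0 \<le> u s" "\<And>s. s \<in> S \<Longrightarrow> y s \<in> convex_cone hull X"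
  shows "(\<Sum>s\<in>S. u s *\<^sub>R y s) \<in> convex_cone hull X"
  using assms by (induction rule: finite_induct)
    (auto intro: convex_cone_hull_add convex_cone_hull_mul convex_cone_hull_contains_0)

lemma convex_cone_hull_finite:
  fixes X :: "'a::real_vector set"
  assumes "finite X"
  shows "convex_cone hull X = {\<Sum>s\<in>X. u s *\<^sub>R s | u. \<forall>s\<in>X. (0::real) \<le> u s}" (is "_ = ?R")
proof
  have "X \<subseteq> ?R"
  proof
    fix x assume "x \<in> X"
    then have "x = (\<Sum>s\<in>X. (if s = x then 1 else 0) *\<^sub>R s)"
      using assms by (simp add: if_distrib[of "\<lambda>c. c *\<^sub>R _"] cong: if_cong)
    then show "x \<in> ?R" by (intro CollectI exI[of _ "\<lambda>s. if s = x then 1 else 0"]) auto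
  qed
  moreover have "convex_cone ?R"
    unfolding convex_cone_iff
  proof (intro conjI ballI allI impI)
    show "0 \<in> ?R" by (auto intro!: exI[of _ "\<lambda>_. 0"])
  next
    fix x y assume "x \<in> ?R" "y \<in> ?R"
    then obtain u u' where "x = (\<Sum>s\<in>X. u s *\<^sub>R s)" "\<forall>s\<in>X. 0 \<le> u s" "y = (\<Sum>s\<in>X. u' s *\<^sub>R s)" "\<forall>s\<in>X. 0 \<le> u' s"
      by blast
    then show "x + y \<in> ?R"
      by (intro CollectI exI[of _ "\<lambda>s. u s + u' s"]) (auto simp: sum.distrib scaleR_left_distrib)
  next
    fix x c assume "x \<in> ?R" "(0::real) \<le> c"
    then obtain u where "x = (\<Sum>s\<in>X. u s *\<^sub>R s)" "\<forall>s\<in>X. 0 \<le> u s" by blast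
    with \<open>0 \<le> c\<close> show "c *\<^sub>R x \<in> ?R"
      by (intro CollectI exI[of _ "\<lambda>s. c * u s"]) (auto simp: scaleR_sum_right)
  qed
  ultimately show "convex_cone hull X \<subseteq> ?R" by (intro hull_minimal) auto
  show "?R \<subseteq> convex_cone hull X"
  proof
    fix x assume "x \<in> ?R"
    then obtain u where u: "x = (\<Sum>s\<in>X. u s *\<^sub>R s)" "\<forall>s\<in>X. 0 \<le> u s" by blast
    show "x \<in> convex_cone hull X"
      unfolding u(1) using assms u(2) by (intro convex_cone_hull_sum) (simp_all add: hull_inc)
  qed
qed

text \<open>In a generating subset of least cardinality a linear relation could be subtracted until
  a coefficient vanishes, which contradicts minimality.\<close>

lemma convex_cone_hull_caratheodory:
  fixes X :: "'a::euclidean_space set"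
  assumes "finite X" "x \<in> convex_cone hull X"
  obtains B where "B \<subseteq> X" "independent B" "x \<in> convex_cone hull B"
proof -
  define P where "P S \<longleftrightarrow> S \<subseteq> X \<and> x \<in> convex_cone hull S" for S
  have "P X" using assms by (simp add: P_def)
  then obtain S where S: "P S" "\<And>T. P T \<Longrightarrow> card S \<le> card T"
    using ex_has_least_nat[of P X card] by blast
  have fin: "finite S" using S(1) assms(1) finite_subset by (auto simp: P_def)
  obtain u where u: "\<forall>s\<in>S. (0::real) \<le> u s" "x = (\<Sum>s\<in>S. u s *\<^sub>R s)"
    using S(1) fin by (auto simp: P_def convex_cone_hull_finite)
  have "independent S"
  proof
    assume "dependent S"
    then obtain c0 s0 where c0: "s0 \<in> S" "c0 s0 \<noteq> 0" "(\<Sum>s\<in>S. c0 s *\<^sub>R s) = 0"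
      using fin by (auto simp: dependent_finite)
    \<comment> \<open>Multiplication by \<open>c0 s0\<close> makes the entry at \<open>s0\<close> a
      square, so the relation has a positive entry and the minimum defining \<open>t\<close> is over
      a nonempty set.\<close>
    define c where "c s = c0 s * c0 s0" for s
    have c: "c s0 > 0" using c0(2) by (auto simp: c_def zero_less_mult_iff)
    have "(\<Sum>s\<in>S. c s *\<^sub>R s) = c0 s0 *\<^sub>R (\<Sum>s\<in>S. c0 s *\<^sub>R s)"
      unfolding scaleR_sum_right by (intro sum.cong) (auto simp: c_def mult.commute)
    then have c2: "(\<Sum>s\<in>S. c s *\<^sub>R s) = 0" using c0(3) by simp
    define t where "t = Min ((\<lambda>s. u s / c s) ` {s \<in> S. c s > 0})"
    have ne: "{s \<in> S. c s > 0} \<noteq> {}" using c c0 by auto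
    then have "t \<in> (\<lambda>s. u s / c s) ` {s \<in> S. c s > 0}" using fin by (simp add: t_def)
    then obtain s1 where s1: "s1 \<in> S" "c s1 > 0" "t = u s1 / c s1" by auto
    have t0: "t \<ge> 0" using s1 u by simp
    have tle: "t * c s \<le> u s" if "s \<in> S" for s
    proof (cases "c s > 0")
      case True
      then have "t \<le> u s / c s" using fin that by (auto simp: t_def intro!: Min_le)
      then show ?thesis using True by (simp add: field_simps)
    next
      case False
      then have "t * c s \<le> 0" using t0 by (simp add: mult_nonneg_nonpos)
      then show ?thesis using u that by force
    qed
    have "(\<Sum>s\<in>S. (t * c s) *\<^sub>R s) = t *\<^sub>R (\<Sum>s\<in>S. c s *\<^sub>R s)"
      unfolding scaleR_sum_right by simp
    then have "x = (\<Sum>s\<in>S. (u s - t * c s) *\<^sub>R s)"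
      using u(2) c2 by (simp add: scaleR_left_diff_distrib sum_subtractf)
    also have "\<dots> = (\<Sum>s\<in>S - {s1}. (u s - t * c s) *\<^sub>R s)"
      using fin s1 by (simp add: sum.remove)
    also have "\<dots> \<in> convex_cone hull (S - {s1})"
      using fin tle by (intro convex_cone_hull_sum) (simp_all add: hull_inc)
    finally have "P (S - {s1})" using S(1) by (auto simp: P_def)
    then have "card S \<le> card (S - {s1})" by (rule S(2))
    then show False using card_Diff1_less[OF fin s1(1)] by simp
  qed
  then show thesis using that[of S] S(1) by (simp add: P_def)
qed

section \<open>Coordinates with respect to bases drawn from a rational vector configuration\<close>

definition bases_in :: "(real ^ 'v::finite) set \<Rightarrow> (real ^ 'v) set set" where
  "bases_in X = {B. B \<subseteq> X \<and> independent B \<and> span B = UNIV}"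

definition dual_vector :: "(real ^ 'v::finite) set \<Rightarrow> real ^ 'v \<Rightarrow> real ^ 'v" where
  "dual_vector B b = (SOME u. rational_vec u \<and> u \<bullet> b = 1 \<and> (\<forall>c\<in>B - {b}. u \<bullet> c = 0))"

text \<open>The component of \<open>b\<close> orthogonal to the span of the other vectors is, up to
  scaling, a real solution; \<open>rational_witness\<close> replaces it by a rational one.\<close>

lemma dual_vector:
  fixes B :: "(real ^ 'v::finite) set"
  assumes "independent B" "\<forall>c\<in>B. rational_vec c" "b \<in> B"
  shows "rational_vec (dual_vector B b)" "dual_vector B b \<bullet> b = 1"
    "\<And>c. c \<in> B \<Longrightarrow> c \<noteq> b \<Longrightarrow> dual_vector B b \<bullet> c = 0"
proof -
  obtain y z where yz: "y \<in> span (B - {b})" "\<And>w. w \<in> span (B - {b}) \<Longrightarrow> orthogonal z w" "b = y + z"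
    using orthogonal_subspace_decomp_exists[of "B - {b}" b] by metis
  have "b \<notin> span (B - {b})" using assms by (auto simp: dependent_def)
  then have "z \<noteq> 0" using yz by auto
  moreover have "b \<bullet> z = z \<bullet> z" using yz(2)[OF yz(1)] yz(3) by (simp add: orthogonal_def inner_simps inner_commute)
  ultimately have "b \<bullet> z \<noteq> 0" by simp
  moreover have "\<forall>c\<in>B - {b}. c \<bullet> z = 0"
    using yz(2) by (auto simp: orthogonal_def inner_commute span_base)
  moreover have "finite (B - {b})" using assms(1) finiteI_independent by auto
  ultimately obtain u where "rational_vec u" "\<forall>c\<in>B - {b}. c \<bullet> u = 0" "b \<bullet> u = 1"
    using rational_witness[of "B - {b}" b z] assms by auto
  then have "\<exists>u. rational_vec u \<and> u \<bullet> b = 1 \<and> (\<forall>c\<in>B - {b}. u \<bullet> c = 0)"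
    by (metis inner_commute)
  from someI_ex[OF this] show "rational_vec (dual_vector B b)" "dual_vector B b \<bullet> b = 1"
    "\<And>c. c \<in> B \<Longrightarrow> c \<noteq> b \<Longrightarrow> dual_vector B b \<bullet> c = 0"
    by (auto simp: dual_vector_def)
qed

lemma bases_in_expansion:
  fixes X :: "(real ^ 'v::finite) set"
  assumes "B \<in> bases_in X" "\<forall>c\<in>X. rational_vec c"
  shows "x = (\<Sum>b\<in>B. (dual_vector B b \<bullet> x) *\<^sub>R b)"
proof -
  have B: "independent B" "\<forall>c\<in>B. rational_vec c" "finite B" "span B = UNIV"
    using assms finiteI_independent by (auto simp: bases_in_def)
  obtain c where c: "x = (\<Sum>b\<in>B. c b *\<^sub>R b)"
    using B(4) span_finite[OF B(3)] by auto
  have "dual_vector B b \<bullet> x = c b" if "b \<in> B" for b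
  proof -
    have "dual_vector B b \<bullet> x = (\<Sum>b'\<in>B. c b' * (dual_vector B b \<bullet> b'))"
      by (simp add: c inner_sum_right)
    also have "\<dots> = (\<Sum>b'\<in>B. if b' = b then c b else 0)"
      using dual_vector[OF B(1,2) that] by (intro sum.cong) auto
    finally show ?thesis using B(3) that by simp
  qed
  then show ?thesis using c by simp
qed

lemma bases_in_cone:
  fixes X :: "(real ^ 'v::finite) set"
  assumes "B \<in> bases_in X" "\<forall>c\<in>X. rational_vec c"
  shows "convex_cone hull B = {x. \<forall>b\<in>B. 0 \<le> dual_vector B b \<bullet> x}"
proof
  have B: "independent B" "\<forall>c\<in>B. rational_vec c" "finite B"
    using assms finiteI_independent by (auto simp: bases_in_def)
  have "convex_cone {x. \<forall>b\<in>B. 0 \<le> dual_vector B b \<bullet> x}"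
    by (auto simp: convex_cone_iff inner_simps)
  moreover have "0 \<le> dual_vector B b \<bullet> c" if "b \<in> B" "c \<in> B" for b c
    using dual_vector[OF B(1,2) that(1)] that by (cases "c = b") auto
  ultimately show "convex_cone hull B \<subseteq> {x. \<forall>b\<in>B. 0 \<le> dual_vector B b \<bullet> x}"
    by (intro hull_minimal) auto
  show "{x. \<forall>b\<in>B. 0 \<le> dual_vector B b \<bullet> x} \<subseteq> convex_cone hull B"
  proof
    fix x assume "x \<in> {x. \<forall>b\<in>B. 0 \<le> dual_vector B b \<bullet> x}"
    then have "(\<Sum>b\<in>B. (dual_vector B b \<bullet> x) *\<^sub>R b) \<in> convex_cone hull B"
      using B(3) by (intro convex_cone_hull_sum) (auto intro: hull_inc)
    then show "x \<in> convex_cone hull B" using bases_in_expansion[OF assms, of x] by simp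
  qed
qed

lemma open_avoid_hyperplanes:
  fixes U :: "'a::euclidean_space set"
  assumes "finite A" "open U" "U \<noteq> {}" "0 \<notin> A"
  shows "\<exists>x\<in>U. \<forall>a\<in>A. a \<bullet> x \<noteq> 0"
  using assms
proof (induction A arbitrary: U rule: finite_induct)
    case (insert a A)
    have "\<not> U \<subseteq> {x. a \<bullet> x = 0}"
      using insert.prems interior_hyperplane[of a 0] interior_maximal[of U "{x. a \<bullet> x = 0}"] by auto
    then have "U \<inter> {x. a \<bullet> x \<noteq> 0} \<noteq> {}" by auto
    moreover have "open (U \<inter> {x. a \<bullet> x \<noteq> 0})"
      using insert.prems by (intro open_Int open_Collect_neq continuous_intros) auto
    ultimately obtain x where "x \<in> U \<inter> {x. a \<bullet> x \<noteq> 0}" "\<forall>a\<in>A. a \<bullet> x \<noteq> 0"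
      using insert.IH insert.prems by (metis insertCI)
    then show ?case by auto
qed auto

lemma bases_in_exchange:
  fixes X :: "(real ^ 'v::finite) set"
  assumes B: "B \<in> bases_in X" and rat: "\<forall>c\<in>X. rational_vec c"
    and b: "b \<in> B" and c: "c \<in> X" "dual_vector B b \<bullet> c \<noteq> 0"
  shows "insert c (B - {b}) \<in> bases_in X"
proof -
  have B': "independent B" "\<forall>c\<in>B. rational_vec c" "finite B" "span B = UNIV" "B \<subseteq> X"
    using assms finiteI_independent by (auto simp: bases_in_def)
  have z: "dual_vector B b \<bullet> x = 0" if "x \<in> span (B - {b})" for x
    using that
  proof (induction rule: span_induct_alt)
    case (step k x y)
    then show ?case using dual_vector(3)[OF B'(1,2) b, of x] by (simp add: inner_simps)
  qed simp
  then have cn: "c \<notin> span (B - {b})" using c by auto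
  then have ind: "independent (insert c (B - {b}))"
    by (intro independent_insertI independent_mono[OF B'(1)]) auto
  have "c \<notin> B - {b}" using cn span_base[of c "B - {b}"] by auto
  then have "card (insert c (B - {b})) = Suc (card (B - {b}))" using B'(3) by (intro card_insert_disjoint) auto
  also have "\<dots> = card B" using B'(3) b by (rule card_Suc_Diff1)
  also have "card B = dim (UNIV :: (real ^ 'v) set)"
    using dim_span_eq_card_independent[OF B'(1)] B'(4) by simp
  finally have "UNIV \<subseteq> span (insert c (B - {b}))"
    using ind by (intro card_ge_dim_independent) auto
  then have "span (insert c (B - {b})) = UNIV" by auto
  then show ?thesis using ind B' c by (auto simp: bases_in_def)
qed

text \<open>Walk along a segment from a generic point \<open>x0\<close> of the cell \<open>C\<close> to a generic point \<open>y\<close>. At the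
  first entry into a cone not containing \<open>x0\<close>, exchange the basis vector whose coordinate changes sign for
  a vector on the other side of the wall: the new cone contains \<open>x0\<close>, hence \<open>C\<close>, but not \<open>y\<close>.\<close>

lemma generic_chamber_point:
  fixes X :: "(real ^ 'v::finite) set"
  assumes X: "finite X" "\<forall>c\<in>X. rational_vec c"
    and x: "B0 \<in> bases_in X" "x \<in> convex_cone hull B0"
    and C: "C = \<Inter>{convex_cone hull B |B. B \<in> bases_in X \<and> x \<in> convex_cone hull B}"
    and U: "open U" "U \<noteq> {}" "U \<subseteq> C"
  obtains y where "y \<in> U" "\<And>B. B \<in> bases_in X \<Longrightarrow> y \<in> convex_cone hull B \<Longrightarrow> C \<subseteq> convex_cone hull B"
proof -
  let ?K = "\<lambda>B. convex_cone hull B" and ?d = dual_vector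
  define \<B> where "\<B> = bases_in X"
  have fin\<B>: "finite \<B>" using X(1) by (auto simp: \<B>_def bases_in_def intro: finite_subset[of _ "Pow X"])
  have finB: "finite B" if "B \<in> \<B>" for B
    using that X(1) finite_subset by (auto simp: \<B>_def bases_in_def)
  have K: "?K B = {x. \<forall>b\<in>B. 0 \<le> ?d B b \<bullet> x}" if "B \<in> \<B>" for B
    using bases_in_cone X(2) that by (simp add: \<B>_def)
  have dual: "?d B b \<bullet> b = 1" "\<And>c. c \<in> B \<Longrightarrow> c \<noteq> b \<Longrightarrow> ?d B b \<bullet> c = 0" if "B \<in> \<B>" "b \<in> B" for B b
  proof -
    have "independent B" "\<forall>c\<in>B. rational_vec c" using that X(2) by (auto simp: \<B>_def bases_in_def)
    from dual_vector(2,3)[OF this that(2)] show "?d B b \<bullet> b = 1" "\<And>c. c \<in> B \<Longrightarrow> c \<noteq> b \<Longrightarrow> ?d B b \<bullet> c = 0"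
      by blast+
  qed
  have d0: "?d B b \<noteq> 0" if "B \<in> \<B>" "b \<in> B" for B b using dual(1)[OF that] by auto
  have closedK: "closed (?K B)" if "B \<in> \<B>" for B
    using finB[OF that] by (simp add: closed_convex_cone_hull)
  have CK: "C \<subseteq> ?K B" if "B \<in> \<B>" "x \<in> ?K B" for B using that C by (auto simp: \<B>_def)
  have xC: "x \<in> C" using C by auto
  have convC: "convex C" unfolding C by (intro convex_Inter) (auto simp: convex_convex_cone_hull)
  have "interior C \<noteq> {}" using U interior_maximal[of U C] by auto
  then have xcl: "x \<in> closure (interior C)" using convex_closure_interior[OF convC] xC closure_subset by auto

  \<comment> \<open>\<open>W\<close> avoids every basis cone that misses \<open>x\<close>. Hence a
    basis cone containing a point of \<open>W\<close> contains \<open>x\<close>, and therefore all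
    of \<open>C\<close>.\<close>
  define W where "W = (\<Inter>B\<in>{B\<in>\<B>. x \<notin> ?K B}. - ?K B)"
  have "open W" unfolding W_def using fin\<B> closedK by (intro open_INT) auto
  moreover have "x \<in> W" by (auto simp: W_def)
  ultimately have ne: "W \<inter> interior C \<noteq> {}" using xcl open_Int_closure_eq_empty[of W "interior C"] by auto
  have op: "open (W \<inter> interior C)" using \<open>open W\<close> by auto
  have finA: "finite (\<Union>B\<in>\<B>. ?d B ` B)" using fin\<B> finB by auto
  have notin: "0 \<notin> (\<Union>B\<in>\<B>. ?d B ` B)" using d0 by force
  obtain x0 where x0: "x0 \<in> W \<inter> interior C" "\<forall>a\<in>(\<Union>B\<in>\<B>. ?d B ` B). a \<bullet> x0 \<noteq> 0"
    using open_avoid_hyperplanes[OF finA op ne notin] by (elim bexE)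
  have x0C: "x0 \<in> C" using x0 interior_subset by blast
  have x0x: "x \<in> ?K B" if "B \<in> \<B>" "x0 \<in> ?K B" for B using that x0(1) by (auto simp: W_def)
  have x0n: "?d B b \<bullet> x0 \<noteq> 0" if "B \<in> \<B>" "b \<in> B" for B b using x0(2) that by blast

  \<comment> \<open>If the segment from \<open>x0\<close> to \<open>y\<close> met the walls of
    \<open>b\<close> and \<open>b'\<close> at the same positive time, \<open>y\<close> would be
    orthogonal to \<open>nrm B b b'\<close>. Avoiding these vectors means that walls are met one at
    a time.\<close>
  define nrm where "nrm B b b' = (?d B b' \<bullet> x0) *\<^sub>R ?d B b - (?d B b \<bullet> x0) *\<^sub>R ?d B b'" for B b b'
  define A where "A = (\<Union>B\<in>\<B>. ?d B ` B) \<union> (\<Union>B\<in>\<B>. \<Union>b\<in>B. nrm B b ` (B - {b}))"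
  have finA': "finite A" using fin\<B> finB by (auto simp: A_def)
  have notinA: "0 \<notin> A"
  proof
    assume "0 \<in> A"
    then obtain B b b' where B: "B \<in> \<B>" "b \<in> B" "b' \<in> B" "b \<noteq> b'" "nrm B b b' = 0"
      using d0 by (force simp: A_def)
    have "nrm B b b' \<bullet> b = ?d B b' \<bullet> x0"
      using dual(1)[OF B(1,2)] dual(2)[OF B(1,3,2)] B(4) by (simp add: nrm_def inner_diff_left)
    then show False using B x0n by simp
  qed
  obtain y where y: "y \<in> U" "\<forall>a\<in>A. a \<bullet> y \<noteq> 0"
    using open_avoid_hyperplanes[OF finA' U(1,2) notinA] by (elim bexE)
  have yn: "?d B b \<bullet> y \<noteq> 0" if "B \<in> \<B>" "b \<in> B" for B b using y(2) that by (auto simp: A_def)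
  have ynn: "nrm B b b' \<bullet> y \<noteq> 0" if "B \<in> \<B>" "b \<in> B" "b' \<in> B" "b \<noteq> b'" for B b b'
  proof -
    have "nrm B b b' \<in> A" using that unfolding A_def by blast
    then show ?thesis using y(2) by simp
  qed
  have yC: "y \<in> C" using y U by auto

  have "x0 \<in> ?K B" if B: "B \<in> \<B>" "y \<in> ?K B" for B
  proof (rule ccontr)
    assume nB: "x0 \<notin> ?K B"
    define \<gamma> where "\<gamma> t = (1 - t) *\<^sub>R x0 + t *\<^sub>R y" for t :: real
    have cont: "continuous_on UNIV \<gamma>" unfolding \<gamma>_def by (intro continuous_intros)
    \<comment> \<open>The times at which the segment lies in a cone missing \<open>x0\<close>. They
      form a compact set, so there is a first one.\<close>
    define \<Theta> where "\<Theta> = (\<Union>B\<in>{B\<in>\<B>. x0 \<notin> ?K B}. {0..1} \<inter> \<gamma> -` ?K B)"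
    have "closed (\<gamma> -` ?K B)" if "B \<in> \<B>" for B
      using closedK[OF that] cont by (intro closed_vimage) auto
    then have "compact \<Theta>" unfolding \<Theta>_def using fin\<B>
      by (intro compact_UN) (auto intro!: compact_Int_closed)
    moreover have "1 \<in> \<Theta>" using B nB by (auto simp: \<Theta>_def \<gamma>_def)
    ultimately obtain t0 where t0: "t0 \<in> \<Theta>" "\<And>t. t \<in> \<Theta> \<Longrightarrow> t0 \<le> t"
      using compact_attains_inf[of \<Theta>] by auto
    obtain B where B: "B \<in> \<B>" "x0 \<notin> ?K B" "\<gamma> t0 \<in> ?K B" "0 \<le> t0" "t0 \<le> 1"
      using t0(1) by (auto simp: \<Theta>_def)
    have "\<gamma> 0 = x0" by (simp add: \<gamma>_def)
    then have t0pos: "t0 > 0" using B by (cases "t0 = 0") auto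
    have inner\<gamma>: "a \<bullet> \<gamma> t = (1 - t) * (a \<bullet> x0) + t * (a \<bullet> y)" for a t by (simp add: \<gamma>_def inner_simps)
    have ev: "\<forall>\<^sub>F t in at_left t0. 0 < a \<bullet> \<gamma> t" if "0 < a \<bullet> \<gamma> t0" for a
    proof -
      have "((\<lambda>t. a \<bullet> \<gamma> t) \<longlongrightarrow> a \<bullet> \<gamma> t0) (at_left t0)"
        unfolding inner\<gamma> by (intro tendsto_intros)
      then show ?thesis using that by (rule order_tendstoD(1))
    qed
    have ev0: "\<forall>\<^sub>F t in at_left t0. 0 \<le> t \<and> t < t0"
      using t0pos by (auto intro: eventually_at_leftI[of 0])
    have early: "x0 \<in> ?K B'" if "B' \<in> \<B>" "\<gamma> t \<in> ?K B'" "0 \<le> t" "t < t0" for t B'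
    proof (rule ccontr)
      assume "x0 \<notin> ?K B'"
      then have "t \<in> \<Theta>" using that B(5) by (auto simp: \<Theta>_def)
      then show False using t0(2) that(4) by force
    qed
    have nonneg: "0 \<le> ?d B b \<bullet> \<gamma> t0" if "b \<in> B" for b using B(3) that by (simp add: K[OF B(1)])
    have notpos: "\<not> (\<forall>b\<in>B. \<forall>\<^sub>F t in at_left t0. 0 \<le> ?d B b \<bullet> \<gamma> t)"
    proof
      assume "\<forall>b\<in>B. \<forall>\<^sub>F t in at_left t0. 0 \<le> ?d B b \<bullet> \<gamma> t"
      then have "\<forall>\<^sub>F t in at_left t0. \<forall>b\<in>B. 0 \<le> ?d B b \<bullet> \<gamma> t"
        using finB[OF B(1)] by (simp add: eventually_ball_finite)
      with ev0 have "\<forall>\<^sub>F t in at_left t0. (0 \<le> t \<and> t < t0) \<and> (\<forall>b\<in>B. 0 \<le> ?d B b \<bullet> \<gamma> t)"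
        by (rule eventually_conj)
      then obtain t where "0 \<le> t" "t < t0" "\<gamma> t \<in> ?K B"
        using eventually_happens[of _ "at_left t0"] by (auto simp: K[OF B(1)])
      then show False using early[OF B(1)] B(2) by blast
    qed
    \<comment> \<open>This coordinate takes negative values arbitrarily shortly before
      \<open>t0\<close> and is nonnegative at \<open>t0\<close>. Being affine in \<open>t\<close>,
      it vanishes at \<open>t0\<close> and is negative at \<open>x0\<close>.\<close>
    then obtain b where b: "b \<in> B" "\<not> (\<forall>\<^sub>F t in at_left t0. 0 \<le> ?d B b \<bullet> \<gamma> t)" by blast
    define a where "a = ?d B b"
    have a0: "a \<bullet> \<gamma> t0 = 0"
    proof (rule ccontr)
      assume "a \<bullet> \<gamma> t0 \<noteq> 0"
      then have "0 < a \<bullet> \<gamma> t0" using nonneg[OF b(1)] by (simp add: a_def)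
      then have "\<forall>\<^sub>F t in at_left t0. 0 \<le> a \<bullet> \<gamma> t"
        by (rule eventually_mono[OF ev]) simp
      then show False using b(2) by (simp add: a_def)
    qed
    have line: "t0 * (a \<bullet> \<gamma> t) = (t0 - t) * (a \<bullet> x0)" for t
    proof -
      have "t0 * (a \<bullet> \<gamma> t) = t0 * (1 - t) * (a \<bullet> x0) + t * (t0 * (a \<bullet> y))"
        by (simp add: inner\<gamma> algebra_simps)
      also have "t0 * (a \<bullet> y) = - ((1 - t0) * (a \<bullet> x0))" using a0 by (simp add: inner\<gamma>)
      finally show ?thesis by (simp add: algebra_simps)
    qed
    have ax0: "a \<bullet> x0 < 0"
    proof (rule ccontr)
      assume "\<not> a \<bullet> x0 < 0"
      then have "0 \<le> a \<bullet> \<gamma> t" if "t < t0" for t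
        using line[of t] that t0pos by (smt (verit) mult_nonneg_nonneg mult_pos_neg)
      then have "\<forall>\<^sub>F t in at_left t0. 0 \<le> a \<bullet> \<gamma> t"
        by (intro eventually_mono[OF ev0]) simp
      then show False using b(2) by (simp add: a_def)
    qed
    have others: "0 < ?d B b' \<bullet> \<gamma> t0" if b': "b' \<in> B" "b' \<noteq> b" for b'
    proof (rule ccontr)
      assume "\<not> 0 < ?d B b' \<bullet> \<gamma> t0"
      then have z: "?d B b' \<bullet> \<gamma> t0 = 0" using nonneg[OF b'(1)] by simp
      have "t0 * (nrm B b b' \<bullet> y) = (?d B b' \<bullet> x0) * (t0 * (a \<bullet> y)) - (a \<bullet> x0) * (t0 * (?d B b' \<bullet> y))"
        by (simp add: nrm_def inner_simps a_def algebra_simps)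
      also have "t0 * (a \<bullet> y) = - ((1 - t0) * (a \<bullet> x0))" using a0 by (simp add: inner\<gamma>)
      also have "t0 * (?d B b' \<bullet> y) = - ((1 - t0) * (?d B b' \<bullet> x0))" using z by (simp add: inner\<gamma>)
      finally have "t0 * (nrm B b b' \<bullet> y) = 0" by (simp add: algebra_simps)
      then show False using t0pos ynn[OF B(1) b(1) b'(1)] b'(2) by simp
    qed
    \<comment> \<open>Otherwise the cone of \<open>B0\<close>, which contains \<open>C\<close> and
      thus \<open>x0\<close>, would lie in the half-space where \<open>a\<close> is
      nonnegative.\<close>
    have "\<exists>c\<in>X. a \<bullet> c < 0"
    proof (rule ccontr)
      assume "\<not> (\<exists>c\<in>X. a \<bullet> c < 0)"
      then have "B0 \<subseteq> {z. 0 \<le> a \<bullet> z}" using x(1) by (force simp: bases_in_def)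
      then have "?K B0 \<subseteq> {z. 0 \<le> a \<bullet> z}" by (intro hull_minimal convex_cone_halfspace_ge)
      moreover have "x0 \<in> ?K B0" using CK[of B0] x x0C by (auto simp: \<B>_def)
      ultimately show False using ax0 by auto
    qed
    then obtain c where c: "c \<in> X" "a \<bullet> c < 0" by blast
    define B' where "B' = insert c (B - {b})"
    have B': "B' \<in> \<B>"
      unfolding B'_def \<B>_def
      using bases_in_exchange[of B X b c] B(1) X(2) b(1) c by (simp add: \<B>_def a_def)
    \<comment> \<open>The coordinates of the segment in the exchanged basis. At \<open>t0\<close>
      they equal the old positive coordinates, so they stay positive shortly before.\<close>
    define f where "f b' t = ?d B b' \<bullet> \<gamma> t - (a \<bullet> \<gamma> t) / (a \<bullet> c) * (?d B b' \<bullet> c)" for b' t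
    have expand: "\<gamma> t = ((a \<bullet> \<gamma> t) / (a \<bullet> c)) *\<^sub>R c + (\<Sum>b'\<in>B - {b}. f b' t *\<^sub>R b')" for t
    proof -
      have e: "z = (a \<bullet> z) *\<^sub>R b + (\<Sum>b'\<in>B - {b}. (?d B b' \<bullet> z) *\<^sub>R b')" for z
        using bases_in_expansion[of B X z] B(1) X(2) finB[OF B(1)] b(1)
        by (simp add: \<B>_def a_def sum.remove)
      have "((a \<bullet> \<gamma> t) / (a \<bullet> c)) *\<^sub>R c = ((a \<bullet> \<gamma> t) / (a \<bullet> c)) *\<^sub>R
          ((a \<bullet> c) *\<^sub>R b + (\<Sum>b'\<in>B - {b}. (?d B b' \<bullet> c) *\<^sub>R b'))"
        using e[of c] by simp
      also have "\<dots> = (a \<bullet> \<gamma> t) *\<^sub>R b + (\<Sum>b'\<in>B - {b}. ((a \<bullet> \<gamma> t) / (a \<bullet> c) * (?d B b' \<bullet> c)) *\<^sub>R b')"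
        using c by (simp add: scaleR_right_distrib scaleR_sum_right)
      finally show ?thesis
        using e[of "\<gamma> t"] by (simp add: f_def scaleR_left_diff_distrib sum_subtractf)
    qed
    have "\<forall>\<^sub>F t in at_left t0. 0 < f b' t" if "b' \<in> B - {b}" for b'
    proof -
      have "((\<lambda>t. f b' t) \<longlongrightarrow> f b' t0) (at_left t0)"
        unfolding f_def inner\<gamma> by (intro tendsto_intros) (use c in auto)
      moreover have "0 < f b' t0" using others[of b'] that a0 by (simp add: f_def)
      ultimately show ?thesis by (rule order_tendstoD(1))
    qed
    then have "\<forall>\<^sub>F t in at_left t0. \<forall>b'\<in>B - {b}. 0 < f b' t"
      using finB[OF B(1)] by (simp add: eventually_ball_finite)
    with ev0 have "\<forall>\<^sub>F t in at_left t0. (0 \<le> t \<and> t < t0) \<and> (\<forall>b'\<in>B - {b}. 0 < f b' t)"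
      by (rule eventually_conj)
    then obtain t where t: "0 \<le> t" "t < t0" "\<forall>b'\<in>B - {b}. 0 < f b' t"
      using eventually_happens[of _ "at_left t0"] by auto
    have "a \<bullet> \<gamma> t \<le> 0"
      using line[of t] t(2) t0pos ax0 by (smt (verit) mult_pos_neg mult_pos_pos)
    then have "0 \<le> (a \<bullet> \<gamma> t) / (a \<bullet> c)" using c by (simp add: divide_nonpos_neg)
    then have "((a \<bullet> \<gamma> t) / (a \<bullet> c)) *\<^sub>R c + (\<Sum>b'\<in>B - {b}. f b' t *\<^sub>R b') \<in> ?K B'"
      using t(3) finB[OF B(1)]
      by (intro convex_cone_hull_add convex_cone_hull_mul convex_cone_hull_sum)
        (auto simp: B'_def hull_inc less_imp_le)
    then have "\<gamma> t \<in> ?K B'" using expand by simp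
    then have "x0 \<in> ?K B'" using early[OF B'] t by blast
    \<comment> \<open>The new cone contains \<open>y\<close>, so \<open>a\<close> is at most 0
      there; yet \<open>a\<close> rises from a negative value at \<open>x0\<close> to 0 at
      \<open>t0 \<le> 1\<close>, so it is at least 0 at \<open>y\<close>. Genericity of
      \<open>y\<close> excludes 0.\<close>
    then have "C \<subseteq> ?K B'" using x0x CK B' by blast
    moreover have "?K B' \<subseteq> {z. a \<bullet> z \<le> 0}"
      using c dual(2)[OF B(1) b(1)]
      by (intro hull_minimal convex_cone_halfspace_le) (auto simp: B'_def a_def)
    ultimately have "a \<bullet> y \<le> 0" using yC by auto
    moreover have "t0 * (a \<bullet> y) = - ((1 - t0) * (a \<bullet> x0))" using a0 by (simp add: inner\<gamma>)
    then have "0 \<le> t0 * (a \<bullet> y)" using ax0 B(5) by (simp add: mult_nonneg_nonpos)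
    then have "0 \<le> a \<bullet> y" using t0pos by (simp add: zero_le_mult_iff)
    ultimately show False using yn[OF B(1) b(1)] by (simp add: a_def)
  qed
  then show thesis using that[of y] y(1) x0x CK by (auto simp: \<B>_def)
qed

section \<open>Plumbing trees\<close>

lemma rooted_path:
  assumes "rooted E v A" "symp E"
  shows "p \<in> A \<Longrightarrow> q \<in> A \<Longrightarrow>
    \<exists>xs. xs \<noteq> [] \<and> distinct xs \<and> set xs \<subseteq> A \<and> hd xs = p \<and> last xs = q \<and> successively E xs"
  using assms
proof (induction arbitrary: p q rule: rooted.induct)
  case rooted_root
  then show ?case by (intro exI[of _ "[v]"]) auto
next
  case (rooted_grow A w p0)
  have p0: "p0 \<in> A" "E w p0" "E p0 w" using rooted_grow.hyps rooted_grow.prems(3) by (auto dest: sympD)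
  have IH: "\<exists>xs. xs \<noteq> [] \<and> distinct xs \<and> set xs \<subseteq> A \<and> hd xs = p \<and> last xs = q \<and> successively E xs"
    if "p \<in> A" "q \<in> A" for p q
    using rooted_grow.IH[OF that rooted_grow.prems(3)] .
  consider "p = w" "q = w" | "p = w" "q \<in> A" | "p \<in> A" "q = w" | "p \<in> A" "q \<in> A"
    using rooted_grow.prems by auto
  then show ?case
  proof cases
    case 1
    then show ?thesis by (intro exI[of _ "[w]"]) auto
  next
    case 2
    then obtain xs where "xs \<noteq> []" "distinct xs" "set xs \<subseteq> A" "hd xs = p0" "last xs = q" "successively E xs"
      using IH[OF p0(1) 2(2)] by auto
    then show ?thesis using 2 p0 rooted_grow.hyps(2)
      by (intro exI[of _ "w # xs"]) (auto simp: successively_Cons)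
  next
    case 3
    then obtain xs where "xs \<noteq> []" "distinct xs" "set xs \<subseteq> A" "hd xs = p" "last xs = p0" "successively E xs"
      using IH[OF 3(1) p0(1)] by auto
    then show ?thesis using 3 p0 rooted_grow.hyps(2)
      by (intro exI[of _ "xs @ [w]"]) (auto simp: successively_append_iff)
  next
    case 4
    then show ?thesis using IH[OF 4] by auto
  qed
qed

text \<open>Connectedness gives an edge leaving \<open>A\<close>. A second neighbour in
  \<open>A\<close> of its outer end would close a cycle with a simple path inside
  \<open>A\<close>.\<close>

lemma tree_rooted_extend:
  fixes G :: "'v::finite plumbing"
  assumes T: "is_tree G" and A: "rooted (adj G) v A" "A \<noteq> UNIV"
  shows "\<exists>w. w \<notin> A \<and> rooted (adj G) v (insert w A)"
proof -
  have sym: "symp (adj G)" and conn: "\<And>v w. (adj G)\<^sup>*\<^sup>* v w" and nocyc: "\<And>c. \<not> is_cycle G c"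
    using T by (auto simp: is_tree_def)
  obtain z where z: "z \<notin> A" using A(2) by auto
  have "\<exists>p w. p \<in> A \<and> w \<notin> A \<and> adj G p w"
  proof (rule ccontr)
    assume *: "\<nexists>p w. p \<in> A \<and> w \<notin> A \<and> adj G p w"
    have "x \<in> A" if "(adj G)\<^sup>*\<^sup>* v x" for x
      using that rooted_root_mem[OF A(1)] * by (induction rule: rtranclp_induct) blast+
    then show False using conn z by blast
  qed
  then obtain p w where pw: "p \<in> A" "w \<notin> A" "adj G p w" by blast
  have wp: "adj G w p" using pw(3) sym by (auto dest: sympD)
  have "{u \<in> A. adj G w u} = {p}"
  proof (rule ccontr)
    assume "{u \<in> A. adj G w u} \<noteq> {p}"
    then obtain q where q: "q \<in> A" "adj G w q" "q \<noteq> p" using pw wp by blast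
    obtain xs where xs: "xs \<noteq> []" "distinct xs" "set xs \<subseteq> A" "hd xs = p" "last xs = q" "successively (adj G) xs"
      using rooted_path[OF A(1) sym pw(1) q(1)] by auto
    have "length xs \<ge> 2"
    proof (rule ccontr)
      assume "\<not> 2 \<le> length xs"
      then have "length xs = Suc 0" using xs(1) length_greater_0_conv[of xs] by linarith
      then obtain x where "xs = [x]" by (auto simp: length_Suc_conv)
      then show False using xs(4,5) q(3) by simp
    qed
    then have "is_cycle G (w # xs)"
      using xs pw wp sympD[OF sym q(2)] unfolding is_cycle_def successively_conv_nth[symmetric]
      by (auto simp: successively_Cons)
    then show False using nocyc by blast
  qed
  then show ?thesis using rooted_grow[OF A(1) pw(2,1)] pw(2) by blast
qed

lemma tree_rooted_UNIV:
  fixes G :: "'v::finite plumbing"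
  assumes T: "is_tree G"
  shows "rooted (adj G) v UNIV"
proof -
  have "\<exists>A. rooted (adj G) v A \<and> (\<forall>B. rooted (adj G) v B \<longrightarrow> card B \<le> card A)"
    by (rule ex_has_greatest_nat[of _ "{v}" _ "card (UNIV :: 'v set) + 1"])
      (auto intro: rooted_root simp: less_Suc_eq_le card_mono)
  then obtain A where A: "rooted (adj G) v A" "\<And>B. rooted (adj G) v B \<Longrightarrow> card B \<le> card A" by blast
  have "A = UNIV"
  proof (rule ccontr)
    assume "A \<noteq> UNIV"
    then obtain w where w: "w \<notin> A" "rooted (adj G) v (insert w A)"
      using tree_rooted_extend[OF T A(1)] by blast
    then show False using A(2)[OF w(2)] by simp
  qed
  then show ?thesis using A by simp
qed

section \<open>The intersection form, its minimum principle and the dual basis\<close>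

locale plumbing_graph =
  fixes G :: "'v::finite plumbing"
  assumes plumbing: "plumbing_tree G"
begin

abbreviation b :: "'v \<Rightarrow> int" where "b w \<equiv> - euler G w"

text \<open>If \<open>x = \<Sum>\<^sub>w n\<^sub>w E\<^sub>w\<^sup>*\<close> then \<open>ndeg x w = n\<^sub>w\<close>.\<close>

definition ndeg :: "real ^ 'v \<Rightarrow> 'v \<Rightarrow> real" where
  "ndeg x w = - iform G x (axis w 1)"

lemma sym: "symp (adj G)" and irr: "irreflp (adj G)"
  using plumbing by (auto simp: plumbing_tree_def is_tree_def)

lemma adj_sym: "adj G u w \<Longrightarrow> adj G w u"
  using sym by (auto dest: sympD)

lemma adj_irr [simp]: "\<not> adj G w w"
  using irr by (auto simp: irreflp_def)

lemma rooted_UNIV: "rooted (adj G) v UNIV"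
  using plumbing by (auto simp: plumbing_tree_def intro: tree_rooted_UNIV)

lemma iform_eq: "iform G x y = (\<Sum>v\<in>UNIV. \<Sum>w\<in>UNIV. x $ v * intersection_matrix G $ v $ w * y $ w)"
  by (simp add: iform_def inner_vec_def matrix_vector_mult_def sum_distrib_left mult.assoc)

lemma intersection_matrix_sym: "intersection_matrix G $ v $ w = intersection_matrix G $ w $ v"
  using adj_sym[of v w] adj_sym[of w v] by (auto simp: intersection_matrix_def)

lemma iform_sym: "iform G x y = iform G y x"
proof -
  have "iform G x y = (\<Sum>w\<in>UNIV. \<Sum>v\<in>UNIV. x $ v * intersection_matrix G $ v $ w * y $ w)"
    unfolding iform_eq by (rule sum.swap)
  also have "\<dots> = iform G y x"
    unfolding iform_eq
  proof (intro sum.cong refl)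
    fix v w
    show "x $ v * intersection_matrix G $ v $ w * y $ w = y $ w * intersection_matrix G $ w $ v * x $ v"
      using intersection_matrix_sym[of v w] by simp
  qed
  finally show ?thesis .
qed

lemma iform_linear_left:
  "iform G (x + y) z = iform G x z + iform G y z" "iform G (x - y) z = iform G x z - iform G y z"
  "iform G (c *\<^sub>R x) z = c * iform G x z" "iform G 0 z = 0" "iform G (- x) z = - iform G x z"
  by (simp_all add: iform_def inner_simps)

lemma iform_linear_right:
  "iform G z (x + y) = iform G z x + iform G z y" "iform G z (x - y) = iform G z x - iform G z y"
  "iform G z (c *\<^sub>R x) = c * iform G z x" "iform G z 0 = 0"  "iform G z (- x) = - iform G z x"
  unfolding iform_sym[of z "x + y"] iform_sym[of z "x - y"] iform_sym[of z "c *\<^sub>R x"] iform_sym[of z 0]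
    iform_sym[of z "- x"] iform_sym[of z x] iform_sym[of z y]
  by (rule iform_linear_left)+

lemmas iform_linear = iform_linear_left iform_linear_right

lemma ndeg_linear [simp]:
  "ndeg (x + y) w = ndeg x w + ndeg y w" "ndeg (x - y) w = ndeg x w - ndeg y w"
  "ndeg (c *\<^sub>R x) w = c * ndeg x w" "ndeg 0 w = 0" "ndeg (- x) w = - ndeg x w"
  by (simp_all add: ndeg_def iform_linear)

lemma ndeg_sum: "ndeg (\<Sum>i\<in>I. f i) w = (\<Sum>i\<in>I. ndeg (f i) w)"
  by (induction I rule: infinite_finite_induct) auto

lemma ndeg_eq: "ndeg x w = of_int (b w) * x $ w - (\<Sum>u | adj G w u. x $ u)"
proof -
  have "iform G x (axis w 1) = (\<Sum>v\<in>UNIV. \<Sum>u\<in>UNIV. if u = w then x $ v * intersection_matrix G $ v $ w else 0)"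
    unfolding iform_eq by (intro sum.cong refl) (simp add: axis_def)
  also have "\<dots> = (\<Sum>v\<in>UNIV. x $ v * intersection_matrix G $ w $ v)"
    using intersection_matrix_sym[of _ w] by (intro sum.cong) (auto simp: sum.delta)
  also have "\<dots> = x $ w * of_int (euler G w) + (\<Sum>v\<in>UNIV - {w}. x $ v * intersection_matrix G $ w $ v)"
    by (simp add: sum.remove[of UNIV w] intersection_matrix_def)
  also have "(\<Sum>v\<in>UNIV - {w}. x $ v * intersection_matrix G $ w $ v) = (\<Sum>v\<in>UNIV - {w}. if adj G w v then x $ v else 0)"
    by (intro sum.cong) (auto simp: intersection_matrix_def)
  also have "\<dots> = (\<Sum>u | adj G w u. x $ u)"
    by (intro sum.mono_neutral_cong_right) auto
  finally show ?thesis by (simp add: ndeg_def)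
qed

lemma iform_ndeg: "iform G x y = - (\<Sum>w\<in>UNIV. ndeg x w * y $ w)"
proof -
  have "y = (\<Sum>w\<in>UNIV. y $ w *\<^sub>R axis w 1)"
    using basis_expansion[of y] by (simp add: scalar_mult_eq_scaleR)
  then have "iform G x y = iform G x (\<Sum>w\<in>UNIV. y $ w *\<^sub>R axis w 1)" by simp
  also have "\<dots> = (\<Sum>w\<in>UNIV. y $ w * iform G x (axis w 1))"
  proof -
    have "iform G x (\<Sum>w\<in>I. y $ w *\<^sub>R axis w 1) = (\<Sum>w\<in>I. y $ w * iform G x (axis w 1))" for I
      by (induction I rule: infinite_finite_induct) (auto simp: iform_linear)
    then show ?thesis .
  qed
  finally show ?thesis by (simp add: ndeg_def sum_negf mult.commute)
qed

lemma ndeg_axis: "ndeg (axis v 1) w = (if v = w then of_int (b w) else if adj G w v then -1 else 0)"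
proof -
  have "(\<Sum>u | adj G w u. axis v (1::real) $ u) = (\<Sum>u | adj G w u. if u = v then 1 else 0)"
    by (intro sum.cong) (auto simp: axis_def)
  then show ?thesis by (auto simp: ndeg_eq axis_def)
qed

lemma iform_neg: "x \<noteq> 0 \<Longrightarrow> iform G x x < 0"
  using plumbing by (auto simp: plumbing_tree_def negative_definite_def)

lemma ndeg_inj: "(\<And>w. ndeg x w = ndeg y w) \<Longrightarrow> x = y"
proof (rule ccontr)
  assume eq: "\<And>w. ndeg x w = ndeg y w" and "x \<noteq> y"
  then have "iform G (x - y) (x - y) < 0" by (intro iform_neg) auto
  then show False by (simp add: iform_ndeg eq)
qed

text \<open>Split \<open>x = p - y\<close> into positive and negative part. The hypothesis gives
  \<open>(x, y) \<le> 0\<close>, disjointness of supports gives \<open>(p, y) \<ge> 0\<close>, hence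
  \<open>(y, y) \<ge> 0\<close> and \<open>y = 0\<close>.\<close>

lemma minimum_principle:
  assumes "\<And>w. x $ w < 0 \<Longrightarrow> 0 \<le> ndeg x w"
  shows "0 \<le> x"
proof -
  define p y :: "real ^ 'v" where "p = (\<chi> w. max 0 (x $ w))" and "y = (\<chi> w. max 0 (- x $ w))"
  have xpy: "x = p - y" by (simp add: p_def y_def vec_eq_iff max_def)
  have "iform G x y \<le> 0"
  proof -
    have "0 \<le> ndeg x w * y $ w" for w
      using assms[of w] by (cases "x $ w < 0") (auto simp: y_def mult_nonneg_nonpos)
    then show ?thesis unfolding iform_ndeg by (simp add: sum_nonneg)
  qed
  moreover have "iform G p y \<ge> 0"
  proof -
    have "ndeg p w * y $ w \<le> 0" for w
    proof (cases "x $ w < 0")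
      case True
      have "0 \<le> (\<Sum>u | adj G w u. p $ u)" by (intro sum_nonneg) (simp add: p_def)
      then have "ndeg p w \<le> 0" using True by (simp add: ndeg_eq p_def)
      then show ?thesis by (simp add: y_def mult_nonpos_nonneg)
    qed (simp add: y_def)
    then show ?thesis unfolding iform_ndeg by (simp add: sum_nonpos)
  qed
  ultimately have "iform G y y \<ge> 0" by (simp add: xpy iform_linear)
  then have "y = 0" using iform_neg[of y] by force
  then have "x = p" using xpy by simp
  moreover have "0 \<le> p" by (simp add: less_eq_vec_def p_def)
  ultimately show ?thesis by simp
qed

lemma exists_dual:
  "\<exists>x. rational_vec x \<and> (\<forall>w. ndeg x w = (if w = v then 1 else 0))"
proof -
  define a where "a w = - (intersection_matrix G *v axis w 1)" for w
  have a: "a w \<bullet> x = ndeg x w" for w x by (simp add: a_def ndeg_def iform_def inner_commute)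
  have rat: "rational_vec (a w)" for w
    by (simp add: a_def rational_vec_def matrix_vector_mult_basis column_def intersection_matrix_def)
  define f where "f x = (\<chi> w. ndeg x w)" for x :: "real ^ 'v"
  have "linear f" by (intro linearI) (auto simp: f_def vec_eq_iff)
  moreover have "inj f" by (intro injI ndeg_inj) (metis f_def vec_lambda_beta)
  ultimately have "surj f" by (rule linear_injective_imp_surjective) simp
  then obtain z where "f z = axis v 1" by (metis surjD)
  then have z: "ndeg z w = (if w = v then 1 else 0)" for w 
    using arg_cong[OF \<open>f z = axis v 1\<close>, of "\<lambda>u. u $ w"] by (simp add: f_def axis_def)
  obtain u where u: "rational_vec u" "\<forall>c\<in>a ` (UNIV - {v}). c \<bullet> u = 0" "a v \<bullet> u = 1"
    by (rule rational_witness[of "a ` (UNIV - {v})" "a v" z]) (auto simp: rat a z)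
  then show ?thesis by (intro exI[of _ u]) (auto simp: a[symmetric])
qed

lemma dual_properties: "dual G v \<in> dual_latt G" "ndeg (dual G v) w = (if w = v then 1 else 0)"
proof -
  obtain x where x: "rational_vec x" "\<And>w. ndeg x w = (if w = v then 1 else 0)" using exists_dual by blast
  have "x \<in> dual_latt G"
    using x by (auto simp: dual_latt_def rational_vec_def latt_def iform_ndeg intro!: Ints_minus Ints_sum)
  have eq: "(\<forall>w. iform G y (axis w 1) = (if v = w then -1 else 0)) \<longleftrightarrow> (\<forall>w. ndeg y w = (if w = v then 1 else 0))" for y
    by (rule all_cong1) (auto simp: ndeg_def)
  have "\<exists>!x. x \<in> dual_latt G \<and> (\<forall>w. iform G x (axis w 1) = (if v = w then -1 else 0))"
    unfolding eq
  proof (rule ex1I[of _ x])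
    show "y = x" if "y \<in> dual_latt G \<and> (\<forall>w. ndeg y w = (if w = v then 1 else 0))" for y
      using that x(2) by (intro ndeg_inj) simp
  qed (use x \<open>x \<in> dual_latt G\<close> in simp)
  from theI'[OF this] have "dual G v \<in> dual_latt G \<and> (\<forall>w. iform G (dual G v) (axis w 1) = (if v = w then -1 else 0))"
    by (simp add: dual_def)
  then show "dual G v \<in> dual_latt G" "ndeg (dual G v) w = (if w = v then 1 else 0)"
    by (auto simp: ndeg_def)
qed

lemma ndeg_dual_sum: "ndeg (\<Sum>v\<in>UNIV. c v *\<^sub>R dual G v) w = c w"
proof -
  have "ndeg (\<Sum>v\<in>UNIV. c v *\<^sub>R dual G v) w = (\<Sum>v\<in>UNIV. if v = w then c v else 0)"
    unfolding ndeg_sum by (intro sum.cong) (auto simp: dual_properties(2))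
  then show ?thesis by simp
qed

lemma dual_expansion: "x = (\<Sum>v\<in>UNIV. ndeg x v *\<^sub>R dual G v)"
  by (rule ndeg_inj) (simp add: ndeg_dual_sum)

lemma rational_dual: "rational_vec (dual G v)"
  using dual_properties(1) by (auto simp: dual_latt_def rational_vec_def)

lemma dual_latt_iff: "x \<in> dual_latt G \<longleftrightarrow> (\<forall>w. ndeg x w \<in> \<int>)"
proof
  assume "x \<in> dual_latt G"
  moreover have "axis w 1 \<in> (latt :: (real ^ 'v) set)" for w by (auto simp: latt_def axis_def)
  ultimately show "\<forall>w. ndeg x w \<in> \<int>" by (auto simp: dual_latt_def ndeg_def)
next
  assume *: "\<forall>w. ndeg x w \<in> \<int>"
  have "x $ w = (\<Sum>v\<in>UNIV. ndeg x v * dual G v $ w)" for w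
    by (subst dual_expansion[of x]) simp
  moreover have "(\<Sum>v\<in>UNIV. ndeg x v * dual G v $ w) \<in> \<rat>" for w
    using * rational_dual Ints_subset_Rats by (intro Rats_sum Rats_mult) (auto simp: rational_vec_def)
  ultimately show "x \<in> dual_latt G"
    using * by (auto simp: dual_latt_def latt_def iform_ndeg intro!: Ints_minus Ints_sum)
qed

lemma latt_ndeg: "x \<in> latt \<Longrightarrow> ndeg x w \<in> \<int>"
  by (auto simp: ndeg_eq latt_def intro!: Ints_diff Ints_mult Ints_sum Ints_minus)

lemma latt_dual_latt: "x \<in> latt \<Longrightarrow> x \<in> dual_latt G"
  by (simp add: dual_latt_iff latt_ndeg)

lemma ndeg_nonneg_imp_nonneg: "(\<And>w. 0 \<le> ndeg x w) \<Longrightarrow> 0 \<le> x $ w"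
  using minimum_principle[of x] by (simp add: less_eq_vec_def)

text \<open>Nonnegativity is the minimum principle. At a zero coordinate the degree is minus the sum
  over the neighbours and still nonnegative, so zeros spread along edges and the whole vector would
  vanish.\<close>

lemma dual_pos: "dual G v $ w > 0"
proof (rule ccontr)
  have nn: "0 \<le> dual G v $ u" for u by (rule ndeg_nonneg_imp_nonneg) (simp add: dual_properties)
  assume "\<not> dual G v $ w > 0"
  then have w0: "dual G v $ w = 0" using nn[of w] by simp
  have step: "dual G v $ u' = 0" if "dual G v $ u = 0" "adj G u u'" for u u'
  proof -
    have "0 \<le> ndeg (dual G v) u" by (simp add: dual_properties)
    then have "(\<Sum>c | adj G u c. dual G v $ c) \<le> 0" using that by (simp add: ndeg_eq)
    moreover have "dual G v $ u' \<le> (\<Sum>c | adj G u c. dual G v $ c)"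
      using that nn by (intro member_le_sum) auto
    ultimately show ?thesis using nn[of u'] by simp
  qed
  have "(adj G)\<^sup>*\<^sup>* w u" for u using plumbing by (auto simp: plumbing_tree_def is_tree_def)
  then have "dual G v $ u = 0" for u
  proof (induction rule: rtranclp_induct)
    case base show ?case by (rule w0)
  next
    case (step y z) then show ?case using \<open>\<And>u u'. dual G v $ u = 0 \<Longrightarrow> adj G u u' \<Longrightarrow> dual G v $ u' = 0\<close>[of y z] by simp
  qed
  then have "dual G v = 0" by (simp add: vec_eq_iff)
  then show False using dual_properties(2)[of v v] by simp
qed

lemma node_space_ndeg: "x \<in> node_space G \<Longrightarrow> w \<notin> nodes G \<Longrightarrow> ndeg x w = 0"
  unfolding node_space_def
proof (induction rule: span_induct_alt)
  case (step c x y)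
  then obtain n where "n \<in> nodes G" "x = dual G n" by blast
  with step show ?case by (auto simp: dual_properties(2))
qed simp

lemma le_iff_pr_le:
  assumes l: "l \<in> node_space G" and x: "\<And>w. 0 \<le> ndeg x w"
  shows "l \<le> x \<longleftrightarrow> pr G l \<le> pr G x"
proof
  assume "l \<le> x" then show "pr G l \<le> pr G x" by (simp add: less_eq_vec_def pr_def)
next
  assume le: "pr G l \<le> pr G x"
  have "0 \<le> x - l"
  proof (rule minimum_principle)
    fix w assume "(x - l) $ w < 0"
    moreover have "w \<in> nodes G \<Longrightarrow> l $ w \<le> x $ w" using le[unfolded less_eq_vec_def, rule_format, of w] by (simp add: pr_def)
    ultimately have "w \<notin> nodes G" by auto
    then show "0 \<le> ndeg (x - l) w" using x node_space_ndeg[OF l] by simp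
  qed
  then show "l \<le> x" by simp
qed

end

section \<open>The step formula for the counting function\<close>

context plumbing_graph
begin

abbreviation zfactor :: "'v \<Rightarrow> real fps" where
  "zfactor w \<equiv> power_int (1 - fps_X) (int (valency G w) - 2)"

text \<open>A form without negative exponents, uniform in the valency, from which both conditions of
  \<open>tree_kernel\<close> are obtained.\<close>

lemma zfactor_square: "(1 - fps_X)\<^sup>2 * zfactor w = (1 - fps_X) ^ valency G w"
proof -
  have inv: "(1 - fps_X) * inverse (1 - fps_X :: real fps) = 1"
    using inverse_mult_eq_1[of "1 - fps_X :: real fps"] by (simp add: mult.commute)
  consider "valency G w = 0" | "valency G w = 1" | "2 \<le> valency G w"
    by linarith
  then show ?thesis
  proof cases
    case 1
    have "(1 - fps_X)\<^sup>2 * inverse (1 - fps_X :: real fps) ^ 2 = 1"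
      unfolding power_mult_distrib[symmetric] inv by simp
    then show ?thesis using 1 by (simp add: power_int_def)
  next
    case 2
    have "(1 - fps_X)\<^sup>2 * inverse (1 - fps_X :: real fps) = 1 - fps_X"
      unfolding power2_eq_square mult.assoc inv by simp
    then show ?thesis using 2 by (simp add: power_int_def)
  next
    case 3
    then obtain k where k: "valency G w = 2 + k" using le_Suc_ex by blast
    have "zfactor w = (1 - fps_X) ^ k" by (simp add: power_int_def k)
    then show ?thesis unfolding k power_add by simp
  qed
qed

text \<open>The \<open>E\<^sub>v\<^sup>*\<close> form a basis, so at most one exponent vector
  contributes. If a degree is negative there is none, and a factor on the right vanishes.\<close>

lemma zcoeff_eq:
  assumes c: "\<And>w. ndeg l w = of_int (c w)"
  shows "zcoeff G l = (\<Prod>w\<in>UNIV. int_coeff (zfactor w) (c w))"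
proof -
  have "(\<Sum>v\<in>UNIV. of_nat (n v) *\<^sub>R dual G v) = l \<longleftrightarrow> (\<forall>w. int (n w) = c w)" for n :: "'v \<Rightarrow> nat"
  proof
    assume "(\<Sum>v\<in>UNIV. of_nat (n v) *\<^sub>R dual G v) = l"
    then have "real (n w) = ndeg l w" for w using ndeg_dual_sum[of "\<lambda>v. real (n v)" w] by simp
    then have "real (n w) = of_int (c w)" for w by (simp add: c)
    then have "int (n w) = c w" for w using \<open>\<And>w. real (n w) = of_int (c w)\<close>[of w] by linarith
    then show "\<forall>w. int (n w) = c w" by blast
  next
    assume *: "\<forall>w. int (n w) = c w"
    have "real (n w) = of_int (c w)" for w using *[rule_format, of w, symmetric] by simp
    then show "(\<Sum>v\<in>UNIV. of_nat (n v) *\<^sub>R dual G v) = l"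
      by (intro ndeg_inj) (simp add: ndeg_dual_sum c)
  qed
  then have set: "{n. (\<Sum>v\<in>UNIV. of_nat (n v) *\<^sub>R dual G v) = l} = {n. \<forall>w. int (n w) = c w}" by simp
  show ?thesis
  proof (cases "\<forall>w. c w \<ge> 0")
    case True
    then have "int (n w) = c w \<longleftrightarrow> n w = nat (c w)" for n :: "'v \<Rightarrow> nat" and w
      using nat_eq_iff2[of "n w" "c w"] by auto
    then have "{n. \<forall>w. int (n w) = c w} = {\<lambda>w. nat (c w)}" by (simp add: fun_eq_iff set_eq_iff)
    moreover have "int_coeff (zfactor w) (c w) = fps_nth (zfactor w) (nat (c w))" for w
      using True[rule_format, of w] by (simp add: int_coeff_def)
    ultimately show ?thesis unfolding zcoeff_def set by simp
  next
    case False
    then obtain w where w: "c w < 0" by (auto simp: not_le)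
    have "int (n w) \<noteq> c w" for n :: "'v \<Rightarrow> nat" using w by linarith
    then have none: "{n. \<forall>w. int (n w) = c w} = {}" by blast
    have "(\<Prod>w\<in>UNIV. int_coeff (zfactor w) (c w)) = 0"
      using w by (intro prod_zero) (auto simp: int_coeff_def)
    then show ?thesis unfolding zcoeff_def set none by simp
  qed
qed

lemma zcoeff_nonzero:
  assumes "zcoeff G l \<noteq> 0"
  obtains n :: "'v \<Rightarrow> nat" where "\<And>w. ndeg l w = real (n w)"
proof -
  have "{n. (\<Sum>v\<in>UNIV. of_nat (n v) *\<^sub>R dual G v) = l} \<noteq> {}"
  proof
    assume "{n. (\<Sum>v\<in>UNIV. of_nat (n v) *\<^sub>R dual G v) = l} = {}"
    then have "zcoeff G l = 0" unfolding zcoeff_def by simp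
    then show False using assms by simp
  qed
  then obtain n :: "'v \<Rightarrow> nat" where "(\<Sum>v\<in>UNIV. of_nat (n v) *\<^sub>R dual G v) = l" by blast
  then have "ndeg l w = real (n w)" for w using ndeg_dual_sum[of "\<lambda>v. real (n v)" w] by simp
  then show thesis using that by blast
qed

lemma zcoeff_nonzero_nonneg: "zcoeff G l \<noteq> 0 \<Longrightarrow> 0 \<le> ndeg l w"
  by (rule zcoeff_nonzero[of l]) auto

lemma finite_zcoeff: "finite {l. zcoeff G l \<noteq> 0 \<and> \<not> x \<le> l}"
proof -
  \<comment> \<open>If \<open>l $ w < x $ w\<close>, positivity of the summands of
    \<open>l $ w\<close> bounds each exponent by such a ratio. The sum over all pairs gives a bound
    independent of \<open>w\<close>.\<close>
  define K where "K = (\<Sum>v\<in>UNIV. \<Sum>w\<in>UNIV. nat \<lceil>\<bar>x $ w\<bar> / dual G v $ w\<rceil>)"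
  have K: "\<bar>x $ w\<bar> / dual G v $ w \<le> real K" for v w
  proof -
    have "nat \<lceil>\<bar>x $ w\<bar> / dual G v $ w\<rceil> \<le> (\<Sum>w\<in>UNIV. nat \<lceil>\<bar>x $ w\<bar> / dual G v $ w\<rceil>)"
      by (rule member_le_sum) auto
    also have "\<dots> \<le> K" unfolding K_def by (rule member_le_sum) auto
    finally show ?thesis by (simp add: nat_le_iff ceiling_le_iff)
  qed
  have "{l. zcoeff G l \<noteq> 0 \<and> \<not> x \<le> l} \<subseteq>
      (\<lambda>n. \<Sum>v\<in>UNIV. real (n v) *\<^sub>R dual G v) ` (UNIV \<rightarrow>\<^sub>E {..K})"
  proof
    fix l assume l: "l \<in> {l. zcoeff G l \<noteq> 0 \<and> \<not> x \<le> l}"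
    then obtain n where n: "\<And>w. ndeg l w = real (n w)" using zcoeff_nonzero by blast
    have leq: "l = (\<Sum>v\<in>UNIV. real (n v) *\<^sub>R dual G v)"
      using dual_expansion[of l] by (simp add: n)
    obtain w where w: "l $ w < x $ w" using l by (auto simp: less_eq_vec_def not_le)
    have "n v \<le> K" for v
    proof -
      have "real (n v) * dual G v $ w \<le> (\<Sum>v\<in>UNIV. real (n v) * dual G v $ w)"
        using dual_pos by (intro member_le_sum) (auto simp: less_imp_le)
      also have "\<dots> = l $ w" by (simp add: leq)
      also have "\<dots> \<le> \<bar>x $ w\<bar>" using w by simp
      finally have "real (n v) \<le> \<bar>x $ w\<bar> / dual G v $ w" using dual_pos[of v w] by (simp add: field_simps)
      also note K
      finally show ?thesis by simp
    qed
    then show "l \<in> (\<lambda>n. \<Sum>v\<in>UNIV. real (n v) *\<^sub>R dual G v) ` (UNIV \<rightarrow>\<^sub>E {..K})"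
      using leq by (intro image_eqI[of _ _ n]) auto
  qed
  then show ?thesis by (rule finite_subset) (intro finite_imageI finite_PiE, auto)
qed

lemma cls_eq_iff: "l \<in> dual_latt G \<Longrightarrow> r \<in> dual_latt G \<Longrightarrow> cls G l = cls G r \<longleftrightarrow> l - r \<in> latt"
proof
  assume "l \<in> dual_latt G" "cls G l = cls G r"
  moreover have "l \<in> cls G l" using \<open>l \<in> dual_latt G\<close> by (simp add: cls_def latt_closed)
  ultimately show "l - r \<in> latt" by (simp add: cls_def)
next
  assume lr: "l - r \<in> latt"
  have "y - l \<in> latt \<longleftrightarrow> y - r \<in> latt" for y
    using latt_closed(1)[OF _ lr, of "y - l"] latt_closed(2)[OF _ lr, of "y - r"] by auto
  then show "cls G l = cls G r" by (simp add: cls_def)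
qed

lemma dual_latt_closed:
  "x \<in> dual_latt G \<Longrightarrow> y \<in> dual_latt G \<Longrightarrow> x + y \<in> dual_latt G"
  "x \<in> dual_latt G \<Longrightarrow> y \<in> dual_latt G \<Longrightarrow> x - y \<in> dual_latt G"
  by (auto simp: dual_latt_iff)

lemma fractional_representative:
  assumes "h \<in> Hgroup G"
  obtains r where "r \<in> dual_latt G" "h = cls G r" "\<And>w. 0 \<le> r $ w" "\<And>w. r $ w < 1"
proof -
  obtain l where l: "l \<in> dual_latt G" "h = cls G l" using assms by (auto simp: Hgroup_def)
  define m where "m = (\<chi> w. real_of_int \<lfloor>l $ w\<rfloor>)"
  have m: "m \<in> latt" by (auto simp: m_def latt_def)
  have r: "l - m \<in> dual_latt G" by (rule dual_latt_closed(2)[OF l(1) latt_dual_latt[OF m]])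
  have "cls G l = cls G (l - m)" using l r m by (simp add: cls_eq_iff)
  moreover have "0 \<le> (l - m) $ w" "(l - m) $ w < 1" for w
    by (auto simp: m_def) linarith
  ultimately show thesis using that[of "l - m"] r l by simp
qed

lemma b_pos: "b v > 0"
proof -
  have "iform G (axis v 1) (axis v 1) < 0" by (rule iform_neg) simp
  then show ?thesis using ndeg_axis[of v v] by (simp add: ndeg_def)
qed

text \<open>Since \<open>0 \<le> r < 1\<close>, a point \<open>m + r + k\<close> of class
  \<open>h\<close> dominates \<open>m\<close> iff all entries of the integral vector
  \<open>k\<close> are nonnegative, and then dominates \<open>m + E\<^sub>v\<close> iff moreover
  \<open>k v \<ge> 1\<close>. The difference is thus a tree sum over the heights with
  \<open>k v = 0\<close>.\<close>

theorem Qcount_step: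
  assumes r: "r \<in> dual_latt G" "\<And>w. 0 \<le> r $ w" "\<And>w. r $ w < 1" and h: "h = cls G r"
    and m: "m \<in> latt"
    and N: "\<And>w. real (valency G w - 2) \<le> ndeg m w" "\<And>w. real (valency G w - 2) \<le> ndeg (m + axis v 1) w"
    and val: "\<And>w. 1 \<le> valency G w"
  shows "Qcount G h (m + axis v 1) - Qcount G h m = 1 + ndeg (m + r) v"
proof -
  define S where "S x = {l. l \<in> dual_latt G \<and> zcoeff G l \<noteq> 0 \<and> cls G l = h \<and> \<not> x \<le> l}" for x
  have finS: "finite (S x)" for x
    by (rule finite_subset[OF _ finite_zcoeff[of x]]) (auto simp: S_def)
  have mle: "m \<le> m + axis v 1" by (simp add: less_eq_vec_def axis_def)
  have "m \<le> x" if "m + axis v 1 \<le> x" for x using order_trans[OF mle that] .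
  then have sub: "S m \<subseteq> S (m + axis v 1)" by (auto simp: S_def)
  define D where "D = S (m + axis v 1) - S m"
  have Qdiff: "Qcount G h (m + axis v 1) - Qcount G h m = sum (zcoeff G) D"
    unfolding Qcount_def S_def[symmetric] D_def using sum_diff[OF finS sub, of "zcoeff G"] by simp
  have "\<exists>M. \<forall>w. ndeg (m + r) w = of_int (M w)"
  proof -
    have "m + r \<in> dual_latt G" by (rule dual_latt_closed(1)[OF latt_dual_latt[OF m] r(1)])
    then have "\<forall>w. \<exists>c. ndeg (m + r) w = of_int c" by (auto simp: dual_latt_iff elim!: Ints_cases)
    then show ?thesis by (rule choice)
  qed
  then obtain M where M: "\<And>w. ndeg (m + r) w = of_int (M w)" by blast
  define vec where "vec k = (\<chi> w. real (k w))" for k :: "'v \<Rightarrow> nat"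
  define G0 where "G0 w (j::nat) = zfactor w" for w j
  let ?T = "tree_term (adj G) b M UNIV G0"
  have vec_latt: "vec k \<in> latt" for k by (simp add: vec_def latt_def)
  have zc: "zcoeff G (m + r + vec k) = ?T k" for k
  proof -
    have "ndeg (m + r + vec k) w = of_int (M w + b w * int (k w) - (\<Sum>u | u \<in> UNIV \<and> adj G w u. int (k u)))" for w
    proof -
      have "ndeg (vec k) w = of_int (b w) * real (k w) - (\<Sum>u | adj G w u. real (k u))"
        by (simp add: ndeg_eq vec_def)
      then show ?thesis using M[of w] by simp
    qed
    from zcoeff_eq[OF this] show ?thesis by (simp add: tree_term_def G0_def)
  qed
  have bij: "bij_betw (\<lambda>k. m + r + vec k) {k \<in> height_fun UNIV v. ?T k \<noteq> 0} D"
  proof (rule bij_betw_imageI)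
    show "inj_on (\<lambda>k. m + r + vec k) {k \<in> height_fun UNIV v. ?T k \<noteq> 0}"
      by (auto simp: inj_on_def vec_def vec_eq_iff fun_eq_iff)
    show "(\<lambda>k. m + r + vec k) ` {k \<in> height_fun UNIV v. ?T k \<noteq> 0} = D"
    proof (intro equalityI subsetI)
      fix l assume "l \<in> (\<lambda>k. m + r + vec k) ` {k \<in> height_fun UNIV v. ?T k \<noteq> 0}"
      then obtain k where k: "k v = 0" "?T k \<noteq> 0" "l = m + r + vec k" by (auto simp: height_fun_def)
      have L: "l \<in> dual_latt G" using k(3) m r vec_latt by (simp add: dual_latt_closed latt_dual_latt)
      have "l - r = m + vec k" using k(3) by simp
      then have "cls G l = h" using cls_eq_iff[OF L r(1)] h m vec_latt by (simp add: latt_closed)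
      moreover have "zcoeff G l \<noteq> 0" using zc k by simp
      moreover have "m \<le> l" using r by (simp add: k(3) less_eq_vec_def vec_def)
      moreover have "\<not> m + axis v 1 \<le> l"
      proof
        assume "m + axis v 1 \<le> l"
        then have "(m + axis v 1) $ v \<le> l $ v" unfolding less_eq_vec_def by (rule spec)
        then show False using r(3)[of v] k(1) by (simp add: k(3) vec_def axis_def)
      qed
      ultimately show "l \<in> D" using L by (simp add: D_def S_def)
    next
      fix l assume "l \<in> D"
      then have l: "l \<in> dual_latt G" "zcoeff G l \<noteq> 0" "cls G l = h" "\<not> m + axis v 1 \<le> l" "m \<le> l"
        by (auto simp: D_def S_def)
      have "l - r \<in> latt" using l(1,3) r(1) h by (simp add: cls_eq_iff)
      then have lat: "l - r - m \<in> latt" using m by (simp add: latt_closed)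
      define k where "k w = nat \<lfloor>(l - r - m) $ w\<rfloor>" for w
      have ge: "(l - r - m) $ w > -1" for w
      proof -
        have "m $ w \<le> l $ w" using l(5) by (simp add: less_eq_vec_def)
        then show ?thesis using r(3)[of w] by simp
      qed
      have kw: "real (k w) = (l - r - m) $ w" for w
      proof -
        obtain z where z: "(l - r - m) $ w = of_int z" using lat unfolding latt_def by (auto elim: Ints_cases)
        then have "z \<ge> 0" using ge[of w] by simp
        then show ?thesis unfolding k_def z by simp
      qed
      have lk: "l = m + r + vec k" by (simp add: vec_eq_iff vec_def kw)
      have "k v = 0"
      proof (rule ccontr)
        assume "k v \<noteq> 0"
        then have "1 \<le> real (k v)" by simp
        have "m + axis v 1 \<le> l"
          unfolding less_eq_vec_def
        proof
          fix w
          show "(m + axis v 1) $ w \<le> l $ w"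
            using \<open>1 \<le> real (k v)\<close> r(2)[of w] by (cases "w = v") (auto simp: lk vec_def axis_def)
        qed
        then show False using l(4) by simp
      qed
      then show "l \<in> (\<lambda>k. m + r + vec k) ` {k \<in> height_fun UNIV v. ?T k \<noteq> 0}"
        using lk zc[of k] l(2) by (auto simp: height_fun_def)
    qed
  qed
  have "finite D" using finS by (simp add: D_def)
  then have finT: "finite {k \<in> height_fun UNIV v. ?T k \<noteq> 0}" using bij bij_betw_finite by blast
  have "sum (zcoeff G) D = sum ?T {k \<in> height_fun UNIV v. ?T k \<noteq> 0}"
    using sum.reindex_bij_betw[OF bij, of "zcoeff G"] by (simp add: zc)
  also have "\<dots> = of_int (M v) + 1"
  proof (rule tree_term_sum[where om = "\<lambda>w. dual G v $ w" and r = "\<lambda>w. r $ w" and N = "ndeg m", OF sym irr])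
    show "0 < dual G v $ u" for u by (rule dual_pos)
    show "of_int (b w) * dual G v $ w = (\<Sum>u | adj G w u. dual G v $ u)" if "w \<noteq> v" for w
      using dual_properties(2)[of v w] that by (simp add: ndeg_eq)
    show "of_int (M w) = ndeg m w + of_int (b w) * r $ w - (\<Sum>u | adj G w u. r $ u)" for w
      using M[of w] by (simp add: ndeg_eq[of r])
    show "real (card {u. adj G w u} - 2) \<le> ndeg m w" for w using N(1) by (simp add: valency_def)
    \<comment> \<open>Adding \<open>E\<^sub>v\<close> lowers the degree at its neighbours by 1, so
      the bound at \<open>m + axis v 1\<close> provides the extra unit.\<close>
    show "real (card {u. adj G w u} - 2) + 1 \<le> ndeg m w" if "adj G w v" for w
    proof -
      have "ndeg (axis v 1) w = -1" using that by (auto simp: ndeg_axis)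
      then show ?thesis using N(2)[of w] by (simp add: valency_def)
    qed
    \<comment> \<open>Each neighbour of \<open>v\<close> lowers the degree of \<open>r\<close> at
      \<open>v\<close> by less than 1. As there is at least one neighbour, the total loss is
      strictly below the valency and \<open>M v > -2\<close>.\<close>
    show "- 1 \<le> M v"
    proof -
      have "(\<Sum>u | adj G v u. r $ u) < (\<Sum>u | adj G v u. 1)"
        using val[of v] r(3) by (intro sum_strict_mono) (auto simp: valency_def card_gt_0_iff Suc_le_eq)
      then have "(\<Sum>u | adj G v u. r $ u) < real (valency G v)" by (simp add: valency_def)
      moreover have "0 \<le> of_int (b v) * r $ v" using b_pos[of v] r(2)[of v] by (intro mult_nonneg_nonneg) auto
      ultimately have "ndeg r v > - real (valency G v)" unfolding ndeg_eq by linarith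
      then have "real_of_int (M v) > -2" using N(1)[of v] M[of v] by simp
      then show ?thesis by linarith
    qed
    show "rooted (adj G) v UNIV" by (rule rooted_UNIV)
    show "tree_kernel (adj G) (\<lambda>w. dual G v $ w) (\<lambda>w. r $ w) v UNIV G0"
    proof -
      define F where "F = Abs_fps (\<lambda>_. 1 :: real)"
      have F: "(1 - fps_X) * F = 1"
        by (rule fps_ext) (simp add: F_def left_diff_distrib fps_X_mult_nth)
      have F1: "fps_nth F n = 1" for n by (simp add: F_def)
      \<comment> \<open>No neighbour lies outside \<open>UNIV\<close>, so the initial cutoffs are
        empty sums and \<open>F\<close> has to be the full geometric series.\<close>
      have "zfactor w = F * (1 - fps_X) ^ (card {u. adj G w u} - 1)" for w
      proof -
        obtain d where d: "valency G w = Suc d" using val[of w] by (cases "valency G w") auto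
        have "zfactor w = ((1 - fps_X) * F)\<^sup>2 * zfactor w" by (simp add: F)
        also have "\<dots> = F\<^sup>2 * ((1 - fps_X)\<^sup>2 * zfactor w)" by (simp add: power_mult_distrib mult_ac)
        also have "\<dots> = F * ((1 - fps_X) * F) * (1 - fps_X) ^ d"
          unfolding zfactor_square unfolding d by (simp add: power2_eq_square mult_ac)
        finally show ?thesis using d by (simp add: F valency_def)
      qed
      then show ?thesis
        unfolding tree_kernel_def G0_def using F1 zfactor_square[of v] by (auto simp: valency_def)
    qed
  qed (use r finT in auto)
  finally show ?thesis using Qdiff M[of v] by simp
qed

end

section \<open>Quadraticity of the counting function\<close>

lemma latt_less_imp_add1_le:
  assumes "x \<in> latt" "z \<in> latt" "z $ v < x $ v"
  shows "z $ v + 1 \<le> x $ v"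
proof -
  have "x $ v - z $ v \<in> \<int>" using assms by (auto simp: latt_def)
  then obtain c where c: "x $ v - z $ v = of_int c" by (rule Ints_cases)
  then have "0 < real_of_int c" using assms(3) by simp
  then have "1 \<le> real_of_int c" by simp
  then show ?thesis using c by simp
qed

text \<open>A monotone path of unit steps from 0 to \<open>x\<close>. The next coordinate is left to
  \<open>step\<close>, because a descent below must choose it according to the current
  point.\<close>

lemma lattice_path_induct:
  fixes x :: "real ^ 'v::finite"
  assumes x: "x \<in> latt" "0 \<le> x" and P0: "P 0"
    and step: "\<And>z. z \<in> latt \<Longrightarrow> 0 \<le> z \<Longrightarrow> z \<le> x \<Longrightarrow> z \<noteq> x \<Longrightarrow> P z \<Longrightarrow> \<exists>v. z $ v < x $ v \<and> P (z + axis v 1)"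
  shows "P x"
proof -
  have "P x" if "z \<in> latt" "0 \<le> z" "z \<le> x" "P z" for z
    using that
  proof (induction "nat \<lfloor>\<Sum>v\<in>UNIV. x $ v - z $ v\<rfloor>" arbitrary: z rule: less_induct)
    case less
    show ?case
    proof (cases "z = x")
      case True then show ?thesis using less.prems by simp
    next
      case False
      then obtain v where v: "z $ v < x $ v" "P (z + axis v 1)" using step less.prems by blast
      have ax: "axis v 1 \<in> (latt :: (real ^ 'v) set)" by (auto simp: latt_def axis_def)
      have v1: "z $ v + 1 \<le> x $ v" by (rule latt_less_imp_add1_le[OF x(1) less.prems(1) v(1)])
      have le: "z + axis v 1 \<le> x"
        using less.prems(3) v1 by (auto simp: less_eq_vec_def axis_def)
      have nn: "0 \<le> z + axis v 1"
        using less.prems(2) by (auto simp: less_eq_vec_def axis_def)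
      have "(\<Sum>u\<in>UNIV. (axis v 1 :: real ^ 'v) $ u) = 1" by (simp add: axis_def)
      then have s: "(\<Sum>u\<in>UNIV. x $ u - (z + axis v 1) $ u) = (\<Sum>u\<in>UNIV. x $ u - z $ u) - 1"
        by (simp add: sum_subtractf sum.distrib)
      have "0 \<le> (\<Sum>u\<in>UNIV. x $ u - (z + axis v 1) $ u)"
        using le by (intro sum_nonneg) (simp add: less_eq_vec_def)
      then have "nat \<lfloor>\<Sum>u\<in>UNIV. x $ u - (z + axis v 1) $ u\<rfloor> < nat \<lfloor>\<Sum>u\<in>UNIV. x $ u - z $ u\<rfloor>"
        unfolding s by linarith
      then show ?thesis using less.hyps[OF _ latt_closed(1)[OF less.prems(1) ax] nn le v(2)] by blast
    qed
  qed
  from this[OF latt_closed(3) _ x(2) P0] show ?thesis by simp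
qed

section \<open>Comparison with the Riemann-Roch polynomial along lattice paths\<close>

locale plumbing_class = plumbing_graph G for G :: "'v::finite plumbing" +
  fixes h r
  assumes r: "r \<in> dual_latt G" "\<And>w. 0 \<le> r $ w" "\<And>w. r $ w < 1" and h: "h = cls G r"
    and nodes_ne: "nodes G \<noteq> {}"
begin

lemma valency_ge_1: "1 \<le> valency G w"
proof -
  obtain n where n: "n \<in> nodes G" using nodes_ne by blast
  show ?thesis
  proof (cases "w = n")
    case True then show ?thesis using n by (simp add: nodes_def)
  next
    case False
    then have "{u \<in> UNIV. adj G w u} \<noteq> {}"
      using rooted_has_parent[OF rooted_UNIV[of n] sym, of w] by simp
    then show ?thesis by (simp add: valency_def Suc_le_eq card_gt_0_iff)
  qed
qed

text \<open>\<open>\<chi>(x) = -(x, x + K) / 2\<close>, where \<open>(K, E\<^sub>v) = - e\<^sub>v - 2\<close> by adjunction.\<close>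

definition chi :: "real ^ 'v \<Rightarrow> real" where
  "chi x = - iform G x x / 2 + (\<Sum>v\<in>UNIV. (1 - of_int (b v) / 2) * x $ v)"

lemma chi_step: "chi (x + axis v 1) = chi x + 1 + ndeg x v"
proof -
  have "iform G (axis v 1) x = - ndeg x v" using iform_sym[of x "axis v 1"] by (simp add: ndeg_def)
  moreover have "iform G (axis v 1) (axis v 1) = - of_int (b v)"
    using ndeg_axis[of v v] by (simp add: ndeg_def)
  ultimately have "iform G (x + axis v 1) (x + axis v 1) = iform G x x - 2 * ndeg x v - of_int (b v)"
    by (simp add: iform_linear ndeg_def)
  moreover have "(\<Sum>u\<in>UNIV. (1 - of_int (b u) / 2) * (axis v 1 :: real ^ 'v) $ u) = 1 - of_int (b v) / 2"
  proof -
    have "(\<Sum>u\<in>UNIV. (1 - of_int (b u) / 2) * (axis v 1 :: real ^ 'v) $ u) =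
        (\<Sum>u\<in>UNIV. if u = v then 1 - of_int (b u) / 2 else 0)"
      by (intro sum.cong) (auto simp: axis_def)
    then show ?thesis by simp
  qed
  ultimately show ?thesis
    by (simp add: chi_def algebra_simps sum.distrib add_divide_distrib diff_divide_distrib)
qed

definition defect :: "real ^ 'v \<Rightarrow> real" where
  "defect m = Qcount G h m - chi (m + r)"

text \<open>Truncated subtraction makes the bound \<open>max 0 (\<delta>\<^sub>w - 2)\<close>, which
  is 0 at every vertex that is not a node.\<close>

definition good :: "real ^ 'v \<Rightarrow> bool" where
  "good m \<longleftrightarrow> (\<forall>w. real (valency G w - 2) \<le> ndeg m w)"

lemma defect_step:
  assumes "m \<in> latt" "good m" "good (m + axis v 1)"
  shows "defect (m + axis v 1) = defect m"
proof -
  have "Qcount G h (m + axis v 1) - Qcount G h m = 1 + ndeg (m + r) v"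
    using assms valency_ge_1 unfolding good_def by (intro Qcount_step[OF r h]) auto
  moreover have "chi (m + axis v 1 + r) = chi (m + r) + 1 + ndeg (m + r) v"
    using chi_step[of "m + r" v] by (simp add: add_ac)
  ultimately show ?thesis by (simp add: defect_def)
qed

lemma axis_latt: "axis v 1 \<in> (latt :: (real ^ 'v) set)"
  by (auto simp: latt_def axis_def)

text \<open>On any monotone path from \<open>m\<close> to \<open>m + x\<close> the own coordinate
  raises a degree, and the neighbours lower it by at most the sum of their entries in
  \<open>x\<close>. So all points are good, whatever the order of the steps.\<close>

lemma defect_up:
  assumes m: "m \<in> latt" and x: "x \<in> latt" "0 \<le> x"
    and deep: "\<And>w. real (valency G w - 2) + (\<Sum>u | adj G w u. x $ u) \<le> ndeg m w"
  shows "defect (m + x) = defect m"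
  using x
proof (rule lattice_path_induct)
  show "defect (m + 0) = defect m" by simp
next
  have good: "good (m + z)" if "0 \<le> z" "z \<le> x" for z
    unfolding good_def
  proof
    fix w
    have "(\<Sum>u | adj G w u. z $ u) \<le> (\<Sum>u | adj G w u. x $ u)"
      using that by (intro sum_mono) (simp add: less_eq_vec_def)
    moreover have "0 \<le> of_int (b w) * z $ w"
      using that b_pos[of w] by (intro mult_nonneg_nonneg) (auto simp: less_eq_vec_def)
    ultimately have "- (\<Sum>u | adj G w u. x $ u) \<le> ndeg z w" unfolding ndeg_eq by linarith
    then show "real (valency G w - 2) \<le> ndeg (m + z) w" using deep[of w] by simp
  qed
  fix z assume z: "z \<in> latt" "0 \<le> z" "z \<le> x" "z \<noteq> x" "defect (m + z) = defect m"
  then obtain v where v: "z $ v < x $ v" by (metis less_eq_vec_def order_antisym not_le)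
  have "z $ v + 1 \<le> x $ v" by (rule latt_less_imp_add1_le[OF x(1) z(1) v])
  then have "z + axis v 1 \<le> x" using z(3) by (auto simp: less_eq_vec_def axis_def)
  moreover have "0 \<le> z + axis v 1" using z(2) by (auto simp: less_eq_vec_def axis_def)
  ultimately have "good (m + z + axis v 1)" using good[of "z + axis v 1"] by (simp add: add.assoc)
  then have "defect (m + z + axis v 1) = defect (m + z)"
    using good[OF z(2,3)] m z(1) by (intro defect_step) (auto simp: latt_closed)
  then show "\<exists>v. z $ v < x $ v \<and> defect (m + (z + axis v 1)) = defect m"
    using v z(5) by (intro exI[of _ v]) (simp add: add.assoc)
qed

text \<open>The path from \<open>m\<close> down to \<open>m - x\<close> never leaves the region where the previous step formula
  applies: at a vertex that is not a node, \<open>E\<^sub>v\<close> is subtracted only if the result is still good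
  there. By negative definiteness such a vertex is available until \<open>x\<close> is exhausted.\<close>

lemma defect_down:
  assumes m: "m \<in> latt" "good m" and x: "x \<in> latt" "0 \<le> x"
    and xb: "\<And>w. w \<notin> nodes G \<Longrightarrow> of_int (b w) \<le> - ndeg x w"
    and deep: "\<And>w. w \<in> nodes G \<Longrightarrow> real (valency G w - 2) + of_int (b w) * x $ w \<le> ndeg m w"
  shows "defect (m - x) = defect m"
proof -
  have good: "good (m - z)" if z: "0 \<le> z" "z \<le> x" "\<And>w. w \<notin> nodes G \<Longrightarrow> ndeg z w \<le> 0" for z
    unfolding good_def
  proof
    fix w
    show "real (valency G w - 2) \<le> ndeg (m - z) w"
    proof (cases "w \<in> nodes G")
      case True
      have "0 \<le> (\<Sum>u | adj G w u. z $ u)" using z(1) by (intro sum_nonneg) (simp add: less_eq_vec_def)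
      moreover have "of_int (b w) * z $ w \<le> of_int (b w) * x $ w"
        using z(2) b_pos[of w] by (intro mult_left_mono) (auto simp: less_eq_vec_def)
      ultimately have "ndeg z w \<le> of_int (b w) * x $ w" unfolding ndeg_eq by linarith
      then show ?thesis using deep[OF True] by simp
    next
      case False
      then show ?thesis using z(3)[OF False] m(2) unfolding good_def by (smt (verit) ndeg_linear(2))
    qed
  qed
  define P where "P z \<longleftrightarrow> (\<forall>w. w \<notin> nodes G \<longrightarrow> ndeg z w \<le> 0) \<and> defect (m - z) = defect m" for z
  have "P x"
    using x
  proof (rule lattice_path_induct)
    show "P 0" by (simp add: P_def)
  next
    fix z assume z: "z \<in> latt" "0 \<le> z" "z \<le> x" "z \<noteq> x" "P z"
    define y where "y = x - z"
    have y0: "0 \<le> y $ w" for w using z(3) by (simp add: y_def less_eq_vec_def)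
    \<comment> \<open>If every remaining vertex were blocked, \<open>y\<close> would have
      nonpositive degree wherever it is positive, so \<open>(y, y) \<ge> 0\<close> with
      \<open>y \<noteq> 0\<close>.\<close>
    have "\<exists>v. 0 < y $ v \<and> (v \<notin> nodes G \<longrightarrow> of_int (b v) \<le> - ndeg z v)"
    proof (rule ccontr)
      assume *: "\<not> ?thesis"
      have "ndeg y w * y $ w \<le> 0" for w
      proof (cases "0 < y $ w")
        case True
        then have "w \<notin> nodes G" "- ndeg z w < of_int (b w)" using * by (auto simp: not_le)
        then have "ndeg y w \<le> 0" using xb[of w] by (simp add: y_def)
        then show ?thesis using y0[of w] by (simp add: mult_nonpos_nonneg)
      qed (use y0[of w] in simp)
      then have "0 \<le> iform G y y" unfolding iform_ndeg by (simp add: sum_nonpos)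
      moreover have "y \<noteq> 0" using z(4) by (simp add: y_def)
      ultimately show False using iform_neg[of y] by simp
    qed
    then obtain v where v: "0 < y $ v" "v \<notin> nodes G \<Longrightarrow> of_int (b v) \<le> - ndeg z v" by blast
    have "z $ v + 1 \<le> x $ v" using latt_less_imp_add1_le[OF x(1) z(1), of v] v(1) by (simp add: y_def)
    then have le: "z + axis v 1 \<le> x" using z(3) by (auto simp: less_eq_vec_def axis_def)
    have nn: "0 \<le> z + axis v 1" using z(2) by (auto simp: less_eq_vec_def axis_def)
    \<comment> \<open>At \<open>v\<close> the degree of \<open>z\<close> rises by
      \<open>b v\<close>, which the choice of \<open>v\<close> permits; at all other vertices it
      does not rise.\<close>
    have nd: "ndeg (z + axis v 1) w \<le> 0" if "w \<notin> nodes G" for w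
      using z(5) that v(2) by (auto simp: P_def ndeg_axis)
    have 1: "good (m - (z + axis v 1))" by (rule good[OF nn le nd])
    have 2: "good (m - (z + axis v 1) + axis v 1)"
      using good[OF z(2,3)] z(5) by (simp add: P_def)
    have "m - (z + axis v 1) \<in> latt" using m z(1) axis_latt by (simp add: latt_closed)
    from defect_step[OF this 1 2] have "defect (m - (z + axis v 1)) = defect (m - z)" by simp
    then have "P (z + axis v 1)" using nd z(5) by (simp add: P_def)
    then show "\<exists>v. z $ v < x $ v \<and> P (z + axis v 1)" using v(1) by (auto simp: y_def)
  qed
  then show ?thesis by (simp add: P_def)
qed

lemma integral_dual_multiple:
  obtains K :: nat where "K > 0" "\<And>w. real K *\<^sub>R dual G w \<in> latt"
proof -
  have "\<forall>w. \<exists>n::nat. n > 0 \<and> real n *\<^sub>R dual G w \<in> latt"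
    using rational_vec_integer_multiple[OF rational_dual] by metis
  then obtain k where k: "\<And>w. k w > (0::nat)" "\<And>w. real (k w) *\<^sub>R dual G w \<in> latt" by metis
  have "real (\<Prod>u\<in>UNIV. k u) *\<^sub>R dual G w \<in> latt" for w
  proof -
    have "(\<Prod>u\<in>UNIV. k u) = (\<Prod>u\<in>UNIV - {w}. k u) * k w" by (simp add: prod.remove mult.commute)
    then show ?thesis using latt_closed(5)[OF k(2)[of w], of "\<Prod>u\<in>UNIV - {w}. k u"] by simp
  qed
  then show thesis using that[of "\<Prod>u\<in>UNIV. k u"] k(1) by simp
qed

lemma latt_sum: "(\<And>i. i \<in> I \<Longrightarrow> f i \<in> latt) \<Longrightarrow> (\<Sum>i\<in>I. f i) \<in> latt"
  by (induction I rule: infinite_finite_induct) (auto simp: latt_closed)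

text \<open>Two points are lifted along \<open>z0\<close>, all of whose degrees equal
  \<open>K\<close>, and then raised to a common upper bound. The lift comes first because the depth
  needed for the second move depends on the two points, while a step along \<open>z0\<close> needs
  only the fixed depth \<open>\<beta>\<close>.\<close>

lemma defect_constant_deep:
  assumes K: "K > 0" "\<And>w. real K *\<^sub>R dual G w \<in> latt"
  shows "\<exists>\<beta>\<ge>0. \<exists>c. \<forall>m\<in>latt. (\<forall>w. \<beta> \<le> ndeg m w) \<longrightarrow> defect m = c"
proof -
  define z0 where "z0 = (\<Sum>w\<in>UNIV. real K *\<^sub>R dual G w)"
  have z0: "z0 \<in> latt" using K(2) by (auto simp: z0_def intro: latt_sum)
  have ndz: "ndeg z0 w = real K" for w unfolding z0_def by (rule ndeg_dual_sum)
  have z0nn: "0 \<le> z0" using ndeg_nonneg_imp_nonneg[of z0] by (simp add: ndz less_eq_vec_def)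
  define \<beta>w where "\<beta>w w = real (valency G w - 2) + (\<Sum>u | adj G w u. z0 $ u)" for w
  define \<beta> where "\<beta> = (\<Sum>w\<in>UNIV. \<beta>w w)"
  have \<beta>w0: "0 \<le> \<beta>w w" for w using z0nn by (auto simp: \<beta>w_def less_eq_vec_def intro!: add_nonneg_nonneg sum_nonneg)
  have \<beta>: "\<beta>w w \<le> \<beta>" for w unfolding \<beta>_def using \<beta>w0 by (intro member_le_sum) auto
  have up: "defect (m + real j *\<^sub>R z0) = defect m" if "m \<in> latt" "\<And>w. \<beta> \<le> ndeg m w" for m and j :: nat
  proof (induction j)
    case (Suc j)
    have "defect (m + real j *\<^sub>R z0 + z0) = defect (m + real j *\<^sub>R z0)"
    proof (rule defect_up[OF _ z0 z0nn])
      show "m + real j *\<^sub>R z0 \<in> latt" using that(1) z0 by (simp add: latt_closed)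
      fix w
      have "\<beta>w w \<le> ndeg m w" using \<beta>[of w] that(2)[of w] by simp
      also have "\<dots> \<le> ndeg (m + real j *\<^sub>R z0) w" by (simp add: ndz)
      finally show "real (valency G w - 2) + (\<Sum>u | adj G w u. z0 $ u) \<le> ndeg (m + real j *\<^sub>R z0) w"
        by (simp add: \<beta>w_def)
    qed
    then show ?case using Suc by (simp add: scaleR_left_distrib add_ac)
  qed simp
  have eq: "defect m = defect m'" if m: "m \<in> latt" "\<And>w. \<beta> \<le> ndeg m w" and m': "m' \<in> latt" "\<And>w. \<beta> \<le> ndeg m' w" for m m'
  proof -
    define d d' where "d = (\<chi> w. max 0 ((m' - m) $ w))" and "d' = (\<chi> w. max 0 ((m - m') $ w))"
    have dl: "d \<in> latt" "d' \<in> latt" using m(1) m'(1) by (auto simp: d_def d'_def latt_def max_def)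
    have dn: "0 \<le> d" "0 \<le> d'" by (auto simp: d_def d'_def less_eq_vec_def)
    have eq: "m + d = m' + d'" by (auto simp: d_def d'_def vec_eq_iff max_def)
    define B where "B = (\<Sum>w\<in>UNIV. real (valency G w - 2) + (\<Sum>u | adj G w u. (d + d') $ u))"
    have B: "real (valency G w - 2) + (\<Sum>u | adj G w u. (d + d') $ u) \<le> B" for w
      unfolding B_def using dn
      by (intro member_le_sum) (auto simp: less_eq_vec_def intro!: add_nonneg_nonneg sum_nonneg)
    have Bd: "real (valency G w - 2) + (\<Sum>u | adj G w u. d $ u) \<le> B" "real (valency G w - 2) + (\<Sum>u | adj G w u. d' $ u) \<le> B" for w
    proof -
      have "(\<Sum>u | adj G w u. d $ u) \<le> (\<Sum>u | adj G w u. (d + d') $ u)" "(\<Sum>u | adj G w u. d' $ u) \<le> (\<Sum>u | adj G w u. (d + d') $ u)"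
        using dn by (auto intro!: sum_mono simp: less_eq_vec_def)
      then show "real (valency G w - 2) + (\<Sum>u | adj G w u. d $ u) \<le> B" "real (valency G w - 2) + (\<Sum>u | adj G w u. d' $ u) \<le> B"
        using B[of w] by linarith+
    qed
    obtain j :: nat where j: "B \<le> real j" using real_arch_simple by blast
    have \<beta>0: "0 \<le> \<beta>" using \<beta>[of undefined] \<beta>w0[of undefined] by linarith
    have large: "B \<le> ndeg (n + real j *\<^sub>R z0) w" if "\<And>w. \<beta> \<le> ndeg n w" for n w
    proof -
      have "real j * 1 \<le> real j * real K" using K(1) by (intro mult_left_mono) auto
      then show ?thesis using j that[of w] \<beta>0 by (simp add: ndz)
    qed
    have "defect m = defect (m + real j *\<^sub>R z0)" using up[OF m] by simp
    also have "\<dots> = defect (m + real j *\<^sub>R z0 + d)"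
      using Bd(1) large[OF m(2)] m(1) z0 dl dn
      by (intro defect_up[symmetric]) (auto simp: latt_closed intro: order_trans)
    also have "m + real j *\<^sub>R z0 + d = m' + real j *\<^sub>R z0 + d'"
      using eq by (simp add: algebra_simps)
    also have "defect \<dots> = defect (m' + real j *\<^sub>R z0)"
      using Bd(2) large[OF m'(2)] m'(1) z0 dl dn
      by (intro defect_up) (auto simp: latt_closed intro: order_trans)
    also have "\<dots> = defect m'" using up[OF m'] by simp
    finally show ?thesis .
  qed
  have "0 \<le> \<beta>" using \<beta>[of undefined] \<beta>w0[of undefined] by linarith
  moreover have "\<exists>c. \<forall>m\<in>latt. (\<forall>w. \<beta> \<le> ndeg m w) \<longrightarrow> defect m = c"
  proof (cases "\<exists>m\<in>latt. \<forall>w. \<beta> \<le> ndeg m w")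
    case True
    then obtain m where "m \<in> latt" "\<And>w. \<beta> \<le> ndeg m w" by blast
    then show ?thesis using eq[of _ m] by (intro exI[of _ "defect m"]) blast
  qed blast
  ultimately show ?thesis by blast
qed

text \<open>Subtract a vector \<open>x\<close> with very negative degrees off the nodes, so that
  \<open>m - x\<close> is deep there. Adding \<open>T\<close> copies of a multiple of one
  \<open>E\<^sub>n\<^sup>*\<close> makes \<open>x\<close> nonnegative and changes degrees only at
  the node \<open>n\<close>, where \<open>m\<close> has room.\<close>

theorem Qcount_quadratic:
  "\<exists>B c. \<forall>m\<in>latt. (\<forall>w. w \<notin> nodes G \<longrightarrow> 0 \<le> ndeg m w) \<and> (\<forall>w\<in>nodes G. B \<le> ndeg m w) \<longrightarrow>
    Qcount G h m = chi (m + r) + c"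
proof -
  obtain K :: nat where K: "K > 0" "\<And>w. real K *\<^sub>R dual G w \<in> latt" using integral_dual_multiple by blast
  obtain \<beta> c where \<beta>: "\<beta> \<ge> 0" and c: "\<And>m. m \<in> latt \<Longrightarrow> (\<And>w. \<beta> \<le> ndeg m w) \<Longrightarrow> defect m = c"
    using defect_constant_deep[OF K] by metis
  obtain n0 where n0: "n0 \<in> nodes G" using nodes_ne by blast
  define e where "e w = real K *\<^sub>R dual G w" for w
  have e: "e w \<in> latt" "ndeg (e w) u = (if u = w then real K else 0)" "0 < e w $ u" for w u
    using K dual_pos by (auto simp: e_def dual_properties)
  define s where "s = (\<Sum>w\<in>- nodes G. e w)"
  have s: "s \<in> latt" "ndeg s u = (if u \<in> nodes G then 0 else real K)" for u
    using e by (auto simp: s_def ndeg_sum intro: latt_sum)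
  obtain t :: nat where t: "\<beta> + (\<Sum>w\<in>UNIV. of_int (b w)) \<le> real t" using real_arch_simple by blast
  have tb: "of_int (b w) \<le> real t" "\<beta> \<le> real t" for w
  proof -
    have "of_int (b w) \<le> (\<Sum>w\<in>UNIV. real_of_int (b w))"
      using b_pos by (intro member_le_sum) (auto simp: less_imp_le)
    moreover have "0 \<le> real_of_int (b w)" using b_pos[of w] by simp
    ultimately show "of_int (b w) \<le> real t" "\<beta> \<le> real t" using t \<beta> by linarith+
  qed
  have tK: "real t \<le> real t * real K" using K(1) mult_left_mono[of 1 "real K" "real t"] by simp
  obtain T :: nat where T: "(\<Sum>u\<in>UNIV. \<bar>real t * s $ u\<bar> / e n0 $ u) \<le> real T" using real_arch_simple by blast
  define x where "x = real T *\<^sub>R e n0 - real t *\<^sub>R s"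
  have x: "x \<in> latt" using e s by (simp add: x_def latt_closed)
  have xn: "0 \<le> x"
    unfolding less_eq_vec_def
  proof
    fix u
    have "\<bar>real t * s $ u\<bar> / e n0 $ u \<le> (\<Sum>u\<in>UNIV. \<bar>real t * s $ u\<bar> / e n0 $ u)"
      using e(3) by (intro member_le_sum) (auto simp: less_imp_le)
    then have "\<bar>real t * s $ u\<bar> / e n0 $ u \<le> real T" using T by simp
    then have "\<bar>real t * s $ u\<bar> \<le> real T * e n0 $ u" using e(3)[of n0 u] by (simp add: field_simps)
    then show "0 $ u \<le> x $ u" by (simp add: x_def)
  qed
  have ndx: "ndeg x w = - (real t * real K)" if "w \<notin> nodes G" for w
    using that n0 by (auto simp: x_def e s)
  have ndx': "ndeg x w \<le> real T * real K" if "w \<in> nodes G" for w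
    using that by (auto simp: x_def e s)
  \<comment> \<open>\<open>B\<close> covers the depth at the nodes needed by the descent, and
    \<open>\<beta>\<close> plus the largest degree \<open>T * K\<close> that \<open>x\<close> can
    remove at a node.\<close>
  define B where "B = \<beta> + real T * real K + (\<Sum>w\<in>UNIV. real (valency G w - 2) + of_int (b w) * x $ w)"
  have B: "real (valency G w - 2) + of_int (b w) * x $ w \<le> B"
    "\<beta> + real T * real K \<le> B" "real (valency G w - 2) \<le> B" for w
  proof -
    have nn: "0 \<le> of_int (b u) * x $ u" for u
      using xn b_pos[of u] by (intro mult_nonneg_nonneg) (auto simp: less_eq_vec_def)
    have nn': "0 \<le> real (valency G u - 2) + of_int (b u) * x $ u" for u using nn[of u] by simp
    have "real (valency G w - 2) + of_int (b w) * x $ w \<le> (\<Sum>w\<in>UNIV. real (valency G w - 2) + of_int (b w) * x $ w)"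
      using nn' by (intro member_le_sum) auto
    moreover have "0 \<le> real T * real K" by simp
    ultimately show "real (valency G w - 2) + of_int (b w) * x $ w \<le> B"
      "\<beta> + real T * real K \<le> B" "real (valency G w - 2) \<le> B"
      using \<beta> nn[of w] nn'[of w] unfolding B_def by linarith+
  qed
  show ?thesis
  proof (intro exI ballI impI)
    fix m :: "real ^ 'v" assume m: "m \<in> latt"
      and *: "(\<forall>w. w \<notin> nodes G \<longrightarrow> 0 \<le> ndeg m w) \<and> (\<forall>w\<in>nodes G. B \<le> ndeg m w)"
    have good: "good m"
      unfolding good_def
    proof
      fix w show "real (valency G w - 2) \<le> ndeg m w"
        using * B(3)[of w] by (cases "w \<in> nodes G") (force simp: nodes_def)+
    qed
    have "defect (m - x) = defect m"
    proof (rule defect_down[OF m good x xn])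
      show "of_int (b w) \<le> - ndeg x w" if "w \<notin> nodes G" for w
        using ndx[OF that] tb(1)[of w] tK by linarith
      show "real (valency G w - 2) + of_int (b w) * x $ w \<le> ndeg m w" if "w \<in> nodes G" for w
        using * that B(1)[of w] by (meson order_trans)
    qed
    moreover have "defect (m - x) = c"
    proof (rule c)
      show "m - x \<in> latt" using m x by (simp add: latt_closed)
      show "\<beta> \<le> ndeg (m - x) w" for w
      proof (cases "w \<in> nodes G")
        case True
        then have "B \<le> ndeg m w" using * by blast
        then show ?thesis using ndx'[OF True] B(2) by simp
      next
        case False
        then have "0 \<le> ndeg m w" using * by blast
        then show ?thesis using ndx[OF False] tb(2) tK by simp
      qed
    qed
    ultimately show "Qcount G h m = chi (m + r) + c" by (simp add: defect_def)
  qed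
qed

end

section \<open>Chambers and the Lipman cone\<close>

lemma finite_index_refl:
  assumes "0 \<in> M" "\<And>x y. x \<in> M \<Longrightarrow> y \<in> M \<Longrightarrow> x - y \<in> M"
  shows "finite_index_sublattice M M"
proof -
  have add: "x + y \<in> M" if "x \<in> M" "y \<in> M" for x y
    using assms(2)[OF that(1) assms(2)[OF assms(1) that(2)]] by simp
  have "(+) x ` M = M" if "x \<in> M" for x
  proof
    show "(+) x ` M \<subseteq> M" using add that by auto
    show "M \<subseteq> (+) x ` M"
    proof
      fix y assume "y \<in> M"
      then show "y \<in> (+) x ` M" using assms(2)[OF _ that, of y] by (intro image_eqI[of _ _ "y - x"]) auto
    qed
  qed
  then have "(\<lambda>x. (+) x ` M) ` M \<subseteq> {M}" by auto
  then have "finite ((\<lambda>x. (+) x ` M) ` M)" by (rule finite_subset) simp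
  then show ?thesis using assms by (simp add: finite_index_sublattice_def)
qed

context plumbing_graph
begin

lemma node_cone_iff:
  "x \<in> node_cone G \<longleftrightarrow> (\<forall>w. 0 \<le> ndeg x w) \<and> (\<forall>w. w \<notin> nodes G \<longrightarrow> ndeg x w = 0)"
proof
  assume x: "x \<in> node_cone G"
  let ?S = "{x. (\<forall>w. 0 \<le> ndeg x w) \<and> (\<forall>w. w \<notin> nodes G \<longrightarrow> ndeg x w = 0)}"
  have "convex_cone ?S" by (simp add: convex_cone_iff)
  moreover have "dual G ` nodes G \<subseteq> ?S" by (auto simp: dual_properties)
  ultimately have "node_cone G \<subseteq> ?S" unfolding node_cone_def by (intro hull_minimal) auto
  then show "(\<forall>w. 0 \<le> ndeg x w) \<and> (\<forall>w. w \<notin> nodes G \<longrightarrow> ndeg x w = 0)" using x by blast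
next
  assume x: "(\<forall>w. 0 \<le> ndeg x w) \<and> (\<forall>w. w \<notin> nodes G \<longrightarrow> ndeg x w = 0)"
  have "x = (\<Sum>w\<in>UNIV. ndeg x w *\<^sub>R dual G w)" by (rule dual_expansion)
  also have "\<dots> = (\<Sum>w\<in>nodes G. ndeg x w *\<^sub>R dual G w)"
    using x by (intro sum.mono_neutral_right) auto
  also have "\<dots> \<in> node_cone G"
    unfolding node_cone_def using x by (intro convex_cone_hull_sum) (auto intro: hull_inc)
  finally show "x \<in> node_cone G" .
qed

lemma node_cone_subset_node_space: "node_cone G \<subseteq> node_space G"
  unfolding node_cone_def node_space_def
  by (intro hull_minimal convex_cone_span) (auto intro: span_base)

lemma lipman_cone_iff: "x \<in> lipman_cone G \<longleftrightarrow> (\<forall>w. 0 \<le> ndeg x w)"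
  by (simp add: lipman_cone_def ndeg_def)

lemma ndeg_rational_vector:
  "\<exists>a. (\<forall>w. rational_vec (a w)) \<and> (\<forall>w x. a w \<bullet> x = ndeg x w)"
proof (intro exI conjI allI)
  show "rational_vec (- (intersection_matrix G *v axis w 1))" for w
    by (simp add: rational_vec_def matrix_vector_mult_basis column_def intersection_matrix_def)
  show "- (intersection_matrix G *v axis w 1) \<bullet> x = ndeg x w" for w x
    by (simp add: ndeg_def iform_def inner_commute)
qed

lemma Qcount_nodes_eq: "l \<in> node_space G \<Longrightarrow> Qcount G h l = Qcount_nodes G h (pr G l)"
  unfolding Qcount_def Qcount_nodes_def using le_iff_pr_le zcoeff_nonzero_nonneg
  by (intro sum.cong) blast+

text \<open>Here \<open>l\<close> need not lie in \<open>V\<^sub>\<N>\<close>. Its other coordinates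
  are 0 and the support of \<open>Z\<close> is nonnegative, so only the node coordinates decide the
  comparison.\<close>

lemma Qcount_nodes_eq_node_latt:
  assumes "l \<in> node_latt G"
  shows "Qcount G h l = Qcount_nodes G h l"
proof -
  have l0: "l $ v = 0" if "v \<notin> nodes G" for v using assms that by (simp add: node_latt_def)
  have "l \<le> x \<longleftrightarrow> l \<le> pr G x" if "zcoeff G x \<noteq> 0" for x
  proof -
    have "0 \<le> x $ v" for v using that zcoeff_nonzero_nonneg by (intro ndeg_nonneg_imp_nonneg) auto
    then have "l $ v \<le> x $ v \<longleftrightarrow> l $ v \<le> pr G x $ v" for v
      using l0[of v] by (auto simp: pr_def)
    then show ?thesis unfolding less_eq_vec_def by simp
  qed
  then show ?thesis unfolding Qcount_def Qcount_nodes_def by (intro sum.cong) blast+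
qed

lemma end_sum_ndeg: "0 \<le> ndeg (end_sum G n) w"
  unfolding end_sum_def ndeg_sum by (intro sum_nonneg) (auto simp: dual_properties)

lemma Lcount_nodes_eq: "l \<in> node_space G \<Longrightarrow> Lcount G h l = Lcount_nodes G h (pr G l)"
  unfolding Lcount_def Lcount_nodes_def using le_iff_pr_le[OF _ end_sum_ndeg] by simp

end

section \<open>Basis cones inside the half-spaces that bound the Lipman cone\<close>

context plumbing_class
begin

text \<open>\<open>sl A y u\<close> is what is left for the coordinates at the neighbours of \<open>u\<close> outside \<open>A\<close> beyond the
  harmonic share \<open>dual G v $ c / dual G v $ u * y u\<close> of each; the last neighbour added receives it.\<close>

lemma outward_extension:
  assumes x: "\<And>w. 0 \<le> ndeg x w" and A: "rooted (adj G) v A"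
  defines "sl \<equiv> (\<lambda>A y u. ndeg x u + of_int (b u) * y u - (\<Sum>c | adj G u c \<and> c \<in> A. y c) -
      (\<Sum>c | adj G u c \<and> c \<notin> A. dual G v $ c) / dual G v $ u * y u)"
  shows "\<exists>y. (\<forall>u. (0::real) \<le> y u) \<and> y v = 0 \<and>
    (\<forall>u\<in>A. 0 \<le> sl A y u \<and> ({c. adj G u c} \<subseteq> A \<and> valency G u \<noteq> 1 \<longrightarrow> sl A y u = 0))"
  using A
proof (induction rule: rooted.induct)
  case rooted_root
  have "{c. adj G v c} \<noteq> {}" using valency_ge_1[of v] unfolding valency_def by force
  then have "\<not> {c. adj G v c} \<subseteq> {v}" by (auto simp: subset_singleton_iff)
  then show ?case
    by (intro exI[of _ "\<lambda>_. 0"]) (auto simp: sl_def x)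
next
  case (rooted_grow A w p)
  define om where "om u = dual G v $ u" for u
  have om: "om u > 0" for u by (simp add: om_def dual_pos)
  obtain y where y: "\<And>u. 0 \<le> y u" "y v = 0"
      "\<And>u. u \<in> A \<Longrightarrow> 0 \<le> sl A y u" "\<And>u. u \<in> A \<Longrightarrow> {c. adj G u c} \<subseteq> A \<Longrightarrow> valency G u \<noteq> 1 \<Longrightarrow> sl A y u = 0"
    using rooted_grow.IH by blast
  have w: "w \<notin> A" and p: "p \<in> A" and wp: "{u \<in> A. adj G w u} = {p}" using rooted_grow.hyps by auto
  have wv: "w \<noteq> v" using rooted_root_mem[OF rooted_grow.hyps(1)] w by auto
  have pw: "p \<noteq> w" using p w by auto
  have awp: "adj G w p" using wp by auto
  have apw: "adj G p w" by (rule adj_sym[OF awp])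
  have auw: "\<not> adj G u w" if "u \<in> A" "u \<noteq> p" for u using that wp adj_sym[of u w] by auto
  define last where "last \<longleftrightarrow> {c. adj G p c} \<subseteq> insert w A"
  define yw where "yw = om w / om p * y p + (if last then sl A y p else 0)"
  define y' where "y' = y(w := yw)"
  have yw_ge: "om w / om p * y p \<le> yw" using y(3)[OF p] by (simp add: yw_def)
  have yw0: "0 \<le> yw" using yw_ge om[of w] om[of p] y(1)[of p]
    by (meson divide_nonneg_nonneg less_imp_le mult_nonneg_nonneg order_trans)
  have sum_same: "(\<Sum>c | adj G u c \<and> c \<in> A. y' c) = (\<Sum>c | adj G u c \<and> c \<in> A. y c)" for u
    using w by (intro sum.cong) (auto simp: y'_def)
  have sl_u: "sl (insert w A) y' u = sl A y u" if u: "u \<in> A" "u \<noteq> p" for u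
  proof -
    have 1: "{c. adj G u c \<and> c \<in> insert w A} = {c. adj G u c \<and> c \<in> A}" using auw[OF u] by auto
    have 2: "{c. adj G u c \<and> c \<notin> insert w A} = {c. adj G u c \<and> c \<notin> A}" using auw[OF u] by auto
    have "y' u = y u" using u w by (auto simp: y'_def)
    then show ?thesis unfolding sl_def 1 2 sum_same by simp
  qed
  have sl_p: "sl (insert w A) y' p = sl A y p + om w / om p * y p - yw"
  proof -
    have 1: "{c. adj G p c \<and> c \<in> insert w A} = insert w {c. adj G p c \<and> c \<in> A}" using apw by auto
    have 2: "{c. adj G p c \<and> c \<notin> A} = insert w {c. adj G p c \<and> c \<notin> insert w A}" using apw w by auto
    have s1: "(\<Sum>c | adj G p c \<and> c \<in> insert w A. y' c) = yw + (\<Sum>c | adj G p c \<and> c \<in> A. y c)"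
      unfolding 1 using w sum_same[of p] by (simp add: y'_def)
    have s2: "(\<Sum>c | adj G p c \<and> c \<notin> A. om c) = om w + (\<Sum>c | adj G p c \<and> c \<notin> insert w A. om c)"
      unfolding 2 by simp
    have "y' p = y p" using pw by (simp add: y'_def)
    then show ?thesis
      unfolding sl_def om_def[symmetric] s1 s2 by (simp add: add_divide_distrib algebra_simps)
  qed
  \<comment> \<open>Harmonicity of \<open>dual G v\<close> at \<open>w\<close> reduces the new slack
    to \<open>ndeg x w + (om p / om w * yw - y p)\<close>, and \<open>yw\<close> is at least the
    harmonic share.\<close>
  have sl_w: "0 \<le> sl (insert w A) y' w"
  proof -
    have mem: "c \<in> A \<and> adj G w c \<longleftrightarrow> c = p" for c using wp by blast
    have mem': "c \<noteq> w" if "adj G w c" for c using that adj_irr[of w] by metis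
    have 1: "{c. adj G w c \<and> c \<in> insert w A} = {p}" using mem mem' by blast
    have "{c. adj G w c} = insert p {c. adj G w c \<and> c \<notin> insert w A}" using mem mem' by blast
    then have "(\<Sum>c | adj G w c. om c) = sum om (insert p {c. adj G w c \<and> c \<notin> insert w A})" by simp
    also have "\<dots> = om p + (\<Sum>c | adj G w c \<and> c \<notin> insert w A. om c)"
      using p by (intro sum.insert) auto
    finally have "(\<Sum>c | adj G w c. om c) = om p + (\<Sum>c | adj G w c \<and> c \<notin> insert w A. om c)" .
    moreover have "of_int (b w) * om w = (\<Sum>c | adj G w c. om c)"
      using dual_properties(2)[of v w] wv by (simp add: ndeg_eq om_def)
    ultimately have h: "(\<Sum>c | adj G w c \<and> c \<notin> insert w A. om c) = of_int (b w) * om w - om p" by simp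
    have "sl (insert w A) y' w = ndeg x w + of_int (b w) * yw - y p - (of_int (b w) * om w - om p) / om w * yw"
      unfolding sl_def om_def[symmetric] 1 h using pw by (simp add: y'_def)
    also have "\<dots> = ndeg x w + (om p / om w * yw - y p)"
      using om[of w] by (simp add: field_simps)
    finally have "sl (insert w A) y' w = ndeg x w + (om p / om w * yw - y p)" .
    moreover have "y p \<le> om p / om w * yw"
      using yw_ge om[of w] om[of p] by (simp add: field_simps)
    ultimately show ?thesis using x[of w] by simp
  qed
  show ?case
  proof (intro exI[of _ y'] conjI allI ballI impI)
    show "0 \<le> y' u" for u using y(1) yw0 by (simp add: y'_def)
    show "y' v = 0" using wv y(2) by (simp add: y'_def)
    fix u assume u: "u \<in> insert w A"
    consider "u = w" | "u = p" | "u \<in> A" "u \<noteq> p" using u by auto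
    then show "0 \<le> sl (insert w A) y' u"
    proof cases
      case 2 then show ?thesis using sl_p y(3)[OF p] by (simp add: yw_def)
    qed (use sl_w sl_u y(3) in auto)
    assume full: "{c. adj G u c} \<subseteq> insert w A \<and> valency G u \<noteq> 1"
    consider "u = w" | "u = p" | "u \<in> A" "u \<noteq> p" using u by auto
    then show "sl (insert w A) y' u = 0"
    proof cases
      case 1
      \<comment> \<open>A new vertex whose neighbours are all present is an end, and ends are
        exempt: their slack becomes the coefficient of the end vector.\<close>
      then have "{c. adj G w c} = {p}" using full wp by auto
      then show ?thesis using full 1 by (simp add: valency_def)
    next
      case 2
      then show ?thesis using full sl_p by (simp add: yw_def last_def)
    next
      case 3
      then have "{c. adj G u c} \<subseteq> A" using full auw by auto
      then show ?thesis using sl_u[OF 3] y(4)[OF 3(1)] full by simp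
    qed
  qed
qed


text \<open>The last vertex attached in a rooted exhaustion has its parent as only
  neighbour.\<close>

lemma exists_end_vertex: "\<exists>i. i \<in> end_vertices G"
proof -
  obtain n where n: "n \<in> nodes G" using nodes_ne by blast
  from rooted_UNIV[of n] show ?thesis
  proof (cases rule: rooted.cases)
    case rooted_root
    then have "{w. adj G n w} \<subseteq> {n}" by auto
    then have "{w. adj G n w} = {}" by (auto simp: subset_singleton_iff)
    then show ?thesis using valency_ge_1[of n] by (simp add: valency_def)
  next
    case (rooted_grow A w p)
    have "u \<in> A" if "adj G w u" for u
    proof -
      have "u \<in> insert w A" unfolding rooted_grow(1)[symmetric] by simp
      then show ?thesis using that by auto
    qed
    then have "{u. adj G w u} = {u \<in> A. adj G w u}" by auto
    then have "{u. adj G w u} = {p}" using rooted_grow by simp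
    then have "w \<in> end_vertices G" by (simp add: end_vertices_def valency_def)
    then show ?thesis by blast
  qed
qed

text \<open>The end vectors and the \<open>-E\<^sub>w\<close> with \<open>w \<noteq> v\<close> have
  nonnegative degree at \<open>v\<close>. Once \<open>x\<close> is a nonnegative combination of
  them, a Caratheodory subset extended to a basis gives the cone.\<close>

lemma lipman_cone_basis_cone:
  assumes x: "x \<in> lipman_cone G"
  shows "\<exists>B\<in>bases_in (chamber_vectors G). x \<in> convex_cone hull B \<and>
    convex_cone hull B \<subseteq> {z. 0 \<le> ndeg z v}"
proof -
  define X where "X = dual G ` end_vertices G \<union> (\<lambda>w. - axis w 1) ` (UNIV - {v})"
  have finX: "finite X" by (simp add: X_def)
  have ndx: "0 \<le> ndeg x w" for w using x by (simp add: lipman_cone_iff)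
  \<comment> \<open>Adding \<open>y\<close> to \<open>x\<close> removes all degrees except at the
    ends. So \<open>x + y\<close> is a combination of end vectors, and \<open>-y\<close> one of the
    \<open>-E\<^sub>w\<close>, without \<open>E\<^sub>v\<close> because
    \<open>y v = 0\<close>.\<close>
  obtain y where y: "\<And>u. (0::real) \<le> y u" "y v = 0"
    "\<And>u. 0 \<le> ndeg x u + of_int (b u) * y u - (\<Sum>c | adj G u c. y c)"
    "\<And>u. valency G u \<noteq> 1 \<Longrightarrow> ndeg x u + of_int (b u) * y u - (\<Sum>c | adj G u c. y c) = 0"
    using outward_extension[OF ndx rooted_UNIV[of v]] by auto
  define yv where "yv = (\<chi> u. y u)"
  have nd: "ndeg (x + yv) u = ndeg x u + of_int (b u) * y u - (\<Sum>c | adj G u c. y c)" for u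
    unfolding ndeg_linear ndeg_eq[of yv] by (simp add: yv_def)
  have zero: "ndeg (x + yv) u = 0" if "u \<notin> end_vertices G" for u
    using y(4)[of u] that unfolding nd by (simp add: end_vertices_def)
  have "x + yv = (\<Sum>u\<in>UNIV. ndeg (x + yv) u *\<^sub>R dual G u)" by (rule dual_expansion)
  also have "\<dots> = (\<Sum>u\<in>end_vertices G. ndeg (x + yv) u *\<^sub>R dual G u)"
    by (rule sum.mono_neutral_right) (simp_all add: zero del: ndeg_linear)
  finally have 1: "x + yv = (\<Sum>u\<in>end_vertices G. ndeg (x + yv) u *\<^sub>R dual G u)" .
  have "yv = (\<Sum>w\<in>UNIV. y w *\<^sub>R axis w 1)"
    using basis_expansion[of yv] by (simp add: scalar_mult_eq_scaleR yv_def)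
  also have "\<dots> = (\<Sum>w\<in>UNIV - {v}. y w *\<^sub>R axis w 1)"
    by (rule sum.mono_neutral_right) (auto simp: y(2))
  finally have "- yv = (\<Sum>w\<in>UNIV - {v}. y w *\<^sub>R (- axis w 1))" by (simp add: sum_negf)
  with 1 have "x = (\<Sum>u\<in>end_vertices G. ndeg (x + yv) u *\<^sub>R dual G u) + (\<Sum>w\<in>UNIV - {v}. y w *\<^sub>R (- axis w 1))"
    by (metis add_diff_cancel_right' diff_conv_add_uminus)
  also have "\<dots> \<in> convex_cone hull X"
  proof (intro convex_cone_hull_add convex_cone_hull_sum)
    show "0 \<le> ndeg (x + yv) s" for s using y(3)[of s] nd by simp
  qed (use y(1) in \<open>auto simp: X_def intro: hull_inc\<close>)
  finally obtain B0 where B0: "B0 \<subseteq> X" "independent B0" "x \<in> convex_cone hull B0"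
    by (rule convex_cone_hull_caratheodory[OF finX])
  obtain B where B: "B0 \<subseteq> B" "B \<subseteq> X" "independent B" "X \<subseteq> span B"
    by (rule maximal_independent_subset_extend[OF B0(1,2)])
  have "z \<in> span B" for z
  proof -
    have sX: "s \<in> span B" if "s \<in> X" for s using B(4) that by blast
    have ax: "axis w 1 \<in> span B" if "w \<noteq> v" for w
      using sX[of "- axis w 1"] that span_neg[of "- axis w 1" B] by (simp add: X_def)
    obtain i where i: "i \<in> end_vertices G" using exists_end_vertex by blast
    let ?d = "dual G i"
    have "?d = (\<Sum>w\<in>UNIV. ?d $ w *\<^sub>R axis w 1)"
      using basis_expansion[of ?d] by (simp add: scalar_mult_eq_scaleR)
    also have "\<dots> = ?d $ v *\<^sub>R axis v 1 + (\<Sum>w\<in>UNIV - {v}. ?d $ w *\<^sub>R axis w 1)"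
      by (simp add: sum.remove)
    finally have "?d - (\<Sum>w\<in>UNIV - {v}. ?d $ w *\<^sub>R axis w 1) = ?d $ v *\<^sub>R axis v 1"
      by (simp only: diff_eq_eq)
    \<comment> \<open>\<open>X\<close> omits \<open>-E\<^sub>v\<close>, but an end vector has a
      positive \<open>v\<close>-coordinate and recovers \<open>E\<^sub>v\<close>.\<close>
    then have "axis v 1 = (1 / ?d $ v) *\<^sub>R (?d - (\<Sum>w\<in>UNIV - {v}. ?d $ w *\<^sub>R axis w 1))"
      using dual_pos[of i v] by simp
    also have "\<dots> \<in> span B"
      using sX[of ?d] i ax by (intro span_mul span_diff span_sum) (auto simp: X_def)
    finally have "axis w 1 \<in> span B" for w using ax by (cases "w = v") auto
    then have "(\<Sum>w\<in>UNIV. z $ w *\<^sub>R axis w 1) \<in> span B" by (intro span_sum span_mul)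
    then show ?thesis using basis_expansion[of z] by (simp add: scalar_mult_eq_scaleR)
  qed
  then have "span B = UNIV" by auto
  moreover have "X \<subseteq> chamber_vectors G" by (auto simp: X_def chamber_vectors_def)
  ultimately have "B \<in> bases_in (chamber_vectors G)" using B by (auto simp: bases_in_def)
  moreover have "x \<in> convex_cone hull B" using B0(3) hull_mono[OF B(1), of convex_cone] by auto
  moreover have "convex_cone hull B \<subseteq> {z. 0 \<le> ndeg z v}"
  proof (rule hull_minimal)
    have "0 \<le> ndeg s v" if "s \<in> X" for s
    proof -
      consider i where "s = dual G i" | w where "w \<noteq> v" "s = - axis w 1" using \<open>s \<in> X\<close> by (auto simp: X_def)
      then show ?thesis by cases (simp_all add: dual_properties(2) ndeg_axis)
    qed
    then show "B \<subseteq> {z. 0 \<le> ndeg z v}" using B(2) by auto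
    show "convex_cone {z. 0 \<le> ndeg z v}" by (simp add: convex_cone_iff)
  qed
  ultimately show ?thesis by blast
qed

lemma finite_chamber_vectors: "finite (chamber_vectors G)"
  by (simp add: chamber_vectors_def)

lemma rational_chamber_vectors: "\<forall>c\<in>chamber_vectors G. rational_vec c"
  using rational_dual by (auto simp: chamber_vectors_def rational_vec_def axis_def)

lemma chamber_as_Inter:
  assumes "chamber G C"
  obtains x B0 where "B0 \<in> bases_in (chamber_vectors G)" "x \<in> convex_cone hull B0"
    "C = \<Inter>{convex_cone hull B |B. B \<in> bases_in (chamber_vectors G) \<and> x \<in> convex_cone hull B}"
proof -
  obtain x where x: "x \<in> \<Union>(basis_cones G)" "C = \<Inter>{\<sigma> \<in> basis_cones G. x \<in> \<sigma>}"
    using assms by (auto simp: chamber_def)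
  have bc: "basis_cones G = {convex_cone hull B |B. B \<in> bases_in (chamber_vectors G)}"
    by (simp add: basis_cones_def bases_in_def)
  have eq: "{\<sigma> \<in> basis_cones G. x \<in> \<sigma>} =
      {convex_cone hull B |B. B \<in> bases_in (chamber_vectors G) \<and> x \<in> convex_cone hull B}"
    unfolding bc by blast
  obtain B0 where B0: "B0 \<in> bases_in (chamber_vectors G)" "x \<in> convex_cone hull B0"
    using x(1) unfolding bc by blast
  show thesis by (rule that[OF B0 x(2)[unfolded eq]])
qed

text \<open>Every basis cone through a generic point of the intersection contains \<open>C\<close>,
  and for each \<open>v\<close> one of these cones lies in the half-space
  \<open>n\<^sub>v \<ge> 0\<close>.\<close>

lemma chamber_subset_lipman_cone:
  assumes C: "chamber G C" and meet: "interior (C \<inter> lipman_cone G) \<noteq> {}"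
  shows "C \<subseteq> lipman_cone G"
proof -
  obtain x B0 where x: "B0 \<in> bases_in (chamber_vectors G)" "x \<in> convex_cone hull B0"
    "C = \<Inter>{convex_cone hull B |B. B \<in> bases_in (chamber_vectors G) \<and> x \<in> convex_cone hull B}"
    by (rule chamber_as_Inter[OF C])
  have sub: "interior (C \<inter> lipman_cone G) \<subseteq> C" using interior_subset by blast
  obtain y where y: "y \<in> interior (C \<inter> lipman_cone G)"
    "\<forall>B \<in> bases_in (chamber_vectors G). y \<in> convex_cone hull B \<longrightarrow> C \<subseteq> convex_cone hull B"
  proof (rule generic_chamber_point[OF finite_chamber_vectors rational_chamber_vectors x open_interior meet sub])
    fix y assume "y \<in> interior (C \<inter> lipman_cone G)"
      "\<And>B. B \<in> bases_in (chamber_vectors G) \<Longrightarrow> y \<in> convex_cone hull B \<Longrightarrow> C \<subseteq> convex_cone hull B"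
    then show thesis using that[of y] by simp
  qed
  have yS: "y \<in> lipman_cone G" using y(1) interior_subset by blast
  have "0 \<le> ndeg z v" if "z \<in> C" for z v
  proof -
    obtain B where B: "B \<in> bases_in (chamber_vectors G)" "y \<in> convex_cone hull B"
      "convex_cone hull B \<subseteq> {z. 0 \<le> ndeg z v}"
      using lipman_cone_basis_cone[OF yS, of v] by blast
    have "z \<in> convex_cone hull B" using bspec[OF y(2) B(1)] B(2) that by auto
    then show ?thesis using B(3) by auto
  qed
  then show ?thesis by (auto simp: lipman_cone_iff)
qed

lemma chamber_rational_halfspaces:
  assumes "chamber G C"
  obtains I where "finite I" "\<forall>a\<in>I. rational_vec a" "C = {x. \<forall>a\<in>I. 0 \<le> a \<bullet> x}"
proof -
  obtain x B0 where x: "B0 \<in> bases_in (chamber_vectors G)" "x \<in> convex_cone hull B0"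
    "C = \<Inter>{convex_cone hull B |B. B \<in> bases_in (chamber_vectors G) \<and> x \<in> convex_cone hull B}"
    by (rule chamber_as_Inter[OF assms])
  define \<B> where "\<B> = {B \<in> bases_in (chamber_vectors G). x \<in> convex_cone hull B}"
  define I where "I = (\<Union>B\<in>\<B>. dual_vector B ` B)"
  have sub: "B \<subseteq> chamber_vectors G" "independent B" if "B \<in> \<B>" for B
    using that by (auto simp: \<B>_def bases_in_def)
  have "finite \<B>"
    using sub(1) finite_chamber_vectors by (intro finite_subset[of \<B> "Pow (chamber_vectors G)"]) auto
  moreover have "finite B" if "B \<in> \<B>" for B
    using finite_subset[OF sub(1)[OF that] finite_chamber_vectors] .
  ultimately have 1: "finite I" by (simp add: I_def)
  have 2: "\<forall>a\<in>I. rational_vec a"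
  proof
    fix a assume "a \<in> I"
    then obtain B c where Bc: "B \<in> \<B>" "c \<in> B" "a = dual_vector B c" by (auto simp: I_def)
    have "\<forall>c\<in>B. rational_vec c" using sub(1)[OF Bc(1)] rational_chamber_vectors by blast
    then show "rational_vec a" using dual_vector(1)[OF sub(2)[OF Bc(1)] _ Bc(2)] Bc(3) by simp
  qed
  have "C = (\<Inter>B\<in>\<B>. convex_cone hull B)" unfolding x(3) \<B>_def by blast
  also have "\<dots> = (\<Inter>B\<in>\<B>. {x. \<forall>c\<in>B. 0 \<le> dual_vector B c \<bullet> x})"
    using bases_in_cone[OF _ rational_chamber_vectors] by (simp add: \<B>_def)
  also have "\<dots> = {x. \<forall>a\<in>I. 0 \<le> a \<bullet> x}" by (auto simp: I_def)
  finally have 3: "C = {x. \<forall>a\<in>I. 0 \<le> a \<bullet> x}" .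
  show thesis by (rule that[OF 1 2 3])
qed

end

section \<open>Periodic constants\<close>

lemma is_pcI:
  fixes K :: "(real ^ 'v::finite) set"
  assumes K: "convex_cone K" and dim: "0 < aff_dim K" and l: "l \<in> K"
    and g: "real_polynomial_function g" and eq: "\<And>x. x \<in> latt \<Longrightarrow> x - l \<in> K \<Longrightarrow> f x = g x"
  shows "is_pc K f (g 0)"
proof -
  have "0 \<in> affine hull K" using convex_cone_contains_0[OF K] hull_inc by metis
  then have hull: "affine hull K = span K" by (rule affine_hull_span_0)
  have M: "finite_index_sublattice latt (latt :: (real ^ 'v) set)"
    by (rule finite_index_refl) (auto simp: latt_closed)
  have "finite_index_sublattice (latt \<inter> affine hull K) (latt \<inter> affine hull K)"
    unfolding hull by (rule finite_index_refl) (auto simp: latt_closed span_zero span_diff)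
  then have q: "quasipolynomial_on (latt \<inter> affine hull K) g"
    unfolding quasipolynomial_on_def using g by blast
  show ?thesis
    unfolding is_pc_def
  proof (intro conjI bexI exI)
    show "\<forall>x\<in>latt \<inter> (+) l ` K. f x = g x" using eq by auto
  qed (use dim l M q in auto)
qed

lemma is_pc_pc:
  assumes "is_pc K f q" "\<And>q'. is_pc K f q' \<Longrightarrow> q' = q"
  shows "\<exists>!q. is_pc K f q" and "pc K f = q"
proof -
  show "\<exists>!q. is_pc K f q" using assms by (rule ex1I)
  show "pc K f = q" unfolding pc_def using assms by (rule the_equality)
qed

context plumbing_class
begin

lemma real_polynomial_function_nth: "real_polynomial_function (\<lambda>z::real ^ 'v. z $ i)"
  by (intro real_polynomial_function.intros(1) bounded_linear_vec_nth)

lemma real_polynomial_function_chi: "real_polynomial_function (\<lambda>z. chi (z + r) + c)"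
proof -
  have eq: "(\<lambda>z. chi (z + r) + c) = (\<lambda>z. (\<Sum>v\<in>UNIV. \<Sum>w\<in>UNIV. (z $ v + r $ v) * intersection_matrix G $ v $ w * (z $ w + r $ w)) * (- 1 / 2)
      + (\<Sum>v\<in>UNIV. (1 - of_int (b v) / 2) * (z $ v + r $ v)) + c)"
    by (simp add: chi_def iform_eq)
  show ?thesis
    unfolding eq
    by (intro real_polynomial_function.intros(2-4) real_polynomial_function_sum real_polynomial_function_nth finite)
qed

lemma interior_lipman_ndeg_pos:
  assumes "x \<in> interior (lipman_cone G)"
  shows "0 < ndeg x w"
proof -
  obtain e where e: "e > 0" "ball x e \<subseteq> lipman_cone G" using assms by (auto simp: mem_interior)
  define d where "d = e / (2 * norm (dual G w))"
  have n0: "norm (dual G w) > 0" using dual_pos[of w w] by auto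
  then have "d > 0" using e by (simp add: d_def)
  have "x - d *\<^sub>R dual G w \<in> ball x e" using e n0 by (simp add: d_def dist_norm)
  then have "x - d *\<^sub>R dual G w \<in> lipman_cone G" using e by blast
  then have "0 \<le> ndeg (x - d *\<^sub>R dual G w) w" unfolding lipman_cone_iff by blast
  then show ?thesis using \<open>d > 0\<close> by (simp add: dual_properties)
qed

text \<open>The segment from \<open>E\<^sub>w\<^sup>*\<close> through \<open>x\<close> can be
  prolonged beyond \<open>x\<close> inside the cone, which forces a positive degree at
  \<open>w\<close>.\<close>

lemma rel_interior_node_cone_ndeg_pos:
  assumes x: "x \<in> rel_interior (node_cone G)" and w: "w \<in> nodes G"
  shows "0 < ndeg x w"
proof -
  have conv: "convex (node_cone G)" unfolding node_cone_def by (rule convex_convex_cone_hull)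
  have ne: "node_cone G \<noteq> {}" unfolding node_cone_def by (rule convex_cone_hull_nonempty)
  have "dual G w \<in> node_cone G" using w by (auto simp: node_cone_iff dual_properties)
  then obtain e where e: "e > 1" "(1 - e) *\<^sub>R dual G w + e *\<^sub>R x \<in> node_cone G"
    using convex_rel_interior_iff[OF conv ne, of x] x by auto
  then have "0 \<le> (1 - e) + e * ndeg x w" by (auto simp: node_cone_iff dual_properties dest: spec[of _ w])
  then have "0 < e * ndeg x w" using e(1) by simp
  then show ?thesis using e(1) by (simp add: zero_less_mult_iff)
qed

lemma large_multiple:
  fixes B :: real
  assumes "\<And>w. w \<in> W \<Longrightarrow> 0 < g w"
  shows "\<exists>t\<ge>0. \<forall>w\<in>W. B \<le> t * g (w :: 'v)"
proof -
  define t where "t = (\<Sum>w\<in>W. \<bar>B\<bar> / g w)"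
  have pos: "0 \<le> \<bar>B\<bar> / g w" if "w \<in> W" for w using assms[OF that] by simp
  have 1: "B \<le> t * g w" if "w \<in> W" for w
  proof -
    have "\<bar>B\<bar> / g w \<le> t" unfolding t_def using that pos by (intro member_le_sum) auto
    then have "\<bar>B\<bar> \<le> t * g w" using assms[OF that] by (simp add: field_simps)
    then show ?thesis by simp
  qed
  have 2: "0 \<le> t" unfolding t_def using pos by (rule sum_nonneg)
  show ?thesis using 1 2 by (intro exI[of _ t]) simp
qed

theorem periodic_constants:
  assumes C: "chamber G C" and meet: "interior (C \<inter> lipman_cone G) \<noteq> {}"
    and rel: "C \<inter> rel_interior (node_cone G) \<noteq> {}" and dim: "0 < aff_dim (C \<inter> node_cone G)"
  shows "pc_series_exists G h C \<and> pc_node_series_exists G h (C \<inter> node_cone G) \<and>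
    pc_series G h C = pc_node_series G h (C \<inter> node_cone G)"
proof -
  obtain B c where Bc0: "\<forall>m\<in>latt. (\<forall>w. w \<notin> nodes G \<longrightarrow> 0 \<le> ndeg m w) \<and> (\<forall>w\<in>nodes G. B \<le> ndeg m w) \<longrightarrow>
      Qcount G h m = chi (m + r) + c"
    using Qcount_quadratic by (elim exE)
  have Bc: "\<And>m. m \<in> latt \<Longrightarrow> (\<And>w. w \<notin> nodes G \<Longrightarrow> 0 \<le> ndeg m w) \<Longrightarrow>
      (\<And>w. w \<in> nodes G \<Longrightarrow> B \<le> ndeg m w) \<Longrightarrow> Qcount G h m = chi (m + r) + c"
    using Bc0 by simp
  define g where "g = (\<lambda>z. chi (z + r) + c)"
  have g: "real_polynomial_function g" unfolding g_def by (rule real_polynomial_function_chi)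
  obtain I where I: "finite I" "\<forall>a\<in>I. rational_vec a" "C = {x. \<forall>a\<in>I. 0 \<le> a \<bullet> x}"
    by (rule chamber_rational_halfspaces[OF C])
  obtain a where a: "\<And>w. rational_vec (a w)" "\<And>w x. a w \<bullet> x = ndeg x w"
    using ndeg_rational_vector by blast
  have CS: "C \<subseteq> lipman_cone G" by (rule chamber_subset_lipman_cone[OF C meet])
  have coneC: "convex_cone C" unfolding I(3) by (auto simp: convex_cone_iff inner_simps)
  define K where "K = C \<inter> node_cone G"
  have K: "K = {x. \<forall>a\<in>I \<union> a ` UNIV \<union> (\<lambda>w. - a w) ` (- nodes G). 0 \<le> a \<bullet> x}"
  proof -
    have "x \<in> node_cone G \<longleftrightarrow> (\<forall>c\<in>a ` UNIV \<union> (\<lambda>w. - a w) ` (- nodes G). 0 \<le> c \<bullet> x)" for x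
    proof -
      have "(\<forall>c\<in>a ` UNIV \<union> (\<lambda>w. - a w) ` (- nodes G). 0 \<le> c \<bullet> x) \<longleftrightarrow>
          (\<forall>w. 0 \<le> ndeg x w) \<and> (\<forall>w. w \<notin> nodes G \<longrightarrow> ndeg x w \<le> 0)"
        unfolding ball_Un by (simp add: a) blast
      then show ?thesis unfolding node_cone_iff by (auto intro: antisym)
    qed
    then show ?thesis unfolding K_def I(3) by auto
  qed
  have coneK: "convex_cone K" unfolding K by (auto simp: convex_cone_iff inner_simps)

  have pcC: "is_pc C (Qcount G h) (g 0)"
  proof -
    \<comment> \<open>A multiple of an interior point has degree at least \<open>B\<close> at every
      vertex, and adding elements of \<open>C\<close> preserves this because \<open>C\<close> lies
      in the Lipman cone.\<close>
    obtain x1 where x1: "x1 \<in> interior (C \<inter> lipman_cone G)" using meet by blast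
    have x1C: "x1 \<in> C" using x1 interior_subset by blast
    have "0 < ndeg x1 w" for w
      using x1 interior_mono[of "C \<inter> lipman_cone G" "lipman_cone G"] by (intro interior_lipman_ndeg_pos) auto
    then have "\<exists>t\<ge>0. \<forall>w\<in>UNIV. B \<le> t * ndeg x1 w" by (intro large_multiple)
    then obtain t where t: "0 \<le> t" "\<And>w. B \<le> t * ndeg x1 w" by auto
    have "interior C \<noteq> {}" using C by (simp add: chamber_def)
    then have "0 < aff_dim C" by (simp add: aff_dim_nonempty_interior)
    moreover have "t *\<^sub>R x1 \<in> C" using convex_cone_scaleR[OF coneC t(1) x1C] .
    moreover have "Qcount G h x = g x" if x: "x \<in> latt" "x - t *\<^sub>R x1 \<in> C" for x
    proof -
      have ge: "0 \<le> ndeg (x - t *\<^sub>R x1) w" for w using x(2) CS by (auto simp: lipman_cone_iff)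
      have 0: "0 \<le> t * ndeg x1 w" for w using t(1) \<open>\<And>w. 0 < ndeg x1 w\<close>[of w] by simp
      have le: "t * ndeg x1 w \<le> ndeg x w" for w using ge[of w] by simp
      have "0 \<le> ndeg x w" for w using order_trans[OF 0 le] .
      moreover have "B \<le> ndeg x w" for w using order_trans[OF t(2) le] .
      ultimately show ?thesis unfolding g_def by (intro Bc x(1))
    qed
    ultimately show ?thesis by (intro is_pcI[OF coneC _ _ g])
  qed
  have uniqC: "q = g 0" if "is_pc C (Qcount G h) q" for q
  proof -
    obtain w where w: "w \<in> latt" "w \<in> C" "\<forall>l\<in>C. \<exists>n0::nat. \<forall>n\<ge>n0. real n *\<^sub>R w - l \<in> C"
    proof (rule rational_cone_interior_lattice_point[OF I])
      fix w assume "w \<in> latt" "w \<in> C" "\<And>l. l \<in> C \<Longrightarrow> \<exists>n0::nat. \<forall>n\<ge>n0. real n *\<^sub>R w - l \<in> C"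
      then show thesis using that[of w] by simp
    qed
    show ?thesis by (rule is_pc_unique[OF coneC w(1,2) _ that pcC]) (rule bspec[OF w(3)])
  qed

  have pcK: "is_pc K (\<lambda>l. Qcount_nodes G h (pr G l)) (g 0)"
  proof -
    obtain x2 where x2: "x2 \<in> C" "x2 \<in> rel_interior (node_cone G)" using rel by blast
    have x2K: "x2 \<in> K" using x2 rel_interior_subset by (auto simp: K_def)
    have "\<exists>t\<ge>0. \<forall>w\<in>nodes G. B \<le> t * ndeg x2 w"
      by (intro large_multiple rel_interior_node_cone_ndeg_pos[OF x2(2)])
    then obtain t where t: "0 \<le> t" "\<And>w. w \<in> nodes G \<Longrightarrow> B \<le> t * ndeg x2 w" by auto
    have "t *\<^sub>R x2 \<in> K" using convex_cone_scaleR[OF coneK t(1) x2K] .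
    moreover have "Qcount_nodes G h (pr G x) = g x" if x: "x \<in> latt" "x - t *\<^sub>R x2 \<in> K" for x
    proof -
      have "x = (x - t *\<^sub>R x2) + t *\<^sub>R x2" by simp
      also have "\<dots> \<in> K" using convex_cone_add[OF coneK x(2) convex_cone_scaleR[OF coneK t(1) x2K]] .
      finally have xN: "x \<in> node_cone G" by (simp add: K_def)
      then have "x \<in> node_space G" using node_cone_subset_node_space by blast
      then have "Qcount_nodes G h (pr G x) = Qcount G h x" by (simp add: Qcount_nodes_eq)
      also have "\<dots> = g x"
        unfolding g_def
      proof (rule Bc[OF x(1)])
        show "0 \<le> ndeg x w" for w using xN by (simp add: node_cone_iff)
        have "x - t *\<^sub>R x2 \<in> node_cone G" using x(2) by (simp add: K_def)
        then have le: "t * ndeg x2 w \<le> ndeg x w" for w unfolding node_cone_iff by simp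
        show "B \<le> ndeg x w" if "w \<in> nodes G" for w using order_trans[OF t(2)[OF that] le] .
      qed
      finally show ?thesis .
    qed
    ultimately show ?thesis using dim[folded K_def] by (intro is_pcI[OF coneK _ _ g])
  qed
  have uniqK: "q = g 0" if "is_pc K (\<lambda>l. Qcount_nodes G h (pr G l)) q" for q
  proof -
    have fin: "finite (I \<union> a ` UNIV \<union> (\<lambda>w. - a w) ` (- nodes G))" using I(1) by simp
    have rat: "\<forall>c\<in>I \<union> a ` UNIV \<union> (\<lambda>w. - a w) ` (- nodes G). rational_vec c"
      using I(2) a(1) by (auto simp: rational_vec_def)
    obtain w where w: "w \<in> latt" "w \<in> K" "\<forall>l\<in>K. \<exists>n0::nat. \<forall>n\<ge>n0. real n *\<^sub>R w - l \<in> K"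
    proof (rule rational_cone_interior_lattice_point[OF fin rat K])
      fix w assume "w \<in> latt" "w \<in> K" "\<And>l. l \<in> K \<Longrightarrow> \<exists>n0::nat. \<forall>n\<ge>n0. real n *\<^sub>R w - l \<in> K"
      then show thesis using that[of w] by simp
    qed
    show ?thesis by (rule is_pc_unique[OF coneK w(1,2) _ that pcK]) (rule bspec[OF w(3)])
  qed
  have C1: "\<exists>!q. is_pc C (Qcount G h) q" by (rule is_pc_pc(1)[OF pcC]) (rule uniqC)
  have C2: "pc C (Qcount G h) = g 0" by (rule is_pc_pc(2)[OF pcC]) (rule uniqC)
  have K1: "\<exists>!q. is_pc K (\<lambda>l. Qcount_nodes G h (pr G l)) q" by (rule is_pc_pc(1)[OF pcK]) (rule uniqK)
  have K2: "pc K (\<lambda>l. Qcount_nodes G h (pr G l)) = g 0" by (rule is_pc_pc(2)[OF pcK]) (rule uniqK)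
  show ?thesis
    unfolding pc_series_exists_def pc_node_series_exists_def pc_series_def pc_node_series_def K_def[symmetric] C2 K2
    by (intro conjI C1 K1 refl)
qed

end

theorem theorem5p4p2:
  fixes G :: "'v::finite plumbing" and h :: "(real ^ 'v) set"
  assumes "plumbing_tree G" and "h \<in> Hgroup G"
  shows "
    \<comment> \<open>(a)\<close>
    ((\<forall>l\<^sub>1 \<in> dual_latt G \<inter> node_space G. \<forall>l\<^sub>2 \<in> dual_latt G \<inter> node_space G.
        pr G l\<^sub>1 = pr G l\<^sub>2 \<longrightarrow> Lcount G h l\<^sub>1 = Lcount G h l\<^sub>2) \<and>
     (\<forall>l \<in> dual_latt G \<inter> node_space G. Lcount G h l = Lcount_nodes G h (pr G l)))
    \<and> \<comment> \<open>(b)\<close>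
    ((\<forall>l\<^sub>1 \<in> dual_latt G \<inter> node_space G. \<forall>l\<^sub>2 \<in> dual_latt G \<inter> node_space G.
        pr G l\<^sub>1 = pr G l\<^sub>2 \<longrightarrow> Qcount G h l\<^sub>1 = Qcount G h l\<^sub>2) \<and>
     (\<forall>l \<in> node_space G. l \<in> dual_latt G \<or> pr G l \<in> node_latt G \<longrightarrow>
        Qcount G h l = Qcount_nodes G h (pr G l)) \<and>
     (\<forall>l \<in> node_latt G. Qcount G h l = Qcount_nodes G h l))
    \<and> \<comment> \<open>(c)\<close>
    (\<forall>C. chamber G C \<and> interior (C \<inter> lipman_cone G) \<noteq> {} \<and>
        C \<inter> rel_interior (node_cone G) \<noteq> {} \<and> 0 < aff_dim (C \<inter> node_cone G) \<longrightarrow>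
        pc_series_exists G h C \<and> pc_node_series_exists G h (C \<inter> node_cone G) \<and>
        pc_series G h C = pc_node_series G h (C \<inter> node_cone G))"
proof -
  interpret plumbing_graph G by unfold_locales (rule assms(1))
  have c: "pc_series_exists G h C \<and> pc_node_series_exists G h (C \<inter> node_cone G) \<and>
      pc_series G h C = pc_node_series G h (C \<inter> node_cone G)"
    if C: "chamber G C" "interior (C \<inter> lipman_cone G) \<noteq> {}"
      "C \<inter> rel_interior (node_cone G) \<noteq> {}" "0 < aff_dim (C \<inter> node_cone G)" for C
  proof -
    obtain r where r: "r \<in> dual_latt G" "h = cls G r" "\<And>w. 0 \<le> r $ w" "\<And>w. r $ w < 1"
    proof (rule fractional_representative[OF assms(2)])
      fix r assume "r \<in> dual_latt G" "h = cls G r" "\<And>w. 0 \<le> r $ w" "\<And>w. r $ w < 1"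
      then show thesis by (rule that)
    qed
    \<comment> \<open>Without nodes the node cone is \<open>{0}\<close>, so its positive dimension
      supplies the node required by \<open>plumbing_class\<close>.\<close>
    have "nodes G \<noteq> {}"
    proof
      assume "nodes G = {}"
      then have "C \<inter> node_cone G \<subseteq> {0}" by (auto simp: node_cone_def)
      then have "aff_dim (C \<inter> node_cone G) \<le> aff_dim {0 :: real ^ 'v}" by (rule aff_dim_subset)
      then show False using C(4) by simp
    qed
    then interpret plumbing_class G h r using r by unfold_locales
    show ?thesis by (rule periodic_constants[OF C])
  qed
  have L: "Lcount G h l = Lcount_nodes G h (pr G l)" if "l \<in> node_space G" for l
    using that by (rule Lcount_nodes_eq)
  have Q: "Qcount G h l = Qcount_nodes G h (pr G l)" if "l \<in> node_space G" for l
    using that by (rule Qcount_nodes_eq)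
  show ?thesis
  proof (intro conjI ballI allI impI)
    show "Lcount G h l\<^sub>1 = Lcount G h l\<^sub>2"
      if "l\<^sub>1 \<in> dual_latt G \<inter> node_space G" "l\<^sub>2 \<in> dual_latt G \<inter> node_space G" "pr G l\<^sub>1 = pr G l\<^sub>2" for l\<^sub>1 l\<^sub>2
      using that L[of l\<^sub>1] L[of l\<^sub>2] by simp
    show "Lcount G h l = Lcount_nodes G h (pr G l)" if "l \<in> dual_latt G \<inter> node_space G" for l
      using that L by simp
    show "Qcount G h l\<^sub>1 = Qcount G h l\<^sub>2"
      if "l\<^sub>1 \<in> dual_latt G \<inter> node_space G" "l\<^sub>2 \<in> dual_latt G \<inter> node_space G" "pr G l\<^sub>1 = pr G l\<^sub>2" for l\<^sub>1 l\<^sub>2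
      using that Q[of l\<^sub>1] Q[of l\<^sub>2] by simp
    show "Qcount G h l = Qcount_nodes G h (pr G l)" if "l \<in> node_space G" for l
      using that by (rule Q)
    show "Qcount G h l = Qcount_nodes G h l" if "l \<in> node_latt G" for l
      using that by (rule Qcount_nodes_eq_node_latt)
  qed (use c in auto)
qed

end
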